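(* Let $\alpha\in\mathbb{R}$, $p\in[1,\infty)$, $q\in(0,\infty]$, and let $\mathbf{W}$ be a doubling matrix weight of order $p$ on $\mathbb{R}^d$ (with respect to the expansive dilation $A$). Let $(\varphi,\psi)$ be an admissible pair. Then there exists a constant $C>0$ such that, for every sequence $\vec{s}=\{\vec{s}_Q\}_{Q\in\mathcal{Q}}\in\dot{b}^{\alpha,q}_{p,A}(\mathbf{W})$, $$\left\|T_{\psi}\vec{s}\right\|_{\dot{B}^{\alpha,q}_{p,A}(\mathbb{R}^d,\mathbf{W})}=\left\|\sum_{Q\in\mathcal{Q}}\vec{s}_Q\psi_Q\right\|_{\dot{B}^{\alpha,q}_{p,A}(\mathbb{R}^d,\mathbf{W})}\le C\left\|\{\vec{s}_Q\}_{Q\in\mathcal{Q}}\right\|_{\dot{b}^{\alpha,q}_{p,A}(\mathbf{W})}.$$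
   Context: Dilations. $A$ is a fixed expansive dilation: a real $d\times d$ matrix all of whose (complex) eigenvalues $\lambda$ satisfy $|\lambda|>1$. Fix an ellipsoid $\Delta=\{x\in\mathbb{R}^d:|Px|<1\}$ ($P$ a nondegenerate $d\times d$ matrix) with $|\Delta|=1$ and $\Delta\subset r\Delta\subset A\Delta$ for some $r>1$ (such a $\Delta$ exists). Put $B_k=A^k\Delta$ for $k\in\mathbb{Z}$ and $\mathfrak{B}=\{x+B_k:x\in\mathbb{R}^d,\ k\in\mathbb{Z}\}$ (dilated balls). For $B=x+B_k$, $2B:=x+2B_k$. $A^*$ denotes the transpose of $A$. Matrix weights. Let $\mathcal{H}=\mathbb{C}^m$ with its Euclidean norm $\|\cdot\|$. A matrix weight is a measurable map $\mathbf{W}$ from $\mathbb{R}^d$ to the nonnegative definite $m\times m$ matrices that is invertible almost everywhere. For $p\in[1,\infty)$ and measurable $\vec f:\mathbb{R}^d\to\mathcal{H}$, $\|\vec f\|_{L^p(\mathbf{W})}=\left(\int_{\mathbb{R}^d}\|\mathbf{W}^{1/p}(x)\vec f(x)\|^p\,dx\right)^{1/p}$. The weight $\mathbf{W}$ is a doubling matrix weight of order $p$ if there is a constant $c>0$ such that for all $y\in\mathcal{H}$ and $B\in\mathfrak{B}$, $\int_{2B}\|\mathbf{W}^{1/p}(x)y\|^p\,dx\le c\int_{B}\|\mathbf{W}^{1/p}(x)y\|^p\,dx$. Admissible pairs. The Fourier transform is $\hat f(\xi)=\int f(x)e^{-ix\cdot\xi}\,dx$. An admissible pair $(\varphi,\psi)$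 consists of Schwartz functions on $\mathbb{R}^d$ with $\operatorname{supp}\hat\varphi,\operatorname{supp}\hat\psi\subset[-\pi,\pi]^d\setminus\{\mathbf 0\}$ and $\sum_{k\in\mathbb{Z}}\overline{\hat\varphi((A^* )^{-k}\xi)}\,\hat\psi((A^* )^{-k}\xi)=1$ for all $\xi\in\mathbb{R}^d\setminus\{\mathbf 0\}$. Put $\varphi_k(x)=|\det A|^{k}\varphi(A^{k}x)$. Function space. $\dot{B}^{\alpha,q}_{p,A}(\mathbb{R}^d,\mathbf{W})$ is the set of $\vec f=(f_1,\dots,f_m)^T$ with $f_i\in\mathcal{S}'/\mathcal{P}(\mathbb{R}^d)$ (tempered distributions modulo polynomials) such that $\|\vec f\|_{\dot{B}^{\alpha,q}_{p,A}(\mathbb{R}^d,\mathbf{W})}=\left(\sum_{k\in\mathbb{Z}}|\det A|^{k\alpha q}\|\vec f*\varphi_k\|_{L^p(\mathbf{W})}^q\right)^{1/q}<\infty$ (supremum over $k$ if $q=\infty$), where the convolution is componentwise and $\varphi$ is the first member of the fixed admissible pair. Sequence space. For $\mathbf{j}\in\mathbb{Z}^d$, $k\in\mathbb{Z}$ let $Q_{\mathbf{j},k}=A^{-k}([0,1]^d+\mathbf{j})$, $x_{Q_{\mathbf{j},k}}=A^{-k}\mathbf{j}$, and $\mathcal{Q}=\{Q_{\mathbf{j},k}:k\in\mathbb{Z},\ \mathbf{j}\in\mathbb{Z}^d\}$, so that $|Q_{\mathbf{j},k}|=|\det A|^{-k}$. $\dot{b}^{\alpha,q}_{p,A}(\mathbf{W})$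 is the set of sequences $\vec s=\{\vec s_Q\}_{Q\in\mathcal{Q}}$, $\vec s_Q\in\mathcal{H}$, such that $$\|\vec s\|_{\dot{b}^{\alpha,q}_{p,A}(\mathbf{W})}=\left(\sum_{k\in\mathbb{Z}}|\det A|^{k\alpha q}\left\|\sum_{|Q|=|\det A|^{-k}}|Q|^{-1/2}\,\|\mathbf{W}^{1/p}(x)\vec s_Q\|\,\mathbf{1}_Q(x)\right\|_{L^p(dx)}^q\right)^{1/q}<\infty$$ (supremum over $k$ if $q=\infty$). Inverse $\varphi$-transform. For $Q=Q_{\mathbf{j},k}$, $\psi_Q(x)=|\det A|^{k/2}\psi(A^kx-\mathbf{j})$, and $T_\psi\vec s=\sum_{Q\in\mathcal{Q}}\vec s_Q\psi_Q$, the series being understood componentwise in $\mathcal{S}'/\mathcal{P}(\mathbb{R}^d)$. *)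

theory Defs
  imports "HOL-Analysis.Analysis"
begin

section \<open>Matrices\<close>

text \<open>The class operations \<open>*\<close> and \<open>^\<close> on \<open>real^'d^'d\<close> act entrywise, so integer
  powers with respect to the matrix product need their own definition.\<close>

definition mat_zpow :: "'a::field^'d^'d \<Rightarrow> int \<Rightarrow> 'a^'d^'d" where
  "mat_zpow A k =
     (if 0 \<le> k then (((**) A) ^^ nat k) (mat 1)
      else (((**) (matrix_inv A)) ^^ nat (- k)) (mat 1))"

definition conj_transpose :: "complex^'n^'m \<Rightarrow> complex^'m^'n" where
  "conj_transpose M = map_matrix cnj (transpose M)"

definition unitary_mat :: "complex^'m^'m \<Rightarrow> bool" where
  "unitary_mat U \<longleftrightarrow> conj_transpose U ** U = mat 1 \<and> U ** conj_transpose U = mat 1"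

definition real_diag :: "('m \<Rightarrow> real) \<Rightarrow> complex^'m^'m" where
  "real_diag d = (\<chi> i j. if i = j then complex_of_real (d i) else 0)"

definition nonneg_definite :: "complex^'m^'m \<Rightarrow> bool" where
  "nonneg_definite M \<longleftrightarrow>
     conj_transpose M = M \<and> (\<forall>y. 0 \<le> Re (\<Sum>i\<in>UNIV. cnj (y $ i) * (M *v y) $ i))"

text \<open>Real powers of a nonnegative definite matrix by the spectral calculus:
  \<open>M = U diag(d) U\<^sup>*\<close> with \<open>U\<close> unitary and \<open>d \<ge> 0\<close> gives
  \<open>M\<^sup>s = U diag(d\<^sup>s) U\<^sup>*\<close>, independently of the diagonalisation.
  It is used for \<open>s > 0\<close> only, where \<open>0 powr s = 0\<close> is the intended value.\<close>

definition psd_powr :: "complex^'m^'m \<Rightarrow> real \<Rightarrow> complex^'m^'m" where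
  "psd_powr M s = (THE N. \<exists>U d. unitary_mat U \<and> (\<forall>i. 0 \<le> d i) \<and>
      M = U ** real_diag d ** conj_transpose U \<and>
      N = U ** real_diag (\<lambda>i. d i powr s) ** conj_transpose U)"


section \<open>Expansive dilations and dilated balls\<close>

definition expansive :: "real^'d^'d \<Rightarrow> bool" where
  "expansive A \<longleftrightarrow>
     (\<forall>(l::complex) v. v \<noteq> 0 \<and> map_matrix complex_of_real A *v v = l *s v \<longrightarrow> 1 < norm l)"

definition dilation_ellipsoid :: "real^'d^'d \<Rightarrow> (real^'d) set \<Rightarrow> bool" where
  "dilation_ellipsoid A \<Delta> \<longleftrightarrow>
     (\<exists>P::real^'d^'d. invertible P \<and> \<Delta> = {x. norm (P *v x) < 1}) \<and>
     emeasure lebesgue \<Delta> = 1 \<and>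
     (\<exists>r>1. \<Delta> \<subseteq> (*\<^sub>R) r ` \<Delta> \<and> (*\<^sub>R) r ` \<Delta> \<subseteq> (*v) A ` \<Delta>)"

definition dball0 :: "real^'d^'d \<Rightarrow> (real^'d) set \<Rightarrow> int \<Rightarrow> (real^'d) set" where
  "dball0 A \<Delta> k = (*v) (mat_zpow A k) ` \<Delta>"


section \<open>Extended nonnegative powers and norms\<close>

text \<open>Used for exponents \<open>a > 0\<close> only.\<close>

definition ennpowr :: "ennreal \<Rightarrow> real \<Rightarrow> ennreal" where
  "ennpowr x a = (if x = \<infinity> then \<infinity> else ennreal (enn2real x powr a))"

definition Lp_norm :: "real \<Rightarrow> (real^'d \<Rightarrow> ennreal) \<Rightarrow> ennreal" where
  "Lp_norm p g = ennpowr (\<integral>\<^sup>+ x. ennpowr (g x) p \<partial>lebesgue) (1 / p)"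

definition lq_norm :: "ennreal \<Rightarrow> (int \<Rightarrow> ennreal) \<Rightarrow> ennreal" where
  "lq_norm q a =
     (if q = \<infinity> then (SUP k. a k)
      else ennpowr (\<Sum>\<^sub>\<infinity>k. ennpowr (a k) (enn2real q)) (1 / enn2real q))"


section \<open>Matrix weights\<close>

definition matrix_weight :: "(real^'d \<Rightarrow> complex^'m^'m) \<Rightarrow> bool" where
  "matrix_weight W \<longleftrightarrow>
     W \<in> borel_measurable lebesgue \<and> (\<forall>x. nonneg_definite (W x)) \<and>
     (AE x in lebesgue. invertible (W x))"

definition wnorm :: "real \<Rightarrow> (real^'d \<Rightarrow> complex^'m^'m) \<Rightarrow> real^'d \<Rightarrow> complex^'m \<Rightarrow> real" where
  "wnorm p W x y = norm (psd_powr (W x) (1 / p) *v y)"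

text \<open>For \<open>B = x + B\<^sub>k\<close> the set \<open>2B\<close> is \<open>x + 2B\<^sub>k\<close>: the dilation by 2 is about the centre of
  the ball. The integrals may be infinite.\<close>

definition doubling_weight ::
  "real^'d^'d \<Rightarrow> (real^'d) set \<Rightarrow> real \<Rightarrow> (real^'d \<Rightarrow> complex^'m^'m) \<Rightarrow> bool" where
  "doubling_weight A \<Delta> p W \<longleftrightarrow> matrix_weight W \<and>
     (\<exists>c>0. \<forall>y x k.
        (\<integral>\<^sup>+ z \<in> (+) x ` (*\<^sub>R) 2 ` dball0 A \<Delta> k. ennreal (wnorm p W z y powr p) \<partial>lebesgue)
        \<le> ennreal c * (\<integral>\<^sup>+ z \<in> (+) x ` dball0 A \<Delta> k. ennreal (wnorm p W z y powr p) \<partial>lebesgue))"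

definition LpW_norm ::
  "real \<Rightarrow> (real^'d \<Rightarrow> complex^'m^'m) \<Rightarrow> (real^'d \<Rightarrow> complex^'m) \<Rightarrow> ennreal" where
  "LpW_norm p W f = Lp_norm p (\<lambda>x. ennreal (wnorm p W x (f x)))"


section \<open>Schwartz functions\<close>

definition partial_deriv :: "'d::finite \<Rightarrow> (real^'d \<Rightarrow> complex) \<Rightarrow> real^'d \<Rightarrow> complex" where
  "partial_deriv i f = (\<lambda>x. frechet_derivative f (at x) (axis i 1))"

text \<open>A list \<open>js\<close> of coordinates stands for the corresponding iterated partial derivative.\<close>

abbreviation partial_derivs :: "'d::finite list \<Rightarrow> (real^'d \<Rightarrow> complex) \<Rightarrow> real^'d \<Rightarrow> complex" where
  "partial_derivs js f \<equiv> foldr partial_deriv js f"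

definition schwartz :: "(real^'d \<Rightarrow> complex) set" where
  "schwartz = {f. \<forall>js. (\<forall>x. partial_derivs js f differentiable (at x)) \<and>
      (\<forall>N::nat. \<exists>c. \<forall>x. (1 + norm x) ^ N * norm (partial_derivs js f x) \<le> c)}"

definition schwartz_seminorm :: "nat \<Rightarrow> (real^'d \<Rightarrow> complex) \<Rightarrow> real" where
  "schwartz_seminorm N f =
     (SUP (js, x) \<in> {js. length js \<le> N} \<times> UNIV. (1 + norm x) ^ N * norm (partial_derivs js f x))"

definition fourier :: "(real^'d \<Rightarrow> complex) \<Rightarrow> real^'d \<Rightarrow> complex" where
  "fourier f \<xi> = (LINT x|lebesgue. f x * exp (- (\<i> * complex_of_real (x \<bullet> \<xi>))))"

definition admissible_pair ::
  "real^'d^'d \<Rightarrow> (real^'d \<Rightarrow> complex) \<Rightarrow> (real^'d \<Rightarrow> complex) \<Rightarrow> bool" where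
  "admissible_pair A \<phi> \<psi> \<longleftrightarrow>
     \<phi> \<in> schwartz \<and> \<psi> \<in> schwartz \<and>
     closure {\<xi>. fourier \<phi> \<xi> \<noteq> 0} \<subseteq> {\<xi>. \<forall>i. \<xi> $ i \<in> {- pi..pi}} - {0} \<and>
     closure {\<xi>. fourier \<psi> \<xi> \<noteq> 0} \<subseteq> {\<xi>. \<forall>i. \<xi> $ i \<in> {- pi..pi}} - {0} \<and>
     (\<forall>\<xi>. \<xi> \<noteq> 0 \<longrightarrow>
        ((\<lambda>k::int. cnj (fourier \<phi> (mat_zpow (transpose A) (- k) *v \<xi>)) *
                   fourier \<psi> (mat_zpow (transpose A) (- k) *v \<xi>)) has_sum 1) UNIV)"

definition dilate :: "real^'d^'d \<Rightarrow> (real^'d \<Rightarrow> complex) \<Rightarrow> int \<Rightarrow> real^'d \<Rightarrow> complex" where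
  "dilate A \<phi> k x = complex_of_real (\<bar>det A\<bar> powi k) * \<phi> (mat_zpow A k *v x)"


section \<open>Tempered distributions modulo polynomials\<close>

text \<open>Tempered distributions are the continuous complex-linear functionals on the Schwartz
  functions, taken \<^const>\<open>extensional\<close> so that equal functionals are equal as HOL functions.\<close>

type_synonym 'd functional = "(real^'d \<Rightarrow> complex) \<Rightarrow> complex"

definition tempered :: "'d::finite functional set" where
  "tempered = {u \<in> extensional schwartz.
     (\<forall>f\<in>schwartz. \<forall>g\<in>schwartz. u (\<lambda>x. f x + g x) = u f + u g) \<and>
     (\<forall>a. \<forall>f\<in>schwartz. u (\<lambda>x. a * f x) = a * u f) \<and>
     (\<exists>c N. \<forall>f\<in>schwartz. norm (u f) \<le> c * schwartz_seminorm N f)}"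

definition regular_dist :: "(real^'d \<Rightarrow> complex) \<Rightarrow> 'd functional" where
  "regular_dist g = (\<lambda>f\<in>schwartz. LINT x|lebesgue. g x * f x)"

definition mod_poly :: "('d::finite functional \<times> 'd functional) set" where
  "mod_poly = {(u, v). u \<in> tempered \<and> v \<in> tempered \<and>
     (\<exists>P. polynomial_function P \<and> (\<forall>f\<in>schwartz. u f - v f = regular_dist P f))}"

text \<open>The elements of \<open>\<S>'/\<P>\<close> are the equivalence classes.\<close>

definition tempered_mod_poly :: "'d::finite functional set set" where
  "tempered_mod_poly = tempered // mod_poly"

text \<open>\<open>\<S>'\<close> carries the weak-star topology (pointwise convergence on Schwartz functions) and
  \<open>\<S>'/\<P>\<close> the quotient topology.\<close>

definition tempered_topology :: "'d::finite functional topology" where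
  "tempered_topology = subtopology (product_topology (\<lambda>_. euclidean) schwartz) tempered"

definition tempered_mod_poly_topology :: "'d::finite functional set topology" where
  "tempered_mod_poly_topology = topology (\<lambda>U. U \<subseteq> tempered_mod_poly \<and>
     openin tempered_topology {u \<in> tempered. mod_poly `` {u} \<in> U})"

lemma topspace_tempered_topology: "topspace tempered_topology = tempered"
  by (auto simp: tempered_topology_def tempered_def PiE_def)

lemma openin_tempered_mod_poly_topology:
  fixes U :: "'d::finite functional set set"
  shows "openin tempered_mod_poly_topology U \<longleftrightarrow> U \<subseteq> tempered_mod_poly \<and>
     openin tempered_topology {u \<in> tempered. mod_poly `` {u} \<in> U}"
proof -
  have "istopology (\<lambda>U :: 'd functional set set. U \<subseteq> tempered_mod_poly \<and>
     openin tempered_topology {u \<in> tempered. mod_poly `` {u} \<in> U})"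
    unfolding istopology_def
  proof (rule conjI; intro allI impI)
    fix S T :: "'d functional set set"
    assume S: "S \<subseteq> tempered_mod_poly \<and> openin tempered_topology {u \<in> tempered. mod_poly `` {u} \<in> S}"
      and T: "T \<subseteq> tempered_mod_poly \<and> openin tempered_topology {u \<in> tempered. mod_poly `` {u} \<in> T}"
    have sub: "S \<inter> T \<subseteq> tempered_mod_poly" using S by blast
    have "{u \<in> tempered. mod_poly `` {u} \<in> S \<inter> T} =
        {u \<in> tempered. mod_poly `` {u} \<in> S} \<inter> {u \<in> tempered. mod_poly `` {u} \<in> T}" by blast
    then have "openin tempered_topology {u \<in> tempered. mod_poly `` {u} \<in> S \<inter> T}"
      using openin_Int[OF conjunct2[OF S] conjunct2[OF T]] by (rule ssubst)
    with sub show "S \<inter> T \<subseteq> tempered_mod_poly \<and>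
      openin tempered_topology {u \<in> tempered. mod_poly `` {u} \<in> S \<inter> T}" by blast
  next
    fix K :: "'d functional set set set"
    assume K: "\<forall>U\<in>K. U \<subseteq> tempered_mod_poly \<and>
      openin tempered_topology {u \<in> tempered. mod_poly `` {u} \<in> U}"
    have sub: "\<Union>K \<subseteq> tempered_mod_poly" using K by blast
    have "{u \<in> tempered. mod_poly `` {u} \<in> \<Union>K} =
        \<Union>((\<lambda>U. {u \<in> tempered. mod_poly `` {u} \<in> U}) ` K)" by blast
    moreover have "openin tempered_topology (\<Union>((\<lambda>U. {u \<in> tempered. mod_poly `` {u} \<in> U}) ` K))"
      using K by (intro openin_Union) auto
    ultimately show "\<Union>K \<subseteq> tempered_mod_poly \<and>
      openin tempered_topology {u \<in> tempered. mod_poly `` {u} \<in> \<Union>K}" using sub by (simp only: simp_thms)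
  qed
  then show ?thesis
    unfolding tempered_mod_poly_topology_def by (simp only: topology_inverse')
qed

lemma topspace_tempered_mod_poly_topology:
  "topspace tempered_mod_poly_topology = tempered_mod_poly"
proof -
  have eq: "{u \<in> tempered. mod_poly `` {u} \<in> tempered_mod_poly} = topspace tempered_topology"
    by (auto simp: topspace_tempered_topology tempered_mod_poly_def quotient_def)
  have "openin tempered_mod_poly_topology tempered_mod_poly"
    unfolding openin_tempered_mod_poly_topology eq by (rule conjI[OF order_refl openin_topspace])
  moreover have "topspace tempered_mod_poly_topology \<subseteq> tempered_mod_poly"
    using openin_tempered_mod_poly_topology openin_topspace by blast
  ultimately show ?thesis
    by (meson openin_subset subset_antisym)
qed

lemma quotient_map_mod_poly:
  "quotient_map tempered_topology tempered_mod_poly_topology (\<lambda>u. mod_poly `` {u})"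
  unfolding quotient_map_def topspace_tempered_mod_poly_topology topspace_tempered_topology
proof (intro conjI allI impI)
  show "(\<lambda>u. mod_poly `` {u}) ` tempered = tempered_mod_poly"
    by (auto simp: tempered_mod_poly_def quotient_def)
  fix U :: "'a functional set set"
  assume "U \<subseteq> tempered_mod_poly"
  then show "openin tempered_topology {u \<in> tempered. mod_poly `` {u} \<in> U} =
      openin tempered_mod_poly_topology U"
    by (simp only: openin_tempered_mod_poly_topology simp_thms)
qed

text \<open>The convolution \<open>(u * g)(x) = u(g(x - \<cdot>))\<close> of a class with a Schwartz function. It does not
  depend on the representative \<open>u\<close> when all moments of \<open>g\<close> vanish, as they do for the first
  function of an admissible pair and its dilates.\<close>

definition conv_class ::
  "'d::finite functional set \<Rightarrow> (real^'d \<Rightarrow> complex) \<Rightarrow> real^'d \<Rightarrow> complex" where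
  "conv_class F g x = (SOME u. u \<in> F) (\<lambda>y. g (x - y))"


section \<open>Besov spaces\<close>

definition besov_norm :: "real \<Rightarrow> ennreal \<Rightarrow> real \<Rightarrow> real^'d^'d \<Rightarrow> (real^'d \<Rightarrow> complex) \<Rightarrow>
    (real^'d \<Rightarrow> complex^'m^'m) \<Rightarrow> ('d functional set)^'m \<Rightarrow> ennreal" where
  "besov_norm \<alpha> q p A \<phi> W F =
     lq_norm q (\<lambda>k. ennreal (\<bar>det A\<bar> powr (real_of_int k * \<alpha>)) *
       LpW_norm p W (\<lambda>x. \<chi> i. conv_class (F $ i) (dilate A \<phi> k) x))"

definition besov_space :: "real \<Rightarrow> ennreal \<Rightarrow> real \<Rightarrow> real^'d^'d \<Rightarrow> (real^'d \<Rightarrow> complex) \<Rightarrow>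
    (real^'d \<Rightarrow> complex^'m^'m) \<Rightarrow> (('d functional set)^'m) set" where
  "besov_space \<alpha> q p A \<phi> W =
     {F. (\<forall>i. F $ i \<in> tempered_mod_poly) \<and> besov_norm \<alpha> q p A \<phi> W F < \<infinity>}"

text \<open>A family indexed by the dilated cubes \<open>Q\<^sub>j\<^sub>,\<^sub>k\<close> is written as a function of the
  index \<open>(j, k)\<close>. For expansive \<open>A\<close> distinct indices give distinct cubes, and the cubes of
  measure \<open>\<bar>det A\<bar>\<^sup>-\<^sup>k\<close> are those of level \<open>k\<close>.\<close>

definition ivec :: "int^'d \<Rightarrow> real^'d" where
  "ivec j = (\<chi> i. real_of_int (j $ i))"

definition dcube :: "real^'d^'d \<Rightarrow> int^'d \<Rightarrow> int \<Rightarrow> (real^'d) set" where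
  "dcube A j k = (*v) (mat_zpow A (- k)) ` {x. \<forall>i. x $ i \<in> {real_of_int (j $ i)..real_of_int (j $ i) + 1}}"

definition besov_seq_norm :: "real \<Rightarrow> ennreal \<Rightarrow> real \<Rightarrow> real^'d^'d \<Rightarrow>
    (real^'d \<Rightarrow> complex^'m^'m) \<Rightarrow> ((int^'d) \<times> int \<Rightarrow> complex^'m) \<Rightarrow> ennreal" where
  "besov_seq_norm \<alpha> q p A W s =
     lq_norm q (\<lambda>k. ennreal (\<bar>det A\<bar> powr (real_of_int k * \<alpha>)) *
       Lp_norm p (\<lambda>x. \<Sum>\<^sub>\<infinity>j. ennreal (measure lebesgue (dcube A j k) powr (- 1 / 2) *
         wnorm p W x (s (j, k)) * indicator (dcube A j k) x)))"

definition besov_seq_space :: "real \<Rightarrow> ennreal \<Rightarrow> real \<Rightarrow> real^'d^'d \<Rightarrow>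
    (real^'d \<Rightarrow> complex^'m^'m) \<Rightarrow> ((int^'d) \<times> int \<Rightarrow> complex^'m) set" where
  "besov_seq_space \<alpha> q p A W = {s. besov_seq_norm \<alpha> q p A W s < \<infinity>}"


section \<open>The inverse transform\<close>

definition psi_cube :: "real^'d^'d \<Rightarrow> (real^'d \<Rightarrow> complex) \<Rightarrow> (int^'d) \<times> int \<Rightarrow> real^'d \<Rightarrow> complex" where
  "psi_cube A \<psi> = (\<lambda>(j, k) x.
     complex_of_real (\<bar>det A\<bar> powr (real_of_int k / 2)) * \<psi> (mat_zpow A k *v x - ivec j))"

text \<open>\<open>F = \<Sum>\<^sub>Q s\<^sub>Q \<psi>\<^sub>Q\<close>: every component converges unconditionally in \<open>\<S>'/\<P>\<close>,
  that is, along the net of finite partial sums.\<close>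

definition inv_transform_has_sum :: "real^'d^'d \<Rightarrow> (real^'d \<Rightarrow> complex) \<Rightarrow>
    ((int^'d) \<times> int \<Rightarrow> complex^'m) \<Rightarrow> ('d functional set)^'m \<Rightarrow> bool" where
  "inv_transform_has_sum A \<psi> s F \<longleftrightarrow> (\<forall>i.
     limitin tempered_mod_poly_topology
       (\<lambda>J. mod_poly `` {regular_dist (\<lambda>x. \<Sum>Q\<in>J. s Q $ i * psi_cube A \<psi> Q x)})
       (F $ i) (finite_subsets_at_top UNIV))"

text \<open>The sum is unique because the quotient topology is Hausdorff, so the choice is harmless.\<close>

definition inv_transform :: "real^'d^'d \<Rightarrow> (real^'d \<Rightarrow> complex) \<Rightarrow>
    ((int^'d) \<times> int \<Rightarrow> complex^'m) \<Rightarrow> ('d functional set)^'m" where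
  "inv_transform A \<psi> s = (SOME F. inv_transform_has_sum A \<psi> s F)"

end

theory Submission
  imports Defs
begin

text \<open>
  Let \<open>Q = Q\<^sub>j\<^sub>,\<^sub>l\<close>. The Fourier transforms of \<open>\<phi>\<close> and \<open>\<psi>\<close> vanish near the origin, so all moments of
  both functions vanish (\<open>moment_free_fourier\<close>). In the integral defining \<open>\<psi>\<^sub>Q * \<phi>\<^sub>k\<close> the factor living on the
  coarser scale may therefore be replaced by its Taylor remainder, and the ratio of the scales enters to
  an arbitrarily high power (\<open>vanishing_moment_bound\<close>). The result is the almost orthogonality estimate
  \<open>\<bar>\<psi>\<^sub>Q * \<phi>\<^sub>k (x)\<bar> \<le> C \<bar>Q\<bar>\<^sup>-\<^sup>1\<^sup>/\<^sup>2 \<theta>\<^sup>\<bar>\<^sup>k\<^sup>-\<^sup>l\<^sup>\<bar> (1 + \<bar>A\<^sup>l x - j\<bar>)\<^sup>-\<^sup>N\<close>,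
  with \<open>\<theta> > 0\<close> as small and \<open>N\<close> as large as desired (\<open>almost_orthogonality\<close>).

  For the norm estimate, the length of \<open>W\<^sup>1\<^sup>/\<^sup>p(x) (T\<^sub>\<psi> s * \<phi>\<^sub>k)(x)\<close> is at most the sum over \<open>Q\<close> of these kernels
  times the lengths of \<open>W\<^sup>1\<^sup>/\<^sup>p(x) s\<^sub>Q\<close>. Every term involves a single vector \<open>y = s\<^sub>Q\<close>, so only the scalar
  doubling weights \<open>w\<^sub>y(x) = \<parallel>W\<^sup>1\<^sup>/\<^sup>p(x) y\<parallel>\<^sup>p\<close> matter. Doubling bounds the \<open>w\<^sub>y\<close>-measure of \<open>Q\<^sub>i\<^sub>,\<^sub>l\<close> by
  \<open>C (1 + \<bar>i - j\<bar>)\<^sup>n\<close> times that of \<open>Q\<^sub>j\<^sub>,\<^sub>l\<close>, uniformly in \<open>y\<close> and \<open>l\<close> (\<open>doubling_cubes\<close>); hence the tail of the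
  kernel away from \<open>Q\<close> costs only a constant (\<open>weighted_tail\<close>). What remains is a discrete convolution in
  the level variable with a geometric kernel, which is bounded on the sequence space of exponent \<open>q\<close> for
  every \<open>q > 0\<close> (\<open>lq_norm_geometric_convolution\<close>). Powers of infinite sums, with exponents on either side
  of \<open>1\<close>, are handled throughout by giving up part of the decay (\<open>ennpowr_sum_weighted\<close>).

  For the convergence, doubling and the finiteness of the sequence norm force \<open>s\<^sub>Q\<close> to grow at most
  exponentially in the level and polynomially in \<open>j\<close> (\<open>coefficient_growth\<close>). On fine levels, the pairing of
  \<open>\<psi>\<^sub>Q\<close> with a Schwartz function decays faster than any given exponential by the vanishing moments of \<open>\<psi>\<close>. On
  coarse levels, the same decay appears after the Taylor polynomial of \<open>\<psi>\<^sub>Q\<close> at the origin is subtracted,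
  which does not change the class of \<open>\<psi>\<^sub>Q\<close> modulo polynomials (\<open>psi_mod_pairing_bound\<close>). The corrected series
  converges absolutely in the weak-star sense, and the quotient map carries its sum to a sum of the
  original series. Conversely, the pairing with \<open>\<phi>\<^sub>k(x - \<cdot>)\<close> is well defined and continuous on the quotient,
  so the convolution of any sum with \<open>\<phi>\<^sub>k\<close> may be computed term by term (\<open>conv_class_inv_transform\<close>).

  The scalar weights are measurable because the spectral power of a matrix is a pointwise limit of
  polynomials in the matrix (\<open>psd_powr_limit_of_polynomials\<close>).
\<close>

section \<open>Powers of nonnegative definite matrices\<close>

definition cinner :: "complex^'m \<Rightarrow> complex^'m \<Rightarrow> complex" where
  "cinner x y = (\<Sum>i\<in>UNIV. cnj (x $ i) * y $ i)"

lemma Re_cinner: "Re (cinner x y) = x \<bullet> y"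
  by (simp add: cinner_def inner_vec_def inner_complex_def)

lemma cinner_scale_right: "cinner x (c *s y) = c * cinner x y"
  by (simp add: cinner_def sum_distrib_left mult_ac)

lemma cinner_scale_left: "cinner (c *s x) y = cnj c * cinner x y"
  by (simp add: cinner_def sum_distrib_left mult_ac)

lemma cinner_add_right: "cinner x (y + z) = cinner x y + cinner x z"
  by (simp add: cinner_def sum.distrib algebra_simps)

lemma cinner_eq_0_iff_inner: "cinner x y = 0 \<longleftrightarrow> x \<bullet> y = 0 \<and> (\<i> *s x) \<bullet> y = 0"
  by (simp add: Re_cinner[symmetric] cinner_scale_left complex_eq_iff)

lemma cinner_commute: "cinner y x = cnj (cinner x y)"
  by (simp add: cinner_def mult.commute)

lemma cinner_self: "cinner x x = complex_of_real ((norm x)\<^sup>2)"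
proof (rule complex_eqI)
  show "Im (cinner x x) = Im (complex_of_real ((norm x)\<^sup>2))"
    by (simp add: cinner_def)
qed (simp add: Re_cinner power2_norm_eq_inner)

lemma cinner_mult_right: "cinner x (M *v y) = cinner (conj_transpose M *v x) y"
proof -
  have "cinner x (M *v y) = (\<Sum>i\<in>UNIV. \<Sum>j\<in>UNIV. cnj (x $ i) * (M $ i $ j * y $ j))"
    by (simp add: cinner_def matrix_vector_mult_def sum_distrib_left)
  also have "\<dots> = (\<Sum>j\<in>UNIV. \<Sum>i\<in>UNIV. cnj (x $ i) * (M $ i $ j * y $ j))" by (rule sum.swap)
  also have "\<dots> = cinner (conj_transpose M *v x) y"
    by (simp add: cinner_def matrix_vector_mult_def conj_transpose_def map_matrix_def transpose_def
        sum_distrib_right sum_distrib_left mult_ac)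
  finally show ?thesis .
qed

lemma matrix_vector_mult_scale_complex: "(M::complex^'n^'m) *v (c *s x) = c *s (M *v x)"
  by (simp add: vec_eq_iff matrix_vector_mult_def sum_distrib_left mult_ac)

lemma scaleR_eq_scale_complex: "r *\<^sub>R (x::complex^'m) = complex_of_real r *s x"
  by (simp add: vec_eq_iff scaleR_conv_of_real[where 'a = complex])

text \<open>A unit vector of \<open>K\<close> that maximises the Rayleigh quotient is an eigenvector. The
  variation is carried out in the real inner product, which is why \<open>K\<close> is a real subspace.\<close>
lemma hermitian_eigenvector_in_subspace:
  fixes M :: "complex^'m^'m"
  assumes M: "conj_transpose M = M" and K: "subspace K" "\<And>y. y \<in> K \<Longrightarrow> M *v y \<in> K"
    and y0: "y0 \<in> K" "y0 \<noteq> 0"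
  shows "\<exists>v\<in>K. \<exists>l::real. norm v = 1 \<and> M *v v = l *\<^sub>R v"
proof -
  have lin: "linear ((*v) M)"
    by (intro linearI) (auto simp: vec.add scaleR_eq_scale_complex matrix_vector_mult_scale_complex)
  have adj: "x \<bullet> (M *v y) = y \<bullet> (M *v x)" for x y
    using cinner_mult_right[of x M y] M
    by (metis Re_cinner inner_commute)
  let ?q = "\<lambda>y. y \<bullet> (M *v y)"
  let ?S = "K \<inter> sphere 0 1"
  have "compact ?S" using closed_subspace[OF K(1)] by (simp add: closed_Int_compact)
  moreover have "y0 /\<^sub>R norm y0 \<in> ?S" using y0 K(1) by (simp add: subspace_scale)
  then have "?S \<noteq> {}" by blast
  moreover have "continuous_on ?S ?q"
    by (intro continuous_intros linear_continuous_on linear_conv_bounded_linear[THEN iffD1] lin)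
  ultimately obtain v where v: "v \<in> ?S" and max: "\<And>y. y \<in> ?S \<Longrightarrow> ?q y \<le> ?q v"
    using continuous_attains_sup[of ?S ?q] by blast
  define l where "l = ?q v"
  have nv: "v \<bullet> v = 1" using v by (simp add: norm_eq_1)
  have le: "?q y \<le> l * (y \<bullet> y)" if "y \<in> K" for y
  proof (cases "y = 0")
    case False
    have "y /\<^sub>R norm y \<in> ?S" using that K(1) False by (simp add: subspace_scale)
    from max[OF this] have "?q y / (norm y * norm y) \<le> l"
      by (simp add: l_def linear_scale[OF lin] field_simps)
    then show ?thesis using False by (simp add: field_simps dot_square_norm power2_eq_square)
  qed (simp add: linear_0[OF lin])
  define w where "w = l *\<^sub>R v - M *v v"
  have wK: "w \<in> K" using v K by (simp add: w_def subspace_diff subspace_scale)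
  \<comment> \<open>First variation of the Rayleigh quotient at its maximum \<open>v\<close>, in the direction \<open>w\<close>.\<close>
  have quad: "0 \<le> 2 * t * (w \<bullet> w) + t\<^sup>2 * (l * (w \<bullet> w) - ?q w)" for t
  proof -
    have "v + t *\<^sub>R w \<in> K" using v wK K(1) by (simp add: subspace_add subspace_scale)
    from le[OF this] have "0 \<le> l * ((v + t *\<^sub>R w) \<bullet> (v + t *\<^sub>R w)) - ?q (v + t *\<^sub>R w)" by simp
    also have "\<dots> = (l * (v \<bullet> v) - ?q v) + 2 * t * (l * (w \<bullet> v) - w \<bullet> (M *v v))
        + t\<^sup>2 * (l * (w \<bullet> w) - ?q w)"
      by (simp add: linear_add[OF lin] linear_scale[OF lin] inner_add_left inner_add_right
          adj[of v w] inner_commute[of v w] power2_eq_square algebra_simps)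
    also have "l * (w \<bullet> v) - w \<bullet> (M *v v) = w \<bullet> w"
      unfolding w_def by (simp add: inner_diff_right inner_diff_left algebra_simps)
    finally show ?thesis by (simp add: nv l_def)
  qed
  have "w \<bullet> w = 0"
  proof (rule ccontr)
    assume "w \<bullet> w \<noteq> 0"
    then have pos: "w \<bullet> w > 0" by simp
    define c where "c = \<bar>l * (w \<bullet> w) - ?q w\<bar> + 1"
    define t where "t = - (w \<bullet> w) / c"
    have c: "c > 0" "l * (w \<bullet> w) - ?q w \<le> c" by (auto simp: c_def)
    have "2 * t * (w \<bullet> w) + t\<^sup>2 * (l * (w \<bullet> w) - ?q w) \<le> 2 * t * (w \<bullet> w) + t\<^sup>2 * c"
      using c by (simp add: mult_left_mono)
    also have "\<dots> = - (w \<bullet> w)\<^sup>2 / c" using c by (simp add: t_def field_simps power2_eq_square)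
    also have "\<dots> < 0" using pos c by simp
    finally show False using quad[of t] by simp
  qed
  then have "M *v v = l *\<^sub>R v" by (simp add: w_def)
  then show ?thesis using v by auto
qed

text \<open>While fewer than \<open>CARD('m)\<close> vectors have been chosen, they and their multiples by \<open>\<i>\<close> do not span the
  space over the reals, and the unitary complement is invariant.\<close>
lemma hermitian_orthonormal_eigenvectors:
  fixes M :: "complex^'m^'m"
  assumes M: "conj_transpose M = M" and "n \<le> CARD('m)"
  shows "\<exists>v l. (\<forall>i<n. M *v v i = (l i :: real) *\<^sub>R v i) \<and>
    (\<forall>i<n. \<forall>j<n. cinner (v i) (v j) = (if i = j then 1 else 0))"
  using assms(2)
proof (induction n)
  case 0
  then show ?case by simp
next
  case (Suc n)
  then obtain v l where ev: "\<And>i. i < n \<Longrightarrow> M *v v i = (l i :: real) *\<^sub>R v i"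
    and on: "\<And>i j. i < n \<Longrightarrow> j < n \<Longrightarrow> cinner (v i) (v j) = (if i = j then 1 else 0)"
    by (metis Suc_leD)
  define K where "K = {y. \<forall>i<n. cinner (v i) y = 0}"
  have K: "subspace K"
    by (auto simp: K_def subspace_def cinner_add_right scaleR_eq_scale_complex cinner_scale_right)
       (simp add: cinner_def)
  have inv: "M *v y \<in> K" if "y \<in> K" for y
    using that by (auto simp: K_def cinner_mult_right M ev scaleR_eq_scale_complex cinner_scale_left)
  define T where "T = v ` {..<n} \<union> (\<lambda>i. \<i> *s v i) ` {..<n}"
  have "dim T \<le> card T" by (rule dim_le_card') (simp add: T_def)
  also have "\<dots> \<le> n + n" unfolding T_def
    by (rule order_trans[OF card_Un_le add_mono]) (use card_image_le[of "{..<n}"] in auto)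
  also have "\<dots> < DIM(complex^'m)" using Suc.prems by simp
  finally obtain y where y: "y \<noteq> 0" "\<And>x. x \<in> span T \<Longrightarrow> orthogonal y x"
    using orthogonal_to_subspace_exists[of T] by blast
  have "y \<in> K"
  proof -
    have "cinner (v i) y = 0" if "i < n" for i
    proof -
      have "v i \<in> span T" "\<i> *s v i \<in> span T" using that by (auto simp: T_def intro!: span_base)
      then show ?thesis using y(2) by (simp add: cinner_eq_0_iff_inner orthogonal_def inner_commute[of _ y])
    qed
    then show ?thesis by (simp add: K_def)
  qed
  then obtain u r where u: "u \<in> K" "norm u = 1" "M *v u = (r::real) *\<^sub>R u"
    using hermitian_eigenvector_in_subspace[OF M K inv _ y(1)] by blast
  have uv: "cinner (v i) u = 0" "cinner u (v i) = 0" if "i < n" for i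
    using u(1) that cinner_commute[of u "v i"] by (auto simp: K_def)
  show ?case
    by (rule exI[of _ "v(n := u)"], rule exI[of _ "l(n := r)"])
       (use ev on u uv in \<open>auto simp: less_Suc_eq cinner_self\<close>)
qed

lemma conj_transpose_nth: "conj_transpose M $ i $ j = cnj (M $ j $ i)"
  by (simp add: conj_transpose_def map_matrix_def transpose_def)

lemma real_diag_mult_left: "(real_diag d ** M) $ i $ j = complex_of_real (d i) * M $ i $ j"
  by (simp add: real_diag_def matrix_matrix_mult_def if_distrib[of "\<lambda>x. x * _"] cong: if_cong)

lemma real_diag_mult_right: "(M ** real_diag d) $ i $ j = M $ i $ j * complex_of_real (d j)"
  by (simp add: real_diag_def matrix_matrix_mult_def if_distrib[of "\<lambda>x. _ * x"] cong: if_cong)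

lemma conjugated_diag_nth:
  "(U ** real_diag d ** conj_transpose U) $ i $ j
    = (\<Sum>k\<in>UNIV. U $ i $ k * complex_of_real (d k) * cnj (U $ j $ k))"
  by (simp add: matrix_matrix_mult_def[of "U ** real_diag d"] real_diag_mult_right conj_transpose_nth)

lemma spectral_decomposition:
  fixes M :: "complex^'m^'m"
  assumes "nonneg_definite M"
  shows "\<exists>U d. unitary_mat U \<and> (\<forall>i. 0 \<le> d i) \<and> M = U ** real_diag d ** conj_transpose U"
proof -
  have M: "conj_transpose M = M" and pos: "\<And>y. 0 \<le> Re (cinner y (M *v y))"
    using assms by (auto simp: nonneg_definite_def cinner_def)
  obtain v l where ev: "\<And>i. i < CARD('m) \<Longrightarrow> M *v v i = (l i :: real) *\<^sub>R v i"
    and on: "\<And>i j. i < CARD('m) \<Longrightarrow> j < CARD('m) \<Longrightarrow> cinner (v i) (v j) = (if i = j then 1 else 0)"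
    using hermitian_orthonormal_eigenvectors[OF M order_refl] by metis
  obtain f where f: "bij_betw f (UNIV::'m set) {0..<CARD('m)}"
    using ex_bij_betw_finite_nat[of "UNIV::'m set"] by auto
  then have fl: "f i < CARD('m)" and fi: "f i = f j \<longleftrightarrow> i = j" for i j
    by (auto simp: bij_betw_def inj_on_eq_iff)
  define U where "U = (\<chi> i j. v (f j) $ i)"
  define d where "d = (\<lambda>i. l (f i))"
  have UU: "conj_transpose U ** U = mat 1"
    using on[OF fl fl] by (simp add: vec_eq_iff matrix_matrix_mult_def conj_transpose_nth U_def mat_def
        cinner_def fi)
  then have U: "unitary_mat U" by (simp add: unitary_mat_def matrix_left_right_inverse)
  have "(M ** U) $ i $ j = (U ** real_diag d) $ i $ j" for i j
  proof -
    have "(M ** U) $ i $ j = (M *v v (f j)) $ i"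
      by (simp add: matrix_matrix_mult_def matrix_vector_mult_def U_def)
    then show ?thesis by (simp add: ev[OF fl] real_diag_mult_right U_def d_def scaleR_conv_of_real[where 'a = complex])
  qed
  then have "M ** U = U ** real_diag d" by (simp add: vec_eq_iff)
  then have "M = U ** real_diag d ** conj_transpose U"
    by (metis U matrix_mul_assoc matrix_mul_rid unitary_mat_def)
  moreover have "0 \<le> d i" for i
  proof -
    have "cinner (v (f i)) (M *v v (f i)) = complex_of_real (d i)"
      by (simp add: ev[OF fl] d_def scaleR_eq_scale_complex cinner_scale_right on[OF fl fl])
    then show ?thesis using pos[of "v (f i)"] by simp
  qed
  ultimately show ?thesis using U by blast
qed

text \<open>This makes a function of a matrix independent of the diagonalisation.\<close>
lemma unitary_diag_function_unique:
  assumes U: "unitary_mat U" and V: "unitary_mat V"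
    and eq: "U ** real_diag d ** conj_transpose U = V ** real_diag e ** conj_transpose V"
  shows "U ** real_diag (\<lambda>i. f (d i)) ** conj_transpose U = V ** real_diag (\<lambda>i. f (e i)) ** conj_transpose V"
proof -
  \<comment> \<open>The change of basis intertwines the two diagonal matrices, hence also any function of them.\<close>
  define T where "T = conj_transpose U ** V"
  have "real_diag d ** T = conj_transpose U ** (U ** real_diag d ** conj_transpose U) ** V"
    using U by (simp add: T_def unitary_mat_def matrix_mul_assoc)
  also have "\<dots> = T ** real_diag e"
    unfolding eq using V by (simp add: T_def unitary_mat_def flip: matrix_mul_assoc)
  finally have "complex_of_real (d i) * T $ i $ j = T $ i $ j * complex_of_real (e j)" for i j
    by (metis real_diag_mult_left real_diag_mult_right)
  then have "T $ i $ j = 0 \<or> d i = e j" for i j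
    by (metis mult.commute mult_left_cancel of_real_eq_iff)
  then have "complex_of_real (f (d i)) * T $ i $ j = T $ i $ j * complex_of_real (f (e j))" for i j
    by (metis mult.commute mult_zero_left)
  then have DT: "real_diag (\<lambda>i. f (d i)) ** T = T ** real_diag (\<lambda>i. f (e i))"
    by (simp add: vec_eq_iff real_diag_mult_left real_diag_mult_right)
  have "U ** real_diag (\<lambda>i. f (d i)) ** conj_transpose U
      = U ** (real_diag (\<lambda>i. f (d i)) ** T) ** conj_transpose V"
    using V by (simp add: T_def unitary_mat_def flip: matrix_mul_assoc)
  also have "\<dots> = V ** real_diag (\<lambda>i. f (e i)) ** conj_transpose V"
    unfolding DT using U by (simp add: T_def unitary_mat_def matrix_mul_assoc)
  finally show ?thesis .
qed

lemma psd_powr_decomposition: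
  assumes "nonneg_definite M"
  obtains U d where "unitary_mat U" "\<And>i. 0 \<le> d i" "M = U ** real_diag d ** conj_transpose U"
    "psd_powr M s = U ** real_diag (\<lambda>i. d i powr s) ** conj_transpose U"
proof -
  obtain U d where *: "unitary_mat U" "\<forall>i. 0 \<le> d i" "M = U ** real_diag d ** conj_transpose U"
    using spectral_decomposition[OF assms] by blast
  moreover have "psd_powr M s = U ** real_diag (\<lambda>i. d i powr s) ** conj_transpose U"
    unfolding psd_powr_def
    by (rule the_equality)
       (use * unitary_diag_function_unique[where f = "\<lambda>t. t powr s"] in blast)+
  ultimately show ?thesis using that by blast
qed

text \<open>On the spectrum \<open>d powr s\<close> and \<open>d\<close> vanish simultaneously, so a matrix and its power have the same kernel.\<close>
lemma psd_powr_kernel: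
  assumes M: "nonneg_definite M" "invertible M" and z: "psd_powr M s *v y = 0"
  shows "y = 0"
proof -
  obtain U d where U: "unitary_mat U" and Md: "M = U ** real_diag d ** conj_transpose U"
    and P: "psd_powr M s = U ** real_diag (\<lambda>i. d i powr s) ** conj_transpose U"
    using psd_powr_decomposition[OF M(1), of s] by blast
  let ?z = "conj_transpose U *v y"
  have "real_diag (\<lambda>i. d i powr s) *v ?z = conj_transpose U *v (psd_powr M s *v y)"
    unfolding P using U by (simp add: matrix_vector_mul_assoc matrix_mul_assoc unitary_mat_def)
  then have "real_diag (\<lambda>i. d i powr s) *v ?z = 0" by (simp add: z)
  moreover have diag: "(real_diag e *v x) $ i = complex_of_real (e i) * x $ i" for e and x :: "complex^'a" and i
    by (simp add: real_diag_def matrix_vector_mult_def if_distrib[of "\<lambda>x. x * _"] cong: if_cong)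
  ultimately have "complex_of_real (d i powr s) * ?z $ i = 0" for i
    by (metis zero_index)
  then have "complex_of_real (d i) * ?z $ i = 0" for i
    by (metis mult_eq_0_iff of_real_eq_0_iff powr_eq_0_iff)
  then have "real_diag d *v ?z = 0" by (simp add: vec_eq_iff diag)
  then have "M *v y = 0" unfolding Md by (simp add: matrix_vector_mul_assoc[symmetric])
  then show ?thesis using M(2)
    by (metis invertible_def matrix_vector_mul_assoc matrix_vector_mul_lid matrix_vector_mult_0_right)
qed

definition mat_pow :: "complex^'m^'m \<Rightarrow> nat \<Rightarrow> complex^'m^'m" where
  "mat_pow M n = (((**) M) ^^ n) (mat 1)"

lemma continuous_on_mat_pow: "continuous_on UNIV (\<lambda>M. mat_pow M n)"
proof (induction n)
  case (Suc n)
  then show ?case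
    by (simp add: mat_pow_def matrix_matrix_mult_def)
       (intro continuous_intros; simp)
qed (simp add: mat_pow_def)

lemma mat_pow_conjugated:
  assumes "unitary_mat U"
  shows "mat_pow (U ** real_diag d ** conj_transpose U) n = U ** real_diag (\<lambda>i. d i ^ n) ** conj_transpose U"
proof (induction n)
  case 0
  have "real_diag (\<lambda>i. 1) = mat 1" by (simp add: vec_eq_iff real_diag_def mat_def)
  then have "real_diag (\<lambda>i. d i ^ 0) = mat 1" by simp
  then show ?case using assms by (simp only: mat_pow_def unitary_mat_def funpow_0 matrix_mul_rid)
next
  case (Suc n)
  have DD: "real_diag d ** real_diag (\<lambda>i. d i ^ n) = real_diag (\<lambda>i. d i ^ Suc n)"
    by (simp add: vec_eq_iff real_diag_mult_left) (simp add: real_diag_def)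
  have "mat_pow (U ** real_diag d ** conj_transpose U) (Suc n)
    = U ** real_diag d ** (conj_transpose U ** U) ** real_diag (\<lambda>i. d i ^ n) ** conj_transpose U"
    using Suc by (simp add: mat_pow_def matrix_mul_assoc)
  also have "\<dots> = U ** (real_diag d ** real_diag (\<lambda>i. d i ^ n)) ** conj_transpose U"
    using assms by (simp add: unitary_mat_def matrix_mul_assoc)
  finally show ?case by (simp only: DD)
qed

text \<open>Polynomials that converge to \<open>t powr s\<close> locally uniformly on the half-line converge at every
  nonnegative definite matrix. This is what makes the power of a measurable matrix function measurable.\<close>
lemma psd_powr_limit_of_polynomials:
  assumes s: "0 < s"
  shows "\<exists>P :: nat \<Rightarrow> complex^'m^'m \<Rightarrow> complex^'m^'m.
    (\<forall>n. continuous_on UNIV (P n)) \<and> (\<forall>M. nonneg_definite M \<longrightarrow> (\<lambda>n. P n M) \<longlonglongrightarrow> psd_powr M s)"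
proof -
  have "\<exists>g. real_polynomial_function g \<and> (\<forall>t\<in>{0..real n}. \<bar>t powr s - g t\<bar> < 1 / Suc n)" for n
  proof (rule Stone_Weierstrass_real_polynomial_function[of "{0..real n}" "\<lambda>t. t powr s" "1 / Suc n"])
    show "continuous_on {0..real n} (\<lambda>t. t powr s)"
      using s by (intro continuous_on_powr' continuous_intros) auto
  qed auto
  then obtain g where g: "\<And>n. real_polynomial_function (g n)"
    "\<And>n t. t \<in> {0..real n} \<Longrightarrow> \<bar>t powr s - g n t\<bar> < 1 / Suc n" by metis
  then have "\<forall>n. \<exists>a N. g n = (\<lambda>t. \<Sum>i\<le>N. a i * t ^ i)"
    using real_polynomial_function_iff_sum by blast
  then obtain a N where gs: "\<And>n. g n = (\<lambda>t. \<Sum>i\<le>N n. a n i * t ^ i)" by metis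
  define P where "P n M = (\<Sum>i\<le>N n. a n i *\<^sub>R mat_pow M i)" for n and M :: "complex^'m^'m"
  have cont: "continuous_on UNIV (P n)" for n
    unfolding P_def by (intro continuous_intros continuous_on_mat_pow)
  have "(\<lambda>n. P n M) \<longlonglongrightarrow> psd_powr M s" if M: "nonneg_definite M" for M
  proof -
    obtain U d where U: "unitary_mat U" and d: "\<And>i. 0 \<le> d i" and Md: "M = U ** real_diag d ** conj_transpose U"
      and Ps: "psd_powr M s = U ** real_diag (\<lambda>i. d i powr s) ** conj_transpose U"
      using psd_powr_decomposition[OF M, of s] by blast
    have lim: "(\<lambda>n. g n (d k)) \<longlonglongrightarrow> d k powr s" for k
    proof (rule LIM_zero_cancel, rule Lim_null_comparison)
      obtain m where m: "d k \<le> real m" using real_arch_simple by blast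
      show "eventually (\<lambda>n. norm (g n (d k) - d k powr s) \<le> 1 / Suc n) sequentially"
        using eventually_ge_at_top[of m]
      proof eventually_elim
        case (elim n)
        then have "d k \<in> {0..real n}" using m d[of k] by simp
        then show ?case using g(2)[of "d k" n] by (simp add: abs_minus_commute)
      qed
      show "(\<lambda>n. 1 / real (Suc n)) \<longlonglongrightarrow> 0" by (rule lim_1_over_n[THEN LIMSEQ_Suc])
    qed
    have "P n M $ i $ j = (\<Sum>k\<in>UNIV. U $ i $ k * complex_of_real (g n (d k)) * cnj (U $ j $ k))" for n i j
    proof -
      have "P n M $ i $ j = (\<Sum>l\<le>N n. \<Sum>k\<in>UNIV. complex_of_real (a n l) *
          (U $ i $ k * complex_of_real (d k ^ l) * cnj (U $ j $ k)))"
        by (simp add: P_def Md mat_pow_conjugated[OF U] conjugated_diag_nth scaleR_conv_of_real[where 'a = complex] sum_distrib_left)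
      also have "\<dots> = (\<Sum>k\<in>UNIV. \<Sum>l\<le>N n. complex_of_real (a n l) *
          (U $ i $ k * complex_of_real (d k ^ l) * cnj (U $ j $ k)))" by (rule sum.swap)
      also have "\<dots> = (\<Sum>k\<in>UNIV. U $ i $ k * complex_of_real (g n (d k)) * cnj (U $ j $ k))"
        by (intro sum.cong refl) (simp add: gs sum_distrib_left sum_distrib_right mult_ac)
      finally show ?thesis .
    qed
    then have "(\<lambda>n. P n M $ i $ j) \<longlonglongrightarrow> psd_powr M s $ i $ j" for i j
      unfolding Ps conjugated_diag_nth by (auto intro!: tendsto_intros lim)
    then show ?thesis by (intro vec_tendstoI)
  qed
  then show ?thesis using cont by blast
qed

lemma borel_measurable_wnorm:
  fixes W :: "real^'a \<Rightarrow> complex^'b^'b"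
  assumes W: "matrix_weight W" and p: "1 \<le> p"
  shows "(\<lambda>x. wnorm p W x y) \<in> borel_measurable lebesgue"
proof -
  have Wm: "W \<in> borel_measurable lebesgue" and nn: "\<And>x. nonneg_definite (W x)"
    using W by (auto simp: matrix_weight_def)
  obtain P :: "nat \<Rightarrow> complex^'b^'b \<Rightarrow> complex^'b^'b" where P: "\<And>n. continuous_on UNIV (P n)"
     "\<And>M. nonneg_definite M \<Longrightarrow> (\<lambda>n. P n M) \<longlonglongrightarrow> psd_powr M (1 / p)"
    using psd_powr_limit_of_polynomials[of "1 / p"] p by auto
  have "(\<lambda>x. psd_powr (W x) (1 / p)) \<in> borel_measurable lebesgue"
    by (rule borel_measurable_LIMSEQ_metric[of "\<lambda>n x. P n (W x)"])
       (auto intro: borel_measurable_continuous_on[OF P(1) Wm] P(2) nn)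
  moreover have "continuous_on UNIV (\<lambda>N. norm (N *v y))"
    by (simp add: matrix_vector_mult_def) (intro continuous_intros)
  ultimately show ?thesis
    unfolding wnorm_def by (rule borel_measurable_continuous_on[rotated])
qed

lemma wnorm_pos_AE:
  assumes W: "matrix_weight W" and y: "y \<noteq> 0"
  shows "AE x in lebesgue. 0 < wnorm p W x y"
proof -
  have "AE x in lebesgue. invertible (W x)" "\<And>x. nonneg_definite (W x)"
    using W by (auto simp: matrix_weight_def)
  then show ?thesis
    using psd_powr_kernel y by (auto simp: wnorm_def elim!: eventually_mono)
qed

lemma wnorm_scale: "wnorm p W x (c *s y) = norm c * wnorm p W x y"
  by (simp add: wnorm_def matrix_vector_mult_scale_complex norm_vec_def L2_set_def norm_mult
      power_mult_distrib real_sqrt_mult flip: sum_distrib_left)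

lemma wnorm_triangle: "wnorm p W x (y + z) \<le> wnorm p W x y + wnorm p W x z"
  by (simp add: wnorm_def vec.add norm_triangle_ineq)

lemma wnorm_nonneg: "0 \<le> wnorm p W x y"
  by (simp add: wnorm_def)

section \<open>Powers and weighted sums of extended nonnegative reals\<close>

lemma sum_le_nn_integral_count_space:
  fixes f :: "'a \<Rightarrow> ennreal"
  assumes "finite F" "F \<subseteq> A"
  shows "sum f F \<le> (\<integral>\<^sup>+x. f x \<partial>count_space A)"
proof -
  have "sum f F = (\<integral>\<^sup>+x. f x \<partial>count_space F)" using assms by (simp add: nn_integral_count_space_finite)
  also have "\<dots> \<le> (\<integral>\<^sup>+x. f x \<partial>count_space A)"
    using assms(2) by (subst (1 2) nn_integral_count_space_indicator)
      (auto simp: NO_MATCH_def indicator_def intro!: nn_integral_mono)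
  finally show ?thesis .
qed

text \<open>Sums become integrals over counting measure, so that monotone convergence and Tonelli apply.\<close>
lemma infsum_ennreal_eq_nn_integral:
  fixes f :: "'a \<Rightarrow> ennreal"
  assumes "countable A"
  shows "(\<Sum>\<^sub>\<infinity>x\<in>A. f x) = (\<integral>\<^sup>+x. f x \<partial>count_space A)"
proof -
  have S: "(\<Sum>\<^sub>\<infinity>x\<in>A. f x) = (SUP F\<in>{F. finite F \<and> F \<subseteq> A}. sum f F)"
    by (rule nonneg_infsum_complete) simp
  show ?thesis
  proof (cases "finite A")
    case True
    then show ?thesis by (simp add: nn_integral_count_space_finite)
  next
    case False
    let ?g = "from_nat_into A"
    have bij: "bij_betw ?g UNIV A" using assms False by (rule bij_betw_from_nat_into)
    have "(\<integral>\<^sup>+x. f x \<partial>count_space A) = (\<integral>\<^sup>+n. f (?g n) \<partial>count_space UNIV)"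
      using nn_integral_bij_count_space[OF bij, of f] by simp
    also have "\<dots> = (\<Sum>n. f (?g n))" by (rule nn_integral_count_space_nat)
    also have "\<dots> = (SUP n. \<Sum>i<n. f (?g i))" by (rule suminf_eq_SUP)
    finally have I: "(\<integral>\<^sup>+x. f x \<partial>count_space A) = (SUP n. \<Sum>i<n. f (?g i))" .
    have le1: "(\<Sum>i<n. f (?g i)) \<le> (\<Sum>\<^sub>\<infinity>x\<in>A. f x)" for n
    proof -
      have "(\<Sum>i<n. f (?g i)) = sum f (?g ` {..<n})"
        using bij by (subst sum.reindex) (auto simp: bij_betw_def inj_on_def)
      also have "\<dots> \<le> (\<Sum>\<^sub>\<infinity>x\<in>A. f x)" unfolding S
        using bij by (intro SUP_upper) (auto simp: bij_betw_def)
      finally show ?thesis .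
    qed
    have le2: "sum f F \<le> (\<integral>\<^sup>+x. f x \<partial>count_space A)" if "finite F" "F \<subseteq> A" for F
      using that by (rule sum_le_nn_integral_count_space)
    show ?thesis
      by (rule antisym) (auto simp: S I intro!: SUP_least le1[unfolded S] le2[unfolded I])
  qed
qed

lemma ennpowr_ennreal: "0 \<le> x \<Longrightarrow> ennpowr (ennreal x) a = ennreal (x powr a)"
  by (simp add: ennpowr_def)

lemma ennpowr_infinity [simp]: "ennpowr \<infinity> a = \<infinity>" "ennpowr top a = \<infinity>"
  by (simp_all add: ennpowr_def)

lemma ennpowr_0 [simp]: "ennpowr 0 a = 0"
  by (simp add: ennpowr_def)

lemma ennpowr_mono:
  assumes "x \<le> y" "0 \<le> a" shows "ennpowr x a \<le> ennpowr y a"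
proof (cases y)
  case (real r)
  then obtain s where "x = ennreal s" "0 \<le> s" using assms(1) by (cases x) (auto simp: top_unique)
  then show ?thesis using real assms by (simp add: ennpowr_ennreal powr_mono2)
qed simp

lemma ennpowr_mult:
  assumes "0 < a" shows "ennpowr (x * y) a = ennpowr x a * ennpowr y a"
proof (cases x; cases y)
  fix r s assume "0 \<le> r" "0 \<le> s" "x = ennreal r" "y = ennreal s"
  then show ?thesis by (simp add: ennpowr_ennreal powr_mult flip: ennreal_mult)
qed (use assms in \<open>auto simp: ennreal_mult_top ennreal_top_mult ennpowr_ennreal\<close>)

lemma ennpowr_ennpowr:
  assumes "0 < a" "0 < b" shows "ennpowr (ennpowr x a) b = ennpowr x (a * b)"
  by (cases x) (simp_all add: ennpowr_ennreal powr_powr)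

lemma ennpowr_one [simp]: "ennpowr x 1 = x"
  by (cases x) (simp_all add: ennpowr_ennreal)

lemma ennpowr_le_iff:
  assumes "0 < a" shows "ennpowr x a \<le> y \<longleftrightarrow> x \<le> ennpowr y (1 / a)"
proof
  assume "ennpowr x a \<le> y"
  then have "ennpowr (ennpowr x a) (1 / a) \<le> ennpowr y (1 / a)" using assms by (intro ennpowr_mono) auto
  then show "x \<le> ennpowr y (1 / a)" using assms by (simp add: ennpowr_ennpowr)
next
  assume "x \<le> ennpowr y (1 / a)"
  then have "ennpowr x a \<le> ennpowr (ennpowr y (1 / a)) a" using assms by (intro ennpowr_mono) auto
  then show "ennpowr x a \<le> y" using assms by (simp add: ennpowr_ennpowr)
qed

lemma ennpowr_inverse:
  assumes "0 < a" shows "ennpowr (ennpowr x (1 / a)) a = x" "ennpowr (ennpowr x a) (1 / a) = x"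
  using assms by (simp_all add: ennpowr_ennpowr)

lemma ennpowr_add:
  assumes "0 < a" "0 < b" shows "ennpowr x a * ennpowr x b = ennpowr x (a + b)"
  by (cases x) (use assms in \<open>simp_all add: ennpowr_ennreal powr_add ennreal_mult ennreal_mult_top\<close>)

lemma ennpowr_le_self:
  assumes "x \<le> 1" "1 \<le> a" shows "ennpowr x a \<le> x"
proof (cases x)
  case (real r)
  then have "r \<le> 1" using assms by (simp add: ennreal_le_1)
  then have "r powr a \<le> r" using assms real by (cases "r = 0") (auto intro!: powr_le_one_le)
  then show ?thesis using real by (simp add: ennpowr_ennreal ennreal_leI)
qed (use assms in auto)

lemma borel_measurable_ennpowr [measurable (raw)]:
  assumes [measurable]: "f \<in> borel_measurable M"
  shows "(\<lambda>x. ennpowr (f x) a) \<in> borel_measurable M"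
  unfolding ennpowr_def by measurable

text \<open>Each \<open>x\<^sub>i\<close> is at most the \<open>p\<close>-norm of the family, for every \<open>p > 0\<close>; it serves in place of the inequalities
  of Hoelder and Minkowski when the weights \<open>c\<close> are summable.\<close>
lemma ennpowr_sum_weighted:
  fixes c x :: "'i \<Rightarrow> ennreal"
  assumes p: "0 < p" and K: "(\<integral>\<^sup>+i. c i \<partial>count_space UNIV) \<le> K"
  shows "ennpowr (\<integral>\<^sup>+i. c i * x i \<partial>count_space UNIV) p
    \<le> ennpowr K p * (\<integral>\<^sup>+i. ennpowr (x i) p \<partial>count_space UNIV)"
proof -
  let ?S = "\<integral>\<^sup>+i. ennpowr (x i) p \<partial>count_space UNIV"
  have "ennpowr (x i) p \<le> ?S" for i
    using sum_le_nn_integral_count_space[of "{i}" UNIV "\<lambda>i. ennpowr (x i) p"] by simp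
  then have x: "x i \<le> ennpowr ?S (1 / p)" for i
    using p by (simp add: ennpowr_le_iff)
  have "(\<integral>\<^sup>+i. c i * x i \<partial>count_space UNIV) \<le> (\<integral>\<^sup>+i. c i * ennpowr ?S (1 / p) \<partial>count_space UNIV)"
    by (intro nn_integral_mono mult_left_mono x) auto
  also have "\<dots> = (\<integral>\<^sup>+i. c i \<partial>count_space UNIV) * ennpowr ?S (1 / p)"
    by (rule nn_integral_multc) auto
  also have "\<dots> \<le> K * ennpowr ?S (1 / p)" by (intro mult_right_mono K) auto
  finally have "ennpowr (\<integral>\<^sup>+i. c i * x i \<partial>count_space UNIV) p \<le> ennpowr (K * ennpowr ?S (1 / p)) p"
    using p by (intro ennpowr_mono) auto
  then show ?thesis using p by (simp add: ennpowr_mult ennpowr_inverse)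
qed

text \<open>Each term satisfies \<open>x\<^sub>i\<^sup>p \<le> x\<^sub>i S\<^sup>p\<^sup>-\<^sup>1\<close> with \<open>S\<close> the sum of the family.\<close>
lemma ennpowr_superadditive:
  fixes x :: "'i \<Rightarrow> ennreal"
  assumes p: "1 \<le> p"
  shows "(\<integral>\<^sup>+i. ennpowr (x i) p \<partial>count_space UNIV) \<le> ennpowr (\<integral>\<^sup>+i. x i \<partial>count_space UNIV) p"
proof (cases "p = 1")
  case False
  let ?S = "\<integral>\<^sup>+i. x i \<partial>count_space UNIV"
  have p1: "0 < p - 1" using p False by simp
  have x: "x i \<le> ?S" for i
    using sum_le_nn_integral_count_space[of "{i}" UNIV x] by simp
  have split: "ennpowr y p = y * ennpowr y (p - 1)" for y
    using ennpowr_add[of 1 "p - 1" y] p1 by simp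
  have "(\<integral>\<^sup>+i. ennpowr (x i) p \<partial>count_space UNIV)
      \<le> (\<integral>\<^sup>+i. x i * ennpowr ?S (p - 1) \<partial>count_space UNIV)"
    unfolding split using p1 by (intro nn_integral_mono mult_left_mono ennpowr_mono x) auto
  also have "\<dots> = ?S * ennpowr ?S (p - 1)" by (rule nn_integral_multc) auto
  finally show ?thesis by (simp add: split[of ?S])
qed simp

text \<open>The two half-lines \<open>l \<le> k\<close> and \<open>l \<ge> k\<close> contribute one geometric series each.\<close>
lemma nn_integral_geometric_int:
  fixes \<theta> :: real
  assumes "0 \<le> \<theta>" "\<theta> < 1"
  shows "(\<integral>\<^sup>+l. ennreal (\<theta> ^ nat \<bar>k - l\<bar>) \<partial>count_space UNIV) \<le> ennreal (2 / (1 - \<theta>))"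
proof -
  let ?h = "\<lambda>n::nat. \<theta> ^ n"
  have geo: "(\<integral>\<^sup>+n. ennreal (?h n) \<partial>count_space UNIV) = ennreal (1 / (1 - \<theta>))"
    using assms by (simp add: nn_integral_count_space_nat suminf_ennreal2 summable_geometric suminf_geometric)
  have "(\<integral>\<^sup>+l. ennreal (\<theta> ^ nat \<bar>k - l\<bar>) \<partial>count_space UNIV)
      \<le> (\<integral>\<^sup>+l. ennreal (\<theta> ^ nat \<bar>k - l\<bar>) * indicator {..k} l + ennreal (\<theta> ^ nat \<bar>k - l\<bar>) * indicator {k..} l \<partial>count_space UNIV)"
    by (intro nn_integral_mono) (auto simp: indicator_def)
  also have "\<dots> = (\<integral>\<^sup>+l. ennreal (\<theta> ^ nat \<bar>k - l\<bar>) * indicator {..k} l \<partial>count_space UNIV)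
      + (\<integral>\<^sup>+l. ennreal (\<theta> ^ nat \<bar>k - l\<bar>) * indicator {k..} l \<partial>count_space UNIV)"
    by (rule nn_integral_add) auto
  also have "(\<integral>\<^sup>+l. ennreal (\<theta> ^ nat \<bar>k - l\<bar>) * indicator {..k} l \<partial>count_space UNIV)
      = (\<integral>\<^sup>+l. ennreal (\<theta> ^ nat \<bar>k - l\<bar>) \<partial>count_space {..k})"
    by (simp add: nn_integral_count_space_indicator)
  also have "\<dots> = (\<integral>\<^sup>+n. ennreal (\<theta> ^ nat \<bar>k - (k - int n)\<bar>) \<partial>count_space UNIV)"
    by (rule nn_integral_bij_count_space[symmetric])
       (rule bij_betwI[where g = "\<lambda>l. nat (k - l)"], auto)
  also have "\<dots> = ennreal (1 / (1 - \<theta>))" using geo by simp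
  also have "(\<integral>\<^sup>+l. ennreal (\<theta> ^ nat \<bar>k - l\<bar>) * indicator {k..} l \<partial>count_space UNIV)
      = (\<integral>\<^sup>+l. ennreal (\<theta> ^ nat \<bar>k - l\<bar>) \<partial>count_space {k..})"
    by (simp add: nn_integral_count_space_indicator)
  also have "\<dots> = (\<integral>\<^sup>+n. ennreal (\<theta> ^ nat \<bar>k - (k + int n)\<bar>) \<partial>count_space UNIV)"
    by (rule nn_integral_bij_count_space[symmetric])
       (rule bij_betwI[where g = "\<lambda>l. nat (l - k)"], auto)
  also have "\<dots> = ennreal (1 / (1 - \<theta>))" using geo by simp
  also have "ennreal (1 / (1 - \<theta>)) + ennreal (1 / (1 - \<theta>)) = ennreal (2 / (1 - \<theta>))"
    using assms by (subst ennreal_plus[symmetric]) (auto simp: field_simps)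
  finally show ?thesis .
qed

lemma lq_norm_upper:
  assumes "0 < q" shows "a k \<le> lq_norm q a"
proof (cases "q = \<infinity>")
  case False
  then have r: "0 < enn2real q" using assms by (simp add: enn2real_positive_iff less_top)
  have "ennpowr (a k) (enn2real q) \<le> (\<Sum>\<^sub>\<infinity>k. ennpowr (a k) (enn2real q))"
    using sum_le_nn_integral_count_space[of "{k}" UNIV "\<lambda>k. ennpowr (a k) (enn2real q)"]
    by (simp add: infsum_ennreal_eq_nn_integral)
  then show ?thesis using r False by (simp add: lq_norm_def ennpowr_le_iff)
qed (simp add: lq_norm_def SUP_upper)

text \<open>Young's inequality for a geometric kernel, valid also in the quasi-norm range \<open>q < 1\<close>.\<close>
lemma lq_norm_geometric_convolution:
  fixes \<theta> C :: real
  assumes \<theta>: "0 < \<theta>" "\<theta> < 1" and C: "0 \<le> C" and q: "0 < q"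
  shows "\<exists>K>0. \<forall>a b. (\<forall>k. a k \<le> ennreal C * (\<integral>\<^sup>+l. ennreal (\<theta> ^ nat \<bar>k - l\<bar>) * b l \<partial>count_space UNIV))
    \<longrightarrow> lq_norm q a \<le> ennreal K * lq_norm q b"
proof (cases "q = \<infinity>")
  case True
  let ?K = "C * (2 / (1 - \<theta>)) + 1"
  have "lq_norm q a \<le> ennreal ?K * lq_norm q b"
    if ab: "\<forall>k. a k \<le> ennreal C * (\<integral>\<^sup>+l. ennreal (\<theta> ^ nat \<bar>k - l\<bar>) * b l \<partial>count_space UNIV)" for a b
  proof -
    have "a k \<le> ennreal ?K * (SUP k. b k)" for k
    proof -
      have "(\<integral>\<^sup>+l. ennreal (\<theta> ^ nat \<bar>k - l\<bar>) * b l \<partial>count_space UNIV)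
          \<le> (\<integral>\<^sup>+l. ennreal (\<theta> ^ nat \<bar>k - l\<bar>) * (SUP k. b k) \<partial>count_space UNIV)"
        by (intro nn_integral_mono mult_left_mono SUP_upper) auto
      also have "\<dots> = (\<integral>\<^sup>+l. ennreal (\<theta> ^ nat \<bar>k - l\<bar>) \<partial>count_space UNIV) * (SUP k. b k)"
        by (rule nn_integral_multc) auto
      also have "\<dots> \<le> ennreal (2 / (1 - \<theta>)) * (SUP k. b k)"
        using \<theta> by (intro mult_right_mono nn_integral_geometric_int) auto
      finally have "ennreal C * (\<integral>\<^sup>+l. ennreal (\<theta> ^ nat \<bar>k - l\<bar>) * b l \<partial>count_space UNIV)
          \<le> ennreal C * (ennreal (2 / (1 - \<theta>)) * (SUP k. b k))" by (rule mult_left_mono) auto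
      also have "\<dots> = ennreal (C * (2 / (1 - \<theta>))) * (SUP k. b k)"
        using C \<theta> by (simp only: ennreal_mult' mult.assoc)
      also have "\<dots> \<le> ennreal ?K * (SUP k. b k)"
        by (intro mult_right_mono ennreal_leI) auto
      finally show ?thesis using ab order_trans by blast
    qed
    then show ?thesis using True by (auto simp: lq_norm_def intro: SUP_least)
  qed
  moreover have "?K > 0" using C \<theta> by (simp add: add_nonneg_pos)
  ultimately show ?thesis by (intro exI[of _ ?K]) auto
next
  case False
  define r where "r = enn2real q"
  have r: "0 < r" using q False by (simp add: r_def enn2real_positive_iff less_top)
  \<comment> \<open>Half of the decay makes the kernel summable, the other half survives inside the power.\<close>
  define \<tau> where "\<tau> = sqrt \<theta>"
  have \<tau>: "0 < \<tau>" "\<tau> < 1" "\<tau> * \<tau> = \<theta>" using \<theta> by (simp_all add: \<tau>_def)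
  define \<sigma> where "\<sigma> = \<tau> powr r"
  have \<sigma>: "0 < \<sigma>" "\<sigma> < 1"
    using \<tau> r powr_less_mono2[of r \<tau> 1] by (simp_all add: \<sigma>_def)
  let ?M = "C powr r * ((2 / (1 - \<tau>)) powr r * (2 / (1 - \<sigma>)))"
  let ?K = "?M powr (1 / r) + 1"
  have "lq_norm q a \<le> ennreal ?K * lq_norm q b"
    if ab: "\<forall>k. a k \<le> ennreal C * (\<integral>\<^sup>+l. ennreal (\<theta> ^ nat \<bar>k - l\<bar>) * b l \<partial>count_space UNIV)" for a b :: "int \<Rightarrow> ennreal"
  proof -
    let ?t = "\<lambda>k l. ennreal (\<tau> ^ nat \<bar>k - l\<bar>)"
    have pt: "ennpowr (?t k l) r = ennreal (\<sigma> ^ nat \<bar>k - l\<bar>)" for k l :: int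
      using \<tau> by (simp add: ennpowr_ennreal \<sigma>_def powr_powr powr_realpow[symmetric] mult.commute)
    have "ennpowr (a k) r \<le> ennreal (C powr r * (2 / (1 - \<tau>)) powr r)
        * (\<integral>\<^sup>+l. ennreal (\<sigma> ^ nat \<bar>k - l\<bar>) * ennpowr (b l) r \<partial>count_space UNIV)" for k
    proof -
      have "ennreal (\<theta> ^ nat \<bar>k - l\<bar>) * b l = ?t k l * (?t k l * b l)" for l
        using \<tau> by (simp add: \<tau>(3)[symmetric] power_mult_distrib ennreal_mult mult.assoc)
      then have "a k \<le> ennreal C * (\<integral>\<^sup>+l. ?t k l * (?t k l * b l) \<partial>count_space UNIV)"
        using ab[rule_format, of k] by (simp only:)
      then have "ennpowr (a k) r \<le> ennpowr (ennreal C * (\<integral>\<^sup>+l. ?t k l * (?t k l * b l) \<partial>count_space UNIV)) r"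
        using r by (intro ennpowr_mono) auto
      also have "\<dots> = ennreal (C powr r) * ennpowr (\<integral>\<^sup>+l. ?t k l * (?t k l * b l) \<partial>count_space UNIV) r"
        using r C by (simp add: ennpowr_mult ennpowr_ennreal)
      also have "\<dots> \<le> ennreal (C powr r) * (ennpowr (ennreal (2 / (1 - \<tau>))) r
          * (\<integral>\<^sup>+l. ennpowr (?t k l * b l) r \<partial>count_space UNIV))"
        using \<tau> by (intro mult_left_mono ennpowr_sum_weighted r nn_integral_geometric_int) auto
      also have "ennpowr (ennreal (2 / (1 - \<tau>))) r = ennreal ((2 / (1 - \<tau>)) powr r)"
        using \<tau> by (simp add: ennpowr_ennreal)
      also have "(\<integral>\<^sup>+l. ennpowr (?t k l * b l) r \<partial>count_space UNIV)
          = (\<integral>\<^sup>+l. ennreal (\<sigma> ^ nat \<bar>k - l\<bar>) * ennpowr (b l) r \<partial>count_space UNIV)"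
        using r by (simp add: ennpowr_mult pt)
      finally show ?thesis by (simp only: ennreal_mult'' powr_ge_zero mult.assoc)
    qed
    then have "(\<integral>\<^sup>+k. ennpowr (a k) r \<partial>count_space UNIV)
       \<le> (\<integral>\<^sup>+k. ennreal (C powr r * (2 / (1 - \<tau>)) powr r)
        * (\<integral>\<^sup>+l. ennreal (\<sigma> ^ nat \<bar>k - l\<bar>) * ennpowr (b l) r \<partial>count_space UNIV) \<partial>count_space UNIV)"
      by (intro nn_integral_mono) auto
    also have "\<dots> = ennreal (C powr r * (2 / (1 - \<tau>)) powr r)
        * (\<integral>\<^sup>+k. (\<integral>\<^sup>+l. ennreal (\<sigma> ^ nat \<bar>k - l\<bar>) * ennpowr (b l) r \<partial>count_space UNIV) \<partial>count_space UNIV)"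
      by (rule nn_integral_cmult) auto
    also have "(\<integral>\<^sup>+k. (\<integral>\<^sup>+l. ennreal (\<sigma> ^ nat \<bar>k - l\<bar>) * ennpowr (b l) r \<partial>count_space UNIV) \<partial>count_space UNIV)
        = (\<integral>\<^sup>+l. (\<integral>\<^sup>+k. ennreal (\<sigma> ^ nat \<bar>k - l\<bar>) * ennpowr (b l) r \<partial>count_space UNIV) \<partial>count_space (UNIV::int set))"
      by (rule nn_integral_count_space_nn_integral) auto
    also have "\<dots> = (\<integral>\<^sup>+l. (\<integral>\<^sup>+k. ennreal (\<sigma> ^ nat \<bar>k - l\<bar>) \<partial>count_space UNIV) * ennpowr (b l) r \<partial>count_space UNIV)"
      by (simp add: nn_integral_multc)
    also have "\<dots> \<le> (\<integral>\<^sup>+l. ennreal (2 / (1 - \<sigma>)) * ennpowr (b l) r \<partial>count_space UNIV)"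
    proof (intro nn_integral_mono mult_right_mono)
      fix l :: int
      show "(\<integral>\<^sup>+k. ennreal (\<sigma> ^ nat \<bar>k - l\<bar>) \<partial>count_space UNIV) \<le> ennreal (2 / (1 - \<sigma>))"
        using nn_integral_geometric_int[of \<sigma> l] \<sigma> by (simp add: abs_minus_commute)
    qed auto
    also have "\<dots> = ennreal (2 / (1 - \<sigma>)) * (\<integral>\<^sup>+l. ennpowr (b l) r \<partial>count_space UNIV)"
      by (rule nn_integral_cmult) auto
    finally have "(\<integral>\<^sup>+k. ennpowr (a k) r \<partial>count_space UNIV) \<le>
       ennreal ?M * (\<integral>\<^sup>+l. ennpowr (b l) r \<partial>count_space UNIV)"
      using \<sigma> by (simp only: ennreal_mult'' powr_ge_zero mult.assoc mult_nonneg_nonneg divide_nonneg_nonneg) (simp add: mult_left_mono ennreal_mult' mult.assoc)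
    then have "ennpowr (\<integral>\<^sup>+k. ennpowr (a k) r \<partial>count_space UNIV) (1 / r)
        \<le> ennpowr (ennreal ?M * (\<integral>\<^sup>+l. ennpowr (b l) r \<partial>count_space UNIV)) (1 / r)"
      using r by (intro ennpowr_mono) auto
    also have "\<dots> = ennreal (?M powr (1 / r)) * ennpowr (\<integral>\<^sup>+l. ennpowr (b l) r \<partial>count_space UNIV) (1 / r)"
      using r \<sigma> by (simp add: ennpowr_mult ennpowr_ennreal)
    also have "\<dots> \<le> ennreal ?K * ennpowr (\<integral>\<^sup>+l. ennpowr (b l) r \<partial>count_space UNIV) (1 / r)"
      by (intro mult_right_mono ennreal_leI) auto
    finally show ?thesis using False
      by (simp add: lq_norm_def r_def infsum_ennreal_eq_nn_integral)
  qed
  moreover have "?K > 0" by (simp add: add_nonneg_pos)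
  ultimately show ?thesis by (intro exI[of _ ?K]) auto
qed

section \<open>Linear changes of variables\<close>

lemma shear_det:
  assumes "m \<noteq> n"
  shows "det (matrix (\<lambda>x::real^'n. \<chi> i. if i = m then x $ m + x $ n else x $ i)) = 1"
proof -
  have "matrix (\<lambda>x::real^'n. \<chi> i. if i = m then x $ m + x $ n else x $ i)
      = (\<chi> k. if k = m then row m (mat 1) + 1 *s row n (mat 1) else row k (mat 1))"
    by (auto simp: matrix_def row_def mat_def axis_def vec_eq_iff)
  then show ?thesis using det_row_operation[OF assms, of "mat 1" 1] by simp
qed

text \<open>Both sides are multiplicative in \<open>f\<close>, so it suffices to treat singular maps, diagonal maps,
  transpositions and shears.\<close>
lemma measure_linear_image_finite:
  fixes f :: "real^'n \<Rightarrow> real^'n"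
  assumes "linear f" "S \<in> lmeasurable"
  shows "f ` S \<in> lmeasurable \<and> measure lebesgue (f ` S) = \<bar>det (matrix f)\<bar> * measure lebesgue S"
proof -
  have "\<forall>S\<in>lmeasurable. f ` S \<in> lmeasurable \<and> measure lebesgue (f ` S) = \<bar>det (matrix f)\<bar> * measure lebesgue S"
  proof (rule induct_linear_elementary[OF assms(1)]; intro ballI)
    fix f g :: "real^'n \<Rightarrow> real^'n" and S :: "(real^'n) set"
    assume "linear f" "linear g" "S \<in> lmeasurable"
      and "\<forall>S\<in>lmeasurable. f ` S \<in> lmeasurable \<and> measure lebesgue (f ` S) = \<bar>det (matrix f)\<bar> * measure lebesgue S"
      and "\<forall>S\<in>lmeasurable. g ` S \<in> lmeasurable \<and> measure lebesgue (g ` S) = \<bar>det (matrix g)\<bar> * measure lebesgue S"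
    then show "(f \<circ> g) ` S \<in> lmeasurable \<and> measure lebesgue ((f \<circ> g) ` S) = \<bar>det (matrix (f \<circ> g))\<bar> * measure lebesgue S"
      unfolding image_comp[symmetric] by (simp add: matrix_compose det_mul abs_mult)
  next
    fix f :: "real^'n \<Rightarrow> real^'n" and i and S :: "(real^'n) set"
    assume f: "linear f" "\<And>x. f x $ i = 0" and S: "S \<in> lmeasurable"
    have "\<not> surj f"
    proof
      assume "surj f"
      then obtain x where "f x = axis i 1" by (metis surjD)
      then show False using f(2)[of x] by simp
    qed
    then have ninj: "\<not> inj f" using linear_injective_imp_surjective[OF f(1)] by blast
    then have "negligible (f ` S)" by (rule negligible_linear_singular_image[OF f(1)])
    moreover have "det (matrix f) = 0" using ninj det_nz_iff_inj[OF f(1)] by blast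
    ultimately show "f ` S \<in> lmeasurable \<and> measure lebesgue (f ` S) = \<bar>det (matrix f)\<bar> * measure lebesgue S"
      by (simp add: negligible_iff_measure)
  next
    fix c and S :: "(real^'n) set"
    assume S: "S \<in> lmeasurable"
    have "det (matrix (\<lambda>a::real^'n. \<chi> i. c i * a $ i)) = prod c UNIV"
      by (subst det_diagonal) (auto simp: matrix_def axis_def)
    then show "(\<lambda>a. \<chi> i. c i * a $ i) ` S \<in> lmeasurable \<and>
        measure lebesgue ((\<lambda>a. \<chi> i. c i * a $ i) ` S) = \<bar>det (matrix (\<lambda>a. \<chi> i. c i * a $ i))\<bar> * measure lebesgue S"
      using measurable_stretch[OF S, of c] measure_stretch[OF S, of c] by simp
  next
    fix m n :: 'n and S :: "(real^'n) set"
    assume "m \<noteq> n" and S: "S \<in> lmeasurable"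
    let ?t = "Transposition.transpose m n"
    let ?h = "\<lambda>v::real^'n. \<chi> i. v $ ?t i"
    have lin: "linear ?h" by (rule linearI) (simp_all add: vec_eq_iff)
    \<comment> \<open>A transposition is an involution, so its determinant has absolute value \<open>1\<close>.\<close>
    have "matrix ?h ** matrix ?h = mat 1"
      using matrix_compose[OF lin lin, symmetric] by (simp add: o_def matrix_id_mat_1[unfolded id_def])
    then have "det (matrix ?h) * det (matrix ?h) = 1" by (metis det_I det_mul)
    then have "\<bar>det (matrix ?h)\<bar> = 1" by (metis abs_1 abs_minus square_eq_1_iff)
    moreover have "measure lebesgue (?h ` cbox a b) = measure lebesgue (cbox a b)" for a b :: "real^'n"
    proof -
      have eq: "?h ` cbox a b = cbox (?h a) (?h b)"
      proof (intro set_eqI iffI)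
        fix y assume y: "y \<in> cbox (?h a) (?h b)"
        have "a $ i \<le> y $ ?t i \<and> y $ ?t i \<le> b $ i" for i
          using y[unfolded mem_box_cart, rule_format, of "?t i"] by simp
        then have "?h y \<in> cbox a b" by (simp add: mem_box_cart)
        moreover have "?h (?h y) = y" by (simp add: vec_eq_iff)
        ultimately show "y \<in> ?h ` cbox a b" by (metis image_eqI)
      qed (auto simp: mem_box_cart)
      have "bij ?t" by (rule involuntory_imp_bij) simp
      then have "(\<Prod>i\<in>UNIV. b $ ?t i - a $ ?t i) = (\<Prod>i\<in>UNIV. b $ i - a $ i)"
        by (rule prod.reindex_bij_betw)
      moreover have "(\<forall>i. a $ ?t i \<le> b $ ?t i) \<longleftrightarrow> (\<forall>i. a $ i \<le> b $ i)"
        by (metis transpose_involutory)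
      ultimately show ?thesis unfolding eq
        using interval_ne_empty_cart(1)[of a b] interval_ne_empty_cart(1)[of "?h a" "?h b"]
        by (auto simp: content_cbox_if_cart)
    qed
    ultimately show "?h ` S \<in> lmeasurable \<and> measure lebesgue (?h ` S) = \<bar>det (matrix ?h)\<bar> * measure lebesgue S"
      using measure_linear_sufficient[OF lin S, of 1] by simp
  next
    fix m n :: 'n and S :: "(real^'n) set"
    assume mn: "m \<noteq> n" and S: "S \<in> lmeasurable"
    let ?h = "\<lambda>v::real^'n. \<chi> i. if i = m then v $ m + v $ n else v $ i"
    have lin: "linear ?h" by (rule linearI) (auto simp: vec_eq_iff algebra_simps)
    have "measure lebesgue (?h ` cbox a b) = measure lebesgue (cbox a b)" for a b :: "real^'n"
    proof (cases "cbox a b = {}")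
      case False
      \<comment> \<open>Moving the corner to the origin removes the sign of its coordinates.\<close>
      then have ne: "cbox 0 (b - a) \<noteq> {}" by (simp add: interval_ne_empty_cart)
      have ab: "cbox a b = (+) a ` cbox 0 (b - a)" using cbox_translation[of a 0 "b - a"] by simp
      have "?h ` cbox a b = (+) (?h a) ` ?h ` cbox 0 (b - a)"
        unfolding ab image_comp o_def by (simp only: linear_add[OF lin])
      then have "measure lebesgue (?h ` cbox a b) = measure lebesgue (?h ` cbox 0 (b - a))"
        by (simp only: measure_translation)
      also have "\<dots> = measure lebesgue (cbox 0 (b - a))"
        by (rule measure_shear_interval[OF mn ne]) simp
      also have "\<dots> = measure lebesgue (cbox a b)" unfolding ab by (simp only: measure_translation)
      finally show ?thesis .
    qed simp
    then show "?h ` S \<in> lmeasurable \<and> measure lebesgue (?h ` S) = \<bar>det (matrix ?h)\<bar> * measure lebesgue S"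
      using measure_linear_sufficient[OF lin S, of 1] shear_det[OF mn] by simp
  qed
  then show ?thesis using assms(2) by blast
qed

text \<open>The two measures agree on boxes.\<close>
lemma lborel_linear:
  fixes M :: "real^'n^'n"
  assumes "invertible M"
  shows "lborel = density (distr lborel borel ((*v) M)) (\<lambda>_. ennreal \<bar>det M\<bar>)"
proof (rule lborel_eqI)
  obtain N where N: "M ** N = mat 1" "N ** M = mat 1" using assms by (auto simp: invertible_def)
  have meas [measurable]: "(*v) M \<in> borel \<rightarrow>\<^sub>M borel"
    by (intro borel_measurable_continuous_onI linear_continuous_on) (simp add: linear_linear)
  fix l u :: "real^'n" assume le: "\<And>b. b \<in> Basis \<Longrightarrow> l \<bullet> b \<le> u \<bullet> b"
  have pre: "(*v) M -` box l u = (*v) N ` box l u"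
  proof (intro set_eqI iffI)
    fix x assume "x \<in> (*v) M -` box l u"
    then show "x \<in> (*v) N ` box l u"
      by (intro image_eqI[of _ _ "M *v x"]) (auto simp: matrix_vector_mul_assoc N)
  qed (auto simp: matrix_vector_mul_assoc N)
  have d: "\<bar>det M\<bar> * \<bar>det N\<bar> = 1" using N by (metis abs_1 abs_mult det_I det_mul)
  have img: "(*v) N ` box l u \<in> lmeasurable" "measure lebesgue ((*v) N ` box l u) = \<bar>det N\<bar> * measure lebesgue (box l u)"
    using measure_linear_image_finite[of "(*v) N" "box l u"] by auto
  have "emeasure lborel ((*v) M -` box l u) = emeasure lebesgue ((*v) N ` box l u)"
    unfolding pre[symmetric] by (subst emeasure_completion) (use measurable_sets_borel[OF meas, of "box l u"] in auto)
  also have "\<dots> = ennreal (\<bar>det N\<bar> * measure lebesgue (box l u))"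
    using img by (simp add: emeasure_eq_measure2)
  finally have "emeasure (density (distr lborel borel ((*v) M)) (\<lambda>_. ennreal \<bar>det M\<bar>)) (box l u)
      = ennreal \<bar>det M\<bar> * ennreal (\<bar>det N\<bar> * measure lebesgue (box l u))"
    by (simp add: emeasure_density_const emeasure_distr)
  also have "\<dots> = ennreal (measure lebesgue (box l u))"
    by (simp add: d mult.assoc[symmetric] flip: ennreal_mult)
  also have "\<dots> = (\<Prod>b\<in>Basis. (u - l) \<bullet> b)"
    using le by (simp add: measure_lborel_box_eq inner_diff_left)
  finally show "emeasure (density (distr lborel borel ((*v) M)) (\<lambda>_. ennreal \<bar>det M\<bar>)) (box l u)
    = (\<Prod>b\<in>Basis. (u - l) \<bullet> b)" .
qed simp

lemma borel_measurable_matrix_vector [measurable]: "(*v) (M::real^'n^'m) \<in> borel \<rightarrow>\<^sub>M borel"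
  by (intro borel_measurable_continuous_onI linear_continuous_on) (simp add: linear_linear)

lemma integral_affine_substitution:
  fixes f :: "real^'n \<Rightarrow> 'b::{banach, second_countable_topology}"
  assumes M: "invertible M" and f [measurable]: "f \<in> borel_measurable borel"
  shows "(LINT x|lebesgue. f (M *v x + b)) = (LINT x|lebesgue. f x) /\<^sub>R \<bar>det M\<bar>"
proof -
  have d: "\<bar>det M\<bar> > 0" using M by (simp add: invertible_det_nz)
  have g [measurable]: "(\<lambda>x. f (x + b)) \<in> borel_measurable borel" by measurable
  have "(LINT x|lborel. f x) = (LINT x|distr lborel borel ((+) b). f x)" by (simp only: lborel_distr_plus)
  also have "\<dots> = (LINT x|lborel. f (x + b))" by (simp add: integral_distr add.commute)
  also have "\<dots> = \<bar>det M\<bar> *\<^sub>R (LINT x|lborel. f (M *v x + b))"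
    by (subst lborel_linear[OF M]) (simp add: integral_density integral_distr)
  finally have "(LINT x|lborel. f x) = \<bar>det M\<bar> *\<^sub>R (LINT x|lborel. f (M *v x + b))" .
  moreover have "(LINT x|lebesgue. f (M *v x + b)) = (LINT x|lborel. f (M *v x + b))"
    by (rule integral_completion) measurable
  moreover have "(LINT x|lebesgue. f x) = (LINT x|lborel. f x)"
    by (rule integral_completion) measurable
  ultimately show ?thesis using d by simp
qed

section \<open>Lattice sums and integrals of decaying functions\<close>

text \<open>Replacing \<open>t\<close> by its integer part changes each term by at most a factor \<open>4\<close>; each side of the integer
  part then contributes part of one convergent series.\<close>
lemma sum_inverse_square_int_bounded:
  "\<exists>K>0. \<forall>(t::real) S::int set. finite S \<longrightarrow> (\<Sum>n\<in>S. 1 / (1 + \<bar>t - real_of_int n\<bar>)\<^sup>2) \<le> K"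
proof -
  let ?a = "\<lambda>m::nat. 1 / (1 + real m)\<^sup>2"
  have sm: "summable ?a"
    using inverse_power_summable[of 2, where 'a=real] summable_Suc_iff[of "\<lambda>n. inverse (real n ^ 2)"]
    by (simp add: inverse_eq_divide add.commute)
  define L where "L = suminf ?a"
  have L: "(\<Sum>m\<in>F. ?a m) \<le> L" if "finite F" for F
    unfolding L_def by (rule sum_le_suminf[OF sm that]) auto
  have "(\<Sum>n\<in>S. 1 / (1 + \<bar>t - real_of_int n\<bar>)\<^sup>2) \<le> 8 * L + 1" if S: "finite S" for t :: real and S :: "int set"
  proof -
    let ?g = "\<lambda>n. nat \<bar>n - \<lfloor>t\<rfloor>\<bar>"
    have half: "(\<Sum>n\<in>F. ?a (?g n)) \<le> L" if "F \<subseteq> S" "inj_on ?g F" for F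
    proof -
      have "finite F" using that S finite_subset by blast
      then show ?thesis using L[of "?g ` F"] that by (simp add: sum.reindex)
    qed
    have "(\<Sum>n\<in>S. 1 / (1 + \<bar>t - real_of_int n\<bar>)\<^sup>2) \<le> (\<Sum>n\<in>S. 4 * ?a (?g n))"
    proof (rule sum_mono)
      fix n
      have "real (?g n) = \<bar>real_of_int n - real_of_int \<lfloor>t\<rfloor>\<bar>" by simp
      moreover have "\<bar>real_of_int n - real_of_int \<lfloor>t\<rfloor>\<bar> \<le> \<bar>t - real_of_int n\<bar> + 1" by linarith
      ultimately have "1 + real (?g n) \<le> 2 * (1 + \<bar>t - real_of_int n\<bar>)" 
        by (rule order_trans[OF add_left_mono[OF eq_refl] order_trans[OF add_left_mono]]) simp
      then have "(1 + real (?g n))\<^sup>2 \<le> (2 * (1 + \<bar>t - real_of_int n\<bar>))\<^sup>2"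
        by (rule power_mono) auto
      then have "(1 + real (?g n))\<^sup>2 \<le> 4 * (1 + \<bar>t - real_of_int n\<bar>)\<^sup>2"
        by (simp only: power_mult_distrib) simp
      then show "1 / (1 + \<bar>t - real_of_int n\<bar>)\<^sup>2 \<le> 4 * ?a (?g n)"
        by (subst (asm) pos_divide_le_eq[symmetric], simp, simp add: add_pos_nonneg)
           (simp add: field_simps add_nonneg_eq_0_iff)
    qed
    also have "\<dots> = 4 * (\<Sum>n\<in>S \<inter> {..<\<lfloor>t\<rfloor>} \<union> S \<inter> {\<lfloor>t\<rfloor>..}. ?a (?g n))"
      unfolding sum_distrib_left by (rule sum.cong) auto
    also have "\<dots> = 4 * ((\<Sum>n\<in>S \<inter> {..<\<lfloor>t\<rfloor>}. ?a (?g n)) + (\<Sum>n\<in>S \<inter> {\<lfloor>t\<rfloor>..}. ?a (?g n)))"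
      by (subst sum.union_disjoint) (use S in auto)
    also have "\<dots> \<le> 4 * (L + L)"
      by (intro mult_left_mono add_mono half) (auto simp: inj_on_def)
    finally show ?thesis by simp
  qed
  moreover have "0 \<le> L" using L[of "{}"] by simp
  ultimately show ?thesis by (intro exI[of _ "8 * L + 1"]) auto
qed

text \<open>The summand is dominated by a product of one-dimensional terms.\<close>
lemma lattice_sum_bounded:
  "\<exists>K>0. \<forall>x::real^'d. (\<integral>\<^sup>+j. ennreal (1 / (1 + norm (x - ivec j)) ^ (2 * CARD('d))) \<partial>count_space UNIV) \<le> ennreal K"
proof -
  obtain K where K: "K > 0" "\<And>t S. finite S \<Longrightarrow> (\<Sum>n\<in>S. 1 / (1 + \<bar>t - real_of_int n\<bar>)\<^sup>2) \<le> K"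
    using sum_inverse_square_int_bounded by blast
  have "(\<integral>\<^sup>+j. ennreal (1 / (1 + norm (x - ivec j)) ^ (2 * CARD('d))) \<partial>count_space UNIV) \<le> ennreal (K ^ CARD('d))"
    for x :: "real^'d"
  proof -
    let ?b = "\<lambda>i n. 1 / (1 + \<bar>x $ i - real_of_int n\<bar>)\<^sup>2"
    have factor: "1 / (1 + norm (x - ivec j)) ^ (2 * CARD('d)) \<le> (\<Prod>i\<in>UNIV. ?b i (j $ i))" for j
    proof -
      have "(\<Prod>i\<in>UNIV. (1 + \<bar>x $ i - real_of_int (j $ i)\<bar>)\<^sup>2) \<le> (\<Prod>i\<in>(UNIV::'d set). (1 + norm (x - ivec j))\<^sup>2)"
      proof (intro prod_mono conjI power_mono)
        fix i
        show "1 + \<bar>x $ i - real_of_int (j $ i)\<bar> \<le> 1 + norm (x - ivec j)"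
          using component_le_norm_cart[of "x - ivec j" i] by (simp add: ivec_def)
      qed auto
      also have "\<dots> = (1 + norm (x - ivec j)) ^ (2 * CARD('d))" by (simp add: power_mult)
      finally have "1 / (1 + norm (x - ivec j)) ^ (2 * CARD('d))
          \<le> 1 / (\<Prod>i\<in>UNIV. (1 + \<bar>x $ i - real_of_int (j $ i)\<bar>)\<^sup>2)"
        by (intro divide_left_mono mult_pos_pos prod_pos zero_less_power add_pos_nonneg) auto
      then show ?thesis by (simp add: prod_dividef)
    qed
    have "(\<Sum>j\<in>J. ennreal (1 / (1 + norm (x - ivec j)) ^ (2 * CARD('d)))) \<le> ennreal (K ^ CARD('d))"
      if J: "finite J" for J
    proof -
      define B where "B i = (\<lambda>j. j $ i) ` J" for i
      have finB: "finite (B i)" for i using J by (simp add: B_def)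
      have "(\<Sum>j\<in>J. 1 / (1 + norm (x - ivec j)) ^ (2 * CARD('d))) \<le> (\<Sum>j\<in>J. \<Prod>i\<in>UNIV. ?b i (j $ i))"
        by (intro sum_mono factor)
      also have "\<dots> = (\<Sum>g\<in>vec_nth ` J. \<Prod>i\<in>UNIV. ?b i (g i))"
        by (subst sum.reindex) (auto simp: inj_on_def vec_nth_inject)
      also have "\<dots> \<le> (\<Sum>g\<in>Pi\<^sub>E UNIV B. \<Prod>i\<in>UNIV. ?b i (g i))"
        by (intro sum_mono2 finite_PiE finB prod_nonneg) (auto simp: B_def)
      also have "\<dots> = (\<Prod>i\<in>UNIV. \<Sum>n\<in>B i. ?b i n)"
        by (rule prod_sum_PiE[symmetric]) (auto simp: finB)
      also have "\<dots> \<le> (\<Prod>i\<in>(UNIV::'d set). K)"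
        by (intro prod_mono conjI K finB sum_nonneg) auto
      finally show ?thesis by (subst sum_ennreal) (auto intro!: ennreal_leI)
    qed
    then show ?thesis
      by (subst infsum_ennreal_eq_nn_integral[symmetric]) (auto simp: nonneg_infsum_complete intro!: SUP_least)
  qed
  then show ?thesis using K(1) by (intro exI[of _ "K ^ CARD('d)"]) auto
qed

lemma summable_level_lattice:
  fixes \<theta> :: real
  assumes \<theta>: "0 \<le> \<theta>" "\<theta> < 1"
  shows "(\<lambda>(j :: int^'d, k). \<theta> ^ nat \<bar>k\<bar> / (1 + norm (ivec j :: real^'d)) ^ (2 * CARD('d))) summable_on UNIV"
proof -
  let ?dd = "2 * CARD('d)"
  let ?f = "\<lambda>j :: int^'d. 1 / (1 + norm (ivec j :: real^'d)) ^ ?dd" and ?h = "\<lambda>k :: int. \<theta> ^ nat \<bar>k\<bar>"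
  obtain K where K: "K > 0" "\<And>x::real^'d. (\<integral>\<^sup>+j. ennreal (1 / (1 + norm (x - ivec j)) ^ ?dd) \<partial>count_space UNIV) \<le> ennreal K"
    using lattice_sum_bounded by blast
  have f: "sum ?f J \<le> K" if "finite J" for J
  proof -
    have "ennreal (sum ?f J) = (\<Sum>j\<in>J. ennreal (?f j))" by (subst sum_ennreal) auto
    also have "\<dots> \<le> (\<integral>\<^sup>+j. ennreal (?f j) \<partial>count_space UNIV)"
      by (rule sum_le_nn_integral_count_space[OF that]) simp
    also have "\<dots> \<le> ennreal K" using K(2)[of 0] by simp
    finally show ?thesis using K(1) by (simp add: ennreal_le_iff)
  qed
  have h: "sum ?h L \<le> 2 / (1 - \<theta>)" if "finite L" for L
  proof -
    have "ennreal (sum ?h L) = (\<Sum>k\<in>L. ennreal (?h k))" using \<theta> by (subst sum_ennreal) auto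
    also have "\<dots> \<le> (\<integral>\<^sup>+k. ennreal (?h k) \<partial>count_space UNIV)"
      by (rule sum_le_nn_integral_count_space[OF that]) simp
    also have "\<dots> \<le> ennreal (2 / (1 - \<theta>))" using nn_integral_geometric_int[OF \<theta>, of 0] by simp
    finally show ?thesis using \<theta> by (subst (asm) ennreal_le_iff) auto
  qed
  show ?thesis
  proof (rule nonneg_bdd_above_summable_on)
    show "bdd_above (sum (\<lambda>(j :: int^'d, k). \<theta> ^ nat \<bar>k\<bar> / (1 + norm (ivec j :: real^'d)) ^ ?dd) ` {F. F \<subseteq> UNIV \<and> finite F})"
    proof (rule bdd_aboveI2, clarsimp)
      fix F :: "((int^'d) \<times> int) set" assume F: "finite F"
      have "(\<Sum>(j, k)\<in>F. \<theta> ^ nat \<bar>k\<bar> / (1 + norm (ivec j :: real^'d)) ^ ?dd)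
          \<le> (\<Sum>(j, k)\<in>fst ` F \<times> snd ` F. ?f j * ?h k)"
      proof -
        have "(\<Sum>(j, k)\<in>F. \<theta> ^ nat \<bar>k\<bar> / (1 + norm (ivec j :: real^'d)) ^ ?dd) = (\<Sum>(j, k)\<in>F. ?f j * ?h k)"
          by simp
        also have "\<dots> \<le> (\<Sum>(j, k)\<in>fst ` F \<times> snd ` F. ?f j * ?h k)"
          by (rule sum_mono2) (use F \<theta> subset_fst_snd[of F] in auto)
        finally show ?thesis .
      qed
      also have "\<dots> = sum ?f (fst ` F) * sum ?h (snd ` F)"
        by (simp add: sum_product sum.cartesian_product)
      also have "\<dots> \<le> K * (2 / (1 - \<theta>))"
        using F K(1) \<theta> by (intro mult_mono f h sum_nonneg) auto
      finally show "(\<Sum>(j, k)\<in>F. \<theta> ^ nat \<bar>k\<bar> / (1 + norm (ivec j :: real^'d)) ^ ?dd) \<le> K * (2 / (1 - \<theta>))" .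
    qed
  qed (use \<theta> in auto)
qed

definition ucube :: "int^'d \<Rightarrow> (real^'d) set" where
  "ucube j = {x. \<forall>i. x $ i \<in> {real_of_int (j $ i)..real_of_int (j $ i) + 1}}"

lemma ucube_cbox: "ucube j = cbox (ivec j) (ivec j + 1)"
  by (auto simp: ucube_def mem_box_cart ivec_def)

lemma emeasure_ucube: "emeasure lebesgue (ucube j) = 1"
proof -
  have "measure lebesgue (ucube j) = 1"
    by (simp add: ucube_cbox content_cbox_if_cart interval_ne_empty_cart)
  then show ?thesis by (simp add: ucube_cbox emeasure_eq_measure2)
qed

lemma norm_ucube_diff:
  assumes "x \<in> ucube j" "y \<in> ucube j" shows "norm (x - (y::real^'d)) \<le> real CARD('d)"
proof -
  have "norm (x - y) \<le> (\<Sum>i\<in>UNIV. \<bar>(x - y) $ i\<bar>)" by (rule norm_le_l1_cart)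
  also have "\<dots> \<le> (\<Sum>i\<in>(UNIV::'d set). 1)"
  proof (rule sum_mono)
    fix i
    have "x $ i \<in> {real_of_int (j $ i)..real_of_int (j $ i) + 1}" "y $ i \<in> {real_of_int (j $ i)..real_of_int (j $ i) + 1}"
      using assms by (auto simp: ucube_def)
    then show "\<bar>(x - y) $ i\<bar> \<le> 1" by (simp add: abs_le_iff)
  qed
  finally show ?thesis by simp
qed

lemma ivec_in_ucube: "ivec j \<in> ucube j"
  by (simp add: ucube_def ivec_def)

lemma ex_ucube: "\<exists>j. x \<in> ucube j"
  by (rule exI[of _ "\<chi> i. \<lfloor>x $ i\<rfloor>"]) (auto simp: ucube_def floor_le_iff real_of_int_floor_add_one_ge)

text \<open>Inside a unit cube, \<open>1 + \<bar>z - x\<bar>\<close> is constant up to a factor.\<close>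
lemma one_plus_norm_ucube:
  assumes "x \<in> ucube j" "y \<in> ucube j"
  shows "1 + norm (z - x) \<le> (1 + real CARD('d)) * (1 + norm (z - (y::real^'d)))"
proof -
  have "norm (z - x) \<le> norm (z - y) + norm (y - x)" by (metis diff_add_cancel add_diff_eq norm_triangle_ineq)
  also have "norm (y - x) \<le> real CARD('d)" by (rule norm_ucube_diff[OF assms(2,1)])
  finally have "1 + norm (z - x) \<le> 1 + norm (z - y) + real CARD('d)" by simp
  also have "\<dots> \<le> (1 + real CARD('d)) * (1 + norm (z - y))" by (simp add: algebra_simps)
  finally show ?thesis .
qed

text \<open>The integral over each unit cube is comparable to the value at its lattice point.\<close>
lemma integrable_decay: "integrable lebesgue (\<lambda>x::real^'d. 1 / (1 + norm x) ^ (2 * CARD('d)))"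
proof (rule integrableI_nonneg)
  let ?N = "2 * CARD('d)"
  let ?f = "\<lambda>x::real^'d. 1 / (1 + norm x) ^ ?N"
  have "?f \<in> borel_measurable borel" by measurable
  then show "?f \<in> borel_measurable lebesgue" by (simp add: measurable_completion)
  obtain K where K: "\<And>x::real^'d. (\<integral>\<^sup>+j. ennreal (1 / (1 + norm (x - ivec j)) ^ ?N) \<partial>count_space UNIV) \<le> ennreal K"
    using lattice_sum_bounded by blast
  let ?c = "(1 + real CARD('d)) ^ ?N"
  have "(\<integral>\<^sup>+x. ennreal (?f x) \<partial>lebesgue)
      \<le> (\<integral>\<^sup>+x. (\<integral>\<^sup>+j. ennreal (?c * (1 / (1 + norm (0 - ivec j :: real^'d)) ^ ?N)) * indicator (ucube j) x \<partial>count_space UNIV) \<partial>lebesgue)"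
  proof (rule nn_integral_mono)
    fix x :: "real^'d"
    obtain j where j: "x \<in> ucube j" using ex_ucube by blast
    have "(1 + norm (0 - ivec j :: real^'d)) ^ ?N \<le> ((1 + real CARD('d)) * (1 + norm (0 - x))) ^ ?N"
      by (intro power_mono one_plus_norm_ucube[OF ivec_in_ucube j]) auto
    then have "?f x \<le> ?c * (1 / (1 + norm (0 - ivec j :: real^'d)) ^ ?N)"
      by (simp add: power_mult_distrib divide_simps add_pos_nonneg)
    then have "ennreal (?f x) \<le> (\<Sum>j\<in>{j}. ennreal (?c * (1 / (1 + norm (0 - ivec j :: real^'d)) ^ ?N)) * indicator (ucube j) x)"
      using j by (simp add: ennreal_leI)
    also have "\<dots> \<le> (\<integral>\<^sup>+j. ennreal (?c * (1 / (1 + norm (0 - ivec j :: real^'d)) ^ ?N)) * indicator (ucube j) x \<partial>count_space UNIV)"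
      by (rule sum_le_nn_integral_count_space) auto
    finally show "ennreal (?f x) \<le> \<dots>" .
  qed
  also have "\<dots> = (\<integral>\<^sup>+j. (\<integral>\<^sup>+x. ennreal (?c * (1 / (1 + norm (0 - ivec j :: real^'d)) ^ ?N)) * indicator (ucube j) x \<partial>lebesgue) \<partial>count_space UNIV)"
  proof (rule nn_integral_count_space_nn_integral)
    fix j :: "int^'d"
    have [measurable]: "ucube j \<in> sets lebesgue" by (simp add: ucube_cbox)
    show "(\<lambda>x. ennreal (?c * (1 / (1 + norm (0 - ivec j :: real^'d)) ^ ?N)) * indicator (ucube j) x)
        \<in> borel_measurable lebesgue" by measurable
  qed simp
  also have "\<dots> = (\<integral>\<^sup>+j. ennreal (?c * (1 / (1 + norm (0 - ivec j :: real^'d)) ^ ?N)) \<partial>count_space UNIV)"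
    by (intro nn_integral_cong) (subst nn_integral_cmult_indicator, auto simp: emeasure_ucube, simp add: ucube_cbox)
  also have "\<dots> = ennreal ?c * (\<integral>\<^sup>+j. ennreal (1 / (1 + norm (0 - ivec j :: real^'d)) ^ ?N) \<partial>count_space UNIV)"
    by (subst nn_integral_cmult[symmetric]) (auto simp flip: ennreal_mult')
  also have "\<dots> \<le> ennreal ?c * ennreal K" by (intro mult_left_mono K) auto
  also have "\<dots> < \<infinity>" by (simp add: ennreal_mult_less_top)
  finally show "(\<integral>\<^sup>+x. ennreal (?f x) \<partial>lebesgue) < \<infinity>" .
qed auto

lemma integrable_decay_bound:
  fixes g :: "real^'d \<Rightarrow> complex"
  assumes "g \<in> borel_measurable lebesgue" "\<And>x. norm (g x) \<le> c / (1 + norm x) ^ (2 * CARD('d))"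
  shows "integrable lebesgue g"
proof (rule Bochner_Integration.integrable_bound)
  show "integrable lebesgue (\<lambda>x::real^'d. c * (1 / (1 + norm x) ^ (2 * CARD('d))))"
    by (intro integrable_mult_right integrable_decay)
  show "AE x in lebesgue. norm (g x) \<le> norm (c * (1 / (1 + norm x) ^ (2 * CARD('d))))"
  proof (intro always_eventually allI)
    fix x :: "real^'d"
    have "norm (g x) \<le> c * (1 / (1 + norm x) ^ (2 * CARD('d)))" using assms(2)[of x] by simp
    then show "norm (g x) \<le> norm (c * (1 / (1 + norm x) ^ (2 * CARD('d))))"
      unfolding real_norm_def by linarith
  qed
qed (use assms in auto)

section \<open>Integer powers of a dilation\<close>

lemma mat_zpow_0 [simp]: "mat_zpow A 0 = mat 1"
  by (simp add: mat_zpow_def)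

lemma matrix_inv_works:
  assumes "invertible (A::'a::field^'n^'n)"
  shows "A ** matrix_inv A = mat 1" "matrix_inv A ** A = mat 1"
  using someI_ex[OF assms[unfolded invertible_def]] by (simp_all add: matrix_inv_def)

lemma mat_zpow_Suc:
  assumes A: "invertible A" shows "mat_zpow A (k + 1) = A ** mat_zpow A k"
proof (cases "0 \<le> k")
  case True
  then have "nat (k + 1) = Suc (nat k)" by simp
  then show ?thesis using True by (simp add: mat_zpow_def)
next
  case False
  then have n: "nat (- k) = Suc (nat (- (k + 1)))" by simp
  have "A ** mat_zpow A k = A ** (matrix_inv A ** (((**) (matrix_inv A)) ^^ nat (- (k + 1))) (mat 1))"
    using False by (simp add: mat_zpow_def n)
  also have "\<dots> = (((**) (matrix_inv A)) ^^ nat (- (k + 1))) (mat 1)"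
    by (simp add: matrix_mul_assoc matrix_inv_works[OF A])
  also have "\<dots> = mat_zpow A (k + 1)" using False by (cases "k = -1") (simp_all add: mat_zpow_def)
  finally show ?thesis by simp
qed

lemma mat_zpow_pred:
  assumes A: "invertible A" shows "mat_zpow A (k - 1) = matrix_inv A ** mat_zpow A k"
  using mat_zpow_Suc[OF A, of "k - 1"] by (simp add: matrix_mul_assoc matrix_inv_works[OF A])

lemma mat_zpow_add:
  assumes A: "invertible A" shows "mat_zpow A (k + l) = mat_zpow A k ** mat_zpow A l"
proof (induction k rule: int_induct[where k = 0])
  case (step1 i)
  have "mat_zpow A (i + 1 + l) = mat_zpow A ((i + l) + 1)" by (simp add: algebra_simps)
  then show ?case using step1 by (simp only: mat_zpow_Suc[OF A] matrix_mul_assoc)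
next
  case (step2 i)
  have "mat_zpow A (i - 1 + l) = mat_zpow A ((i + l) - 1)" by (simp add: algebra_simps)
  then show ?case using step2 by (simp only: mat_zpow_pred[OF A] matrix_mul_assoc)
qed simp

lemma mat_zpow_add_vec:
  assumes "invertible A" shows "mat_zpow A (k + l) *v x = mat_zpow A k *v (mat_zpow A l *v x)"
  by (simp add: mat_zpow_add[OF assms] matrix_vector_mul_assoc)

lemma mat_zpow_inverse_vec [simp]:
  assumes "invertible A"
  shows "mat_zpow A k *v (mat_zpow A (- k) *v x) = x" "mat_zpow A (- k) *v (mat_zpow A k *v x) = x"
  by (simp_all flip: mat_zpow_add_vec[OF assms])

lemma invertible_mat_zpow:
  assumes "invertible A" shows "invertible (mat_zpow A k)"
  unfolding invertible_def
  by (rule exI[of _ "mat_zpow A (- k)"]) (simp flip: mat_zpow_add[OF assms])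

lemma det_mat_zpow:
  fixes A :: "'a::field^'n^'n"
  assumes A: "invertible A" shows "det (mat_zpow A k) = det A powi k"
proof -
  have d: "det A \<noteq> 0" using A by (simp add: invertible_det_nz)
  have di: "det (matrix_inv A) = inverse (det A)"
    by (metis d A det_I det_mul inverse_unique matrix_inv_works(1))
  show ?thesis
  proof (induction k rule: int_induct[where k = 0])
    case (step1 i)
    then show ?case using d by (simp add: mat_zpow_Suc[OF A] det_mul power_int_add mult.commute)
  next
    case (step2 i)
    then show ?case using d by (simp add: mat_zpow_pred[OF A] det_mul di power_int_diff field_simps)
  qed simp
qed

lemma matrix_vector_scaleR: "(M::real^'n^'m) *v (c *\<^sub>R x) = c *\<^sub>R (M *v x)"
  by (simp add: matrix_scaleR_vector_ac scaleR_matrix_vector_assoc)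

text \<open>The inclusion \<open>r \<Delta> \<subseteq> A \<Delta>\<close> says that the inverse of \<open>A\<close> contracts the norm with unit ball \<open>\<Delta>\<close> by
  the factor \<open>1 / r\<close>.\<close>
locale dilation =
  fixes A P :: "real^'d^'d" and \<Delta> :: "(real^'d) set" and r :: real
  assumes P: "invertible P" and \<Delta>: "\<Delta> = {x. norm (P *v x) < 1}"
    and r: "1 < r" and r\<Delta>: "(*\<^sub>R) r ` \<Delta> \<subseteq> (*v) A ` \<Delta>"
begin

abbreviation Z :: "int \<Rightarrow> real^'d \<Rightarrow> real^'d" where "Z k x \<equiv> mat_zpow A k *v x"

lemma norm_P_bounds: "\<exists>a>0. \<exists>b>0. \<forall>x. a * norm x \<le> norm (P *v x) \<and> norm (P *v x) \<le> b * norm x"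
proof -
  obtain b where b: "b > 0" "\<And>x. norm (P *v x) \<le> b * norm x"
    using linear_bounded_pos[of "(*v) P"] by (auto simp: mult.commute)
  obtain a where a: "a > 0" "\<And>x. norm (matrix_inv P *v x) \<le> a * norm x"
    using linear_bounded_pos[of "(*v) (matrix_inv P)"] by (auto simp: mult.commute)
  have "(1 / a) * norm x \<le> norm (P *v x)" for x
    using a(2)[of "P *v x"] a(1) by (simp add: matrix_vector_mul_assoc matrix_inv_works[OF P] field_simps)
  then show ?thesis using a(1) b by (intro exI[of _ "1 / a"] conjI exI[of _ b]) auto
qed

text \<open>The image of \<open>A\<close> contains the ellipsoid \<open>r \<Delta>\<close>, which is absorbing.\<close>
lemma invertible_A: "invertible A"
proof -
  have "\<exists>y. A *v y = x" for x
  proof -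
    define t where "t = r / (norm (P *v x) + 1)"
    have t: "t > 0" using r by (simp add: t_def add_nonneg_pos)
    have "norm (P *v x) / (norm (P *v x) + 1) < 1" by (simp add: add_nonneg_pos)
    then have "(1 / (norm (P *v x) + 1)) *\<^sub>R x \<in> \<Delta>" by (simp add: \<Delta> matrix_vector_scaleR)
    then have "r *\<^sub>R ((1 / (norm (P *v x) + 1)) *\<^sub>R x) \<in> (*v) A ` \<Delta>" using r\<Delta> by blast
    then obtain z where "t *\<^sub>R x = A *v z" by (auto simp: t_def)
    then have "A *v ((1 / t) *\<^sub>R z) = (1 / t) *\<^sub>R (t *\<^sub>R x)" by (simp only: matrix_vector_scaleR)
    then show ?thesis using t by auto
  qed
  then have "surj ((*v) A)" by (metis surjI)
  then show ?thesis
    using matrix_right_invertible_surjective invertible_right_inverse by blast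
qed

lemma det_pos: "0 < \<bar>det A\<bar>" using invertible_A by (simp add: invertible_det_nz)

lemmas Z_add = mat_zpow_add_vec[OF invertible_A]
lemmas Z_inverse [simp] = mat_zpow_inverse_vec[OF invertible_A]

text \<open>The norm whose unit ball is \<open>B\<^sub>k\<close>.\<close>
definition dgauge :: "int \<Rightarrow> real^'d \<Rightarrow> real" where "dgauge k x = norm (P *v (Z (- k) x))"

lemma dgauge_triangle: "dgauge k (x + y) \<le> dgauge k x + dgauge k y"
  by (simp add: dgauge_def matrix_vector_right_distrib norm_triangle_ineq)

lemma dgauge_scale: "dgauge k (c *\<^sub>R x) = \<bar>c\<bar> * dgauge k x"
  by (simp add: dgauge_def matrix_vector_scaleR)

lemma dgauge_minus: "dgauge k (- x) = dgauge k x"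
  using dgauge_scale[of k "-1" x] by simp

lemma dgauge_nonneg: "0 \<le> dgauge k x" by (simp add: dgauge_def)

lemma dgauge_shift: "dgauge (k + l) (Z k x) = dgauge l x"
  by (simp add: dgauge_def flip: Z_add)

lemma dgauge_pred: "dgauge (k + 1) x \<le> dgauge k x / r"
proof (rule field_le_epsilon)
  \<comment> \<open>The room \<open>e\<close> is needed since \<open>\<Delta>\<close> is the open unit ball.\<close>
  fix e :: real assume e: "e > 0"
  let ?x = "Z (- k) x"
  define t where "t = dgauge k x / r + e"
  have t: "t > 0" using e r dgauge_nonneg[of k x] by (simp add: t_def add_nonneg_pos)
  have "dgauge k x < r * t" using e r by (simp add: t_def field_simps)
  then have "(1 / (r * t)) *\<^sub>R ?x \<in> \<Delta>" using t r by (simp add: \<Delta> matrix_vector_scaleR dgauge_def field_simps)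
  then have "r *\<^sub>R ((1 / (r * t)) *\<^sub>R ?x) \<in> (*v) A ` \<Delta>" using r\<Delta> by blast
  then obtain z where z: "z \<in> \<Delta>" "(1 / t) *\<^sub>R ?x = A *v z" using r by auto
  have A1: "A *v z = Z 1 z" using mat_zpow_Suc[OF invertible_A, of 0] by simp
  have "(1 / t) *\<^sub>R Z (- (k + 1)) x = Z (- 1) ((1 / t) *\<^sub>R ?x)"
    by (simp add: matrix_vector_scaleR algebra_simps flip: Z_add)
  also have "\<dots> = z" unfolding z(2) A1 by simp
  finally have "norm (P *v ((1 / t) *\<^sub>R Z (- (k + 1)) x)) < 1" using z(1) by (simp add: \<Delta>)
  then show "dgauge (k + 1) x \<le> dgauge k x / r + e"
    using t by (simp add: dgauge_def matrix_vector_scaleR t_def field_simps)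
qed

lemma dgauge_decay: "dgauge (k + int n) x \<le> dgauge k x / r ^ n"
proof (induction n)
  case (Suc n)
  have "dgauge (k + int (Suc n)) x \<le> dgauge (k + int n) x / r" using dgauge_pred[of "k + int n" x] by (simp add: add_ac)
  also have "\<dots> \<le> (dgauge k x / r ^ n) / r" using Suc r by (intro divide_right_mono) auto
  finally show ?case by (simp add: mult.commute)
qed simp

lemma dgauge_antimono: "k \<le> l \<Longrightarrow> dgauge l x \<le> dgauge k x"
proof -
  assume "k \<le> l"
  then obtain n where l: "l = k + int n" using zle_iff_zadd by blast
  have "dgauge k x / r ^ n \<le> dgauge k x / 1" using r by (intro divide_left_mono dgauge_nonneg) auto
  then show ?thesis using dgauge_decay[of k n x] l by simp
qed

text \<open>The contraction in the norm of \<open>\<Delta>\<close>, transferred to the Euclidean norm.\<close>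
lemma Z_contraction: "\<exists>c>0. \<forall>n x. norm (Z (- int n) x) \<le> c * (1 / r) ^ n * norm x"
proof -
  obtain a b where ab: "a > 0" "b > 0" "\<And>x. a * norm x \<le> norm (P *v x)" "\<And>x. norm (P *v x) \<le> b * norm x"
    using norm_P_bounds by blast
  have "norm (Z (- int n) x) \<le> (b / a) * (1 / r) ^ n * norm x" for n x
  proof -
    have "a * norm (Z (- int n) x) \<le> dgauge (int n) x" by (simp add: dgauge_def ab(3))
    also have "\<dots> \<le> dgauge 0 x / r ^ n" using dgauge_decay[of 0 n x] by simp
    also have "\<dots> \<le> (b * norm x) / r ^ n" using r ab(4)[of x] by (intro divide_right_mono) (auto simp: dgauge_def)
    finally show ?thesis using ab(1) r by (simp add: pos_le_divide_eq power_one_over field_simps)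
  qed
  then show ?thesis using ab by (intro exI[of _ "b / a"]) auto
qed

lemma Z_growth: "\<exists>L\<ge>1. \<forall>n x. norm (Z (int n) x) \<le> L ^ n * norm x"
proof -
  obtain b where b: "b > 0" "\<And>x. norm (A *v x) \<le> b * norm x"
    using linear_bounded_pos[of "(*v) A"] by (auto simp: mult.commute)
  define L where "L = max 1 b"
  have "norm (Z (int n) x) \<le> L ^ n * norm x" for n x
  proof (induction n)
    case (Suc n)
    have "Z (int (Suc n)) x = A *v Z (int n) x"
      using mat_zpow_Suc[OF invertible_A, of "int n"] by (simp add: add.commute matrix_vector_mul_assoc)
    then have "norm (Z (int (Suc n)) x) \<le> b * norm (Z (int n) x)" using b(2) by simp
    also have "\<dots> \<le> L * (L ^ n * norm x)" using Suc b(1) by (intro mult_mono) (auto simp: L_def)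
    finally show ?case by simp
  qed simp
  then show ?thesis by (intro exI[of _ L]) (auto simp: L_def)
qed

subsection \<open>Doubling measures\<close>

definition gauge_ball :: "real^'d \<Rightarrow> int \<Rightarrow> real \<Rightarrow> (real^'d) set" where
  "gauge_ball x k \<rho> = {z. dgauge k (z - x) < \<rho>}"

lemma continuous_dgauge: "continuous_on S (\<lambda>z. dgauge k (z - x))"
  unfolding dgauge_def
  by (intro continuous_intros linear_continuous_on_compose[of S _ "(*v) P"]
      linear_continuous_on_compose[of S _ "(*v) (mat_zpow A (- k))"]) auto

lemma gauge_ball_sets [measurable]: "gauge_ball x k \<rho> \<in> sets lebesgue"
proof -
  have "open (gauge_ball x k \<rho>)" unfolding gauge_ball_def
    by (rule open_Collect_less[OF continuous_dgauge continuous_on_const])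
  then show ?thesis by simp
qed

lemma gauge_ball_dball: "(+) x ` dball0 A \<Delta> k = gauge_ball x k 1"
proof (intro set_eqI iffI)
  fix z assume "z \<in> gauge_ball x k 1"
  then have "Z (- k) (z - x) \<in> \<Delta>" by (simp add: gauge_ball_def dgauge_def \<Delta>)
  then show "z \<in> (+) x ` dball0 A \<Delta> k"
    unfolding dball0_def by (intro image_eqI[of _ _ "z - x"] image_eqI[of "z - x" _ "Z (- k) (z - x)"]) auto
qed (auto simp: dball0_def gauge_ball_def dgauge_def \<Delta>)

lemma gauge_ball_double_dball: "(+) x ` (*\<^sub>R) 2 ` dball0 A \<Delta> k = gauge_ball x k 2"
proof (intro set_eqI iffI)
  fix z assume "z \<in> gauge_ball x k 2"
  then have "Z (- k) ((1/2) *\<^sub>R (z - x)) \<in> \<Delta>" by (simp add: gauge_ball_def dgauge_def \<Delta> matrix_vector_scaleR)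
  then have "(1/2) *\<^sub>R (z - x) \<in> dball0 A \<Delta> k"
    unfolding dball0_def by (intro image_eqI[of _ _ "Z (- k) ((1/2) *\<^sub>R (z - x))"]) auto
  then have "2 *\<^sub>R ((1/2) *\<^sub>R (z - x)) \<in> (*\<^sub>R) 2 ` dball0 A \<Delta> k" by blast
  then have "z - x \<in> (*\<^sub>R) 2 ` dball0 A \<Delta> k" by simp
  then show "z \<in> (+) x ` (*\<^sub>R) 2 ` dball0 A \<Delta> k" by (rule image_eqI[rotated]) simp
qed (auto simp: dball0_def gauge_ball_def dgauge_def \<Delta> matrix_vector_scaleR)

definition doubling_measure :: "real \<Rightarrow> (real^'d) measure \<Rightarrow> bool" where
  "doubling_measure c N \<longleftrightarrow> sets N = sets lebesgue \<and> 1 \<le> c \<and>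
     (\<forall>x k. emeasure N (gauge_ball x k 2) \<le> ennreal c * emeasure N (gauge_ball x k 1))"

text \<open>If \<open>z\<close> lies in the ball of centre \<open>x\<close>, the ball around \<open>z\<close> lies in the doubled ball around \<open>x\<close>; a chain of \<open>n\<close>
  such steps leads from \<open>x\<close> to any point at distance at most \<open>n\<close>.\<close>
lemma doubling_move:
  assumes N: "doubling_measure c N" and "dgauge k (z - x) \<le> real n"
  shows "emeasure N (gauge_ball z k 1) \<le> ennreal (c ^ n) * emeasure N (gauge_ball x k 1)"
  using assms(2)
proof (induction n arbitrary: x)
  case 0
  then have "dgauge k (z - x) = 0" using dgauge_nonneg[of k "z - x"] by simp
  have "gauge_ball z k 1 \<subseteq> gauge_ball x k 1"
  proof
    fix w assume "w \<in> gauge_ball z k 1"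
    then show "w \<in> gauge_ball x k 1" using dgauge_triangle[of k "w - z" "z - x"] 0 by (simp add: gauge_ball_def)
  qed
  then show ?case using N by (simp add: emeasure_mono doubling_measure_def)
next
  case (Suc n)
  \<comment> \<open>The first point of the chain from \<open>x\<close> to \<open>z\<close>.\<close>
  define z' where "z' = x + (1 / real (Suc n)) *\<^sub>R (z - x)"
  have "dgauge k (z' - x) = dgauge k (z - x) / real (Suc n)" by (simp add: z'_def dgauge_scale)
  also have "\<dots> \<le> 1" using Suc.prems by simp
  finally have 1: "dgauge k (z' - x) \<le> 1" .
  have "z - z' = (real n / real (Suc n)) *\<^sub>R (z - x)"
  proof -
    have "z - z' = (1 - 1 / real (Suc n)) *\<^sub>R (z - x)" by (simp add: z'_def scaleR_left_diff_distrib)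
    also have "1 - 1 / real (Suc n) = real n / real (Suc n)" by (simp add: field_simps)
    finally show ?thesis .
  qed
  then have "dgauge k (z - z') = real n / real (Suc n) * dgauge k (z - x)" by (simp only: dgauge_scale) simp
  also have "\<dots> \<le> real n / real (Suc n) * real (Suc n)" by (intro mult_left_mono Suc.prems) auto
  finally have 2: "dgauge k (z - z') \<le> real n" by simp
  have "gauge_ball z' k 1 \<subseteq> gauge_ball x k 2"
  proof
    fix w assume "w \<in> gauge_ball z' k 1"
    then show "w \<in> gauge_ball x k 2" using dgauge_triangle[of k "w - z'" "z' - x"] 1 by (simp add: gauge_ball_def)
  qed
  then have "emeasure N (gauge_ball z' k 1) \<le> emeasure N (gauge_ball x k 2)"
    using N by (intro emeasure_mono) (auto simp: doubling_measure_def)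
  also have "\<dots> \<le> ennreal c * emeasure N (gauge_ball x k 1)" using N by (simp add: doubling_measure_def)
  finally have "ennreal (c ^ n) * emeasure N (gauge_ball z' k 1) \<le> ennreal (c ^ n) * (ennreal c * emeasure N (gauge_ball x k 1))"
    by (rule mult_left_mono) simp
  with Suc.IH[OF 2] have "emeasure N (gauge_ball z k 1) \<le> ennreal (c ^ n) * (ennreal c * emeasure N (gauge_ball x k 1))"
    by (rule order_trans)
  then show ?case using N by (simp add: doubling_measure_def ennreal_mult mult_ac)
qed

text \<open>Doubling compares a ball with its double, whereas the passage from \<open>B\<^sub>k\<close> to \<open>B\<^sub>k\<^sub>+\<^sub>1\<close> stretches by \<open>A\<close>. By
  compactness \<open>B\<^sub>1\<close> is covered by finitely many translates of \<open>B\<^sub>0\<close>, and applying \<open>A\<^sup>k\<close> gives covers with the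
  same number of balls and the same distances at every level.\<close>
lemma doubling_dilate:
  "\<exists>C\<ge>1. \<forall>N x k n. doubling_measure c N \<longrightarrow>
     emeasure N (gauge_ball x (k + int n) 1) \<le> ennreal (C ^ n) * emeasure N (gauge_ball x k 1)"
proof -
  obtain a b where ab: "a > 0" "b > 0" "\<And>x. a * norm x \<le> norm (P *v x)" "\<And>x. norm (P *v x) \<le> b * norm x"
    using norm_P_bounds by blast
  let ?K = "{w. dgauge 1 w \<le> 1}"
  have "closed ?K" using continuous_dgauge[of UNIV 1 0] by (intro closed_Collect_le) (auto intro!: continuous_intros)
  moreover have "bounded ?K"
  proof -
    obtain L where L: "L \<ge> 1" "\<And>n x. norm (Z (int n) x) \<le> L ^ n * norm x" using Z_growth by blast
    have "norm w \<le> L / a" if "dgauge 1 w \<le> 1" for w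
    proof -
      have "norm w \<le> L * norm (Z (- 1) w)" using L(2)[of 1 "Z (- 1) w"] by simp
      also have "a * norm (Z (- 1) w) \<le> 1" using that ab(3)[of "Z (- 1) w"] by (simp add: dgauge_def)
      then have "L * norm (Z (- 1) w) \<le> L * (1 / a)" using L(1) ab(1) by (intro mult_left_mono) (auto simp: field_simps)
      finally show ?thesis by simp
    qed
    then show ?thesis unfolding bounded_iff by blast
  qed
  ultimately have cK: "compact ?K" by (simp add: compact_eq_bounded_closed)
  have "\<exists>T. finite T \<and> ?K \<subseteq> (\<Union>t\<in>T. gauge_ball t 0 1)"
  proof (rule compactE_image[OF cK, of UNIV "\<lambda>t. gauge_ball t 0 1"])
    show "open (gauge_ball t 0 1)" for t unfolding gauge_ball_def
      by (rule open_Collect_less[OF continuous_dgauge continuous_on_const])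
    have "w \<in> gauge_ball w 0 1" for w by (simp add: gauge_ball_def dgauge_def)
    then show "?K \<subseteq> (\<Union>t\<in>UNIV. gauge_ball t 0 1)" by blast
  qed blast
  then obtain T where T: "finite T" "?K \<subseteq> (\<Union>t\<in>T. gauge_ball t 0 1)" by blast
  have "\<forall>t\<in>T. \<exists>m. dgauge 0 t \<le> real m" using real_arch_simple by blast
  then obtain m where m: "\<And>t. t \<in> T \<Longrightarrow> dgauge 0 t \<le> real (m t)" by metis
  define M where "M = Max (insert 0 (m ` T))"
  have M: "dgauge 0 t \<le> real M" if "t \<in> T" for t
  proof -
    have "m t \<le> M" unfolding M_def using T that by (intro Max_ge) auto
    then show ?thesis using m[OF that] by (meson of_nat_mono order_trans)
  qed
  define C where "C = real (card T) * c ^ M + 1"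
  have one: "emeasure N (gauge_ball x (k + 1) 1) \<le> ennreal C * emeasure N (gauge_ball x k 1)"
    if N: "doubling_measure c N" for N x k
  proof -
    have c: "1 \<le> c" using N by (simp add: doubling_measure_def)
    have [simp]: "sets N = sets lebesgue" using N by (simp add: doubling_measure_def)
    have "gauge_ball x (k + 1) 1 \<subseteq> (\<Union>t\<in>T. gauge_ball (x + Z k t) k 1)"
    proof
      fix z assume "z \<in> gauge_ball x (k + 1) 1"
      then have "dgauge (k + 1) (Z k (Z (- k) (z - x))) \<le> 1" by (simp add: gauge_ball_def)
      then have "Z (- k) (z - x) \<in> ?K" by (simp only: dgauge_shift) simp
      then obtain t where t: "t \<in> T" "dgauge 0 (Z (- k) (z - x) - t) < 1" using T(2) by (auto simp: gauge_ball_def)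
      have "z - (x + Z k t) = Z k (Z (- k) (z - x) - t)"
        by (simp add: matrix_vector_mult_diff_distrib)
      then have "dgauge k (z - (x + Z k t)) = dgauge 0 (Z (- k) (z - x) - t)" using dgauge_shift[of k 0] by simp
      then have "z \<in> gauge_ball (x + Z k t) k 1" using t(2) by (simp only: gauge_ball_def mem_Collect_eq)
      then show "z \<in> (\<Union>t\<in>T. gauge_ball (x + Z k t) k 1)" using t(1) by blast
    qed
    then have "emeasure N (gauge_ball x (k + 1) 1) \<le> emeasure N (\<Union>t\<in>T. gauge_ball (x + Z k t) k 1)"
      by (intro emeasure_mono) (auto intro!: sets.finite_UN T)
    also have "\<dots> \<le> (\<Sum>t\<in>T. emeasure N (gauge_ball (x + Z k t) k 1))"
      by (intro emeasure_subadditive_finite T) auto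
    also have "\<dots> \<le> (\<Sum>t\<in>T. ennreal (c ^ M) * emeasure N (gauge_ball x k 1))"
    proof (intro sum_mono doubling_move[OF N])
      fix t assume "t \<in> T"
      then show "dgauge k (x + Z k t - x) \<le> real M" using dgauge_shift[of k 0 t] M by simp
    qed
    also have "\<dots> = ennreal (real (card T) * c ^ M) * emeasure N (gauge_ball x k 1)"
      using c by (simp add: ennreal_mult mult.assoc ennreal_of_nat_eq_real_of_nat)
    also have "\<dots> \<le> ennreal C * emeasure N (gauge_ball x k 1)"
      by (intro mult_right_mono ennreal_leI) (auto simp: C_def)
    finally show ?thesis .
  qed
  define C' where "C' = max 1 C"
  have "emeasure N (gauge_ball x (k + int n) 1) \<le> ennreal (C' ^ n) * emeasure N (gauge_ball x k 1)"
    if N: "doubling_measure c N" for N x k n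
  proof (induction n)
    case (Suc n)
    have "emeasure N (gauge_ball x (k + int (Suc n)) 1) \<le> ennreal C * emeasure N (gauge_ball x (k + int n) 1)"
      using one[OF N, of x "k + int n"] by (simp add: add_ac)
    also have "\<dots> \<le> ennreal C' * (ennreal (C' ^ n) * emeasure N (gauge_ball x k 1))"
      by (intro mult_mono Suc) (auto simp: C'_def intro: ennreal_leI)
    finally show ?case by (simp add: C'_def ennreal_mult mult.assoc)
  qed simp
  then show ?thesis by (intro exI[of _ C']) (auto simp: C'_def)
qed

lemma dcube_ucube: "dcube A j k = Z (- k) ` ucube j"
  by (simp add: dcube_def ucube_def)

lemma dcube_sets [measurable]: "dcube A j k \<in> sets lebesgue"
  unfolding dcube_ucube ucube_cbox
  by (intro fmeasurableD conjunct1[OF measure_linear_image_finite]) auto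

lemma measure_dcube: "measure lebesgue (dcube A j k) = \<bar>det A\<bar> powr (- real_of_int k)"
proof -
  have "measure lebesgue (dcube A j k) = \<bar>det (mat_zpow A (- k))\<bar> * measure lebesgue (ucube j)"
    unfolding dcube_ucube ucube_cbox
    using measure_linear_image_finite[of "(*v) (mat_zpow A (- k))" "cbox (ivec j) (ivec j + 1)"] by simp
  also have "measure lebesgue (ucube j) = 1" by (simp add: measure_def emeasure_ucube)
  finally show ?thesis
    using det_pos by (simp add: det_mat_zpow[OF invertible_A] power_int_abs powr_real_of_int' flip: of_int_minus)
qed

lemma mem_dcube: "x \<in> dcube A j k \<longleftrightarrow> Z k x \<in> ucube j"
  unfolding dcube_ucube by (auto intro!: image_eqI[of x _ "Z k x"])

lemma ex_dcube: "\<exists>j. x \<in> dcube A j k"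
  using ex_ucube[of "Z k x"] by (simp add: mem_dcube)

text \<open>A fixed small dilated ball fits around the centre of the unit cube; applying \<open>A\<^sup>-\<^sup>l\<close> makes this uniform in
  the level.\<close>
lemma center_gauge_ball_subset_dcube:
  "\<exists>m. \<forall>j l. gauge_ball (Z (- l) (ivec j + (1/2) *\<^sub>R 1)) (- l - int m) 1 \<subseteq> dcube A j l"
proof -
  obtain a b where ab: "a > 0" "b > 0" "\<And>x. a * norm x \<le> norm (P *v x)" "\<And>x. norm (P *v x) \<le> b * norm x"
    using norm_P_bounds by blast
  obtain m where "2 / a < r ^ m" using real_arch_pow[OF r] by blast
  then have m: "1 / (a * r ^ m) \<le> 1/2" using ab(1) r by (simp add: field_simps)
  have "gauge_ball (Z (- l) (ivec j + (1/2) *\<^sub>R 1)) (- l - int m) 1 \<subseteq> dcube A j l" for j l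
  proof
    fix w assume w: "w \<in> gauge_ball (Z (- l) (ivec j + (1/2) *\<^sub>R 1)) (- l - int m) 1"
    let ?v = "Z l w - (ivec j + (1/2) *\<^sub>R 1)"
    have wv: "w - Z (- l) (ivec j + (1/2) *\<^sub>R 1) = Z (- l) ?v" by (simp add: matrix_vector_mult_diff_distrib)
    have "dgauge (- int m) ?v < 1" using w dgauge_shift[of "- l" "- int m" ?v] by (simp add: gauge_ball_def wv)
    moreover have "dgauge 0 ?v \<le> dgauge (- int m) ?v / r ^ m" using dgauge_decay[of "- int m" m ?v] by simp
    moreover have "a * norm ?v \<le> dgauge 0 ?v" by (simp add: dgauge_def ab(3))
    ultimately have "a * norm ?v \<le> 1 / r ^ m" using r by (smt (verit) divide_right_mono zero_less_power)
    then have "norm ?v \<le> 1 / (a * r ^ m)" using ab(1) r by (simp add: field_simps)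
    then have nv: "norm ?v \<le> 1/2" using m by linarith
    have "real_of_int (j $ i) \<le> Z l w $ i \<and> Z l w $ i \<le> real_of_int (j $ i) + 1" for i
    proof -
      have "\<bar>?v $ i\<bar> \<le> 1/2" using component_le_norm_cart[of ?v i] nv by linarith
      then have "\<bar>Z l w $ i - (real_of_int (j $ i) + 1/2)\<bar> \<le> 1/2" by (simp add: ivec_def)
      then show ?thesis unfolding abs_le_iff by linarith
    qed
    then show "w \<in> dcube A j l" by (simp add: mem_dcube ucube_def)
  qed
  then show ?thesis by blast
qed

text \<open>A set is compared with a cube through a ball around the centre of the cube that contains the set.\<close>
lemma doubling_small_cube:
  "\<exists>C\<ge>1. \<exists>m. \<forall>N S j l n. doubling_measure c N \<longrightarrow>
     S \<subseteq> gauge_ball (Z (- l) (ivec j + (1/2) *\<^sub>R 1)) (- l + int n) 1 \<longrightarrow>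
     emeasure N S \<le> ennreal (C ^ (n + m)) * emeasure N (dcube A j l)"
proof -
  obtain m where m: "\<And>j l. gauge_ball (Z (- l) (ivec j + (1/2) *\<^sub>R 1)) (- l - int m) 1 \<subseteq> dcube A j l"
    using center_gauge_ball_subset_dcube by blast
  obtain C where C: "C \<ge> 1" "\<And>N x k n. doubling_measure c N \<Longrightarrow>
     emeasure N (gauge_ball x (k + int n) 1) \<le> ennreal (C ^ n) * emeasure N (gauge_ball x k 1)"
    using doubling_dilate by blast
  have "emeasure N S \<le> ennreal (C ^ (n + m)) * emeasure N (dcube A j l)"
    if N: "doubling_measure c N" and S: "S \<subseteq> gauge_ball (Z (- l) (ivec j + (1/2) *\<^sub>R 1)) (- l + int n) 1" for N S j l n
  proof -
    let ?x = "Z (- l) (ivec j + (1/2) *\<^sub>R 1)"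
    have [simp]: "sets N = sets lebesgue" using N by (simp add: doubling_measure_def)
    have "emeasure N S \<le> emeasure N (gauge_ball ?x (- l + int n) 1)"
      by (intro emeasure_mono S) auto
    also have "\<dots> \<le> ennreal (C ^ (n + m)) * emeasure N (gauge_ball ?x (- l - int m) 1)"
      using C(2)[OF N, of ?x "- l - int m" "n + m"] by simp
    also have "\<dots> \<le> ennreal (C ^ (n + m)) * emeasure N (dcube A j l)"
      by (intro mult_left_mono emeasure_mono m) auto
    finally show ?thesis .
  qed
  then show ?thesis using C(1) by blast
qed

lemma power_r_minimal:
  assumes "0 \<le> R" shows "\<exists>n. R < r ^ n \<and> r ^ n \<le> r * (R + 1)"
proof -
  have ex: "\<exists>n. R < r ^ n" using real_arch_pow[OF r] .
  define n where "n = (LEAST n. R < r ^ n)"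
  have n: "R < r ^ n" unfolding n_def by (rule LeastI_ex[OF ex])
  have "r ^ n \<le> r * (R + 1)"
  proof (cases n)
    case 0
    have "1 * 1 \<le> r * (R + 1)" using r assms by (intro mult_mono) auto
    then show ?thesis using 0 by simp
  next
    case (Suc k)
    then have "r ^ k \<le> R" using not_less_Least[of k "\<lambda>n. R < r ^ n"] by (auto simp: n_def)
    then have "r * r ^ k \<le> r * (R + 1)" using r by (intro mult_left_mono) auto
    then show ?thesis using Suc by simp
  qed
  then show ?thesis using n by blast
qed

text \<open>Dilated balls grow at least geometrically in the level, so the number of levels needed to reach
  another cube is logarithmic in the distance; the constants are therefore polynomial in the distance.\<close>
lemma doubling_cubes:
  "\<exists>K\<ge>0. \<exists>n. \<forall>N i j l. doubling_measure c N \<longrightarrow>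
     emeasure N (dcube A i l) \<le> ennreal (K * (1 + norm (ivec i - ivec j :: real^'d)) ^ n) * emeasure N (dcube A j l)"
  and doubling_unit_cube:
  "\<exists>K\<ge>0. \<exists>L\<ge>1. \<exists>n. \<forall>N j l. doubling_measure c N \<longrightarrow>
     emeasure N (dcube A 0 0) \<le> ennreal (K * L ^ nat \<bar>l\<bar> * (1 + norm (ivec j :: real^'d)) ^ n) * emeasure N (dcube A j l)"
proof -
  obtain a b where ab: "a > 0" "b > 0" "\<And>x. a * norm x \<le> norm (P *v x)" "\<And>x. norm (P *v x) \<le> b * norm x"
    using norm_P_bounds by blast
  obtain C m where C: "C \<ge> 1" and Cm: "\<And>N S j l n. doubling_measure c N \<Longrightarrow>
     S \<subseteq> gauge_ball (Z (- l) (ivec j + (1/2) *\<^sub>R 1)) (- l + int n) 1 \<Longrightarrow>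
     emeasure N S \<le> ennreal (C ^ (n + m)) * emeasure N (dcube A j l)"
    using doubling_small_cube by blast
  \<comment> \<open>Comparing \<open>C\<close> with a power of \<open>r\<close> turns the bound \<open>C\<^sup>n\<close> into a power of \<open>r\<^sup>n\<close>, that is, of the distance.\<close>
  obtain p where p: "C < r ^ p" using real_arch_pow[OF r] by blast
  define D where "D = real CARD('d)"
  define K where "K = C ^ m * (r * (2 * b * D + b + 1)) ^ p"
  have D: "D \<ge> 1" by (simp add: D_def Suc_leI)
  have e: "norm ((1/2) *\<^sub>R 1 :: real^'d) \<le> D"
  proof -
    have "norm ((1/2) *\<^sub>R 1 :: real^'d) = norm (((1/2) *\<^sub>R 1 :: real^'d) - 0)" by simp
    also have "\<dots> \<le> D" unfolding D_def by (rule norm_ucube_diff[of _ 0]) (auto simp: ucube_def)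
    finally show ?thesis .
  qed
  have K: "0 \<le> K" using C ab D r by (simp add: K_def)
  have pow: "C ^ (n + m) \<le> K * (1 + t) ^ p"
    if n: "r ^ n \<le> r * (b * (t + 2 * D) + 1)" and t: "0 \<le> t" for n t
  proof -
    have "C ^ n \<le> (r ^ p) ^ n" using C p by (intro power_mono) auto
    also have "\<dots> = (r ^ n) ^ p" by (simp add: power_mult[symmetric] mult.commute)
    also have "\<dots> \<le> (r * (b * (t + 2 * D) + 1)) ^ p" using n r by (intro power_mono) auto
    also have "\<dots> \<le> ((r * (2 * b * D + b + 1)) * (1 + t)) ^ p"
    proof (intro power_mono)
      have "b * (t + 2 * D) + 1 \<le> (2 * b * D + b + 1) * (1 + t)"
        using t ab(2) D by (simp add: algebra_simps)
      then show "r * (b * (t + 2 * D) + 1) \<le> r * (2 * b * D + b + 1) * (1 + t)"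
        using r by (simp add: mult.assoc)
      show "0 \<le> r * (b * (t + 2 * D) + 1)" using r ab(2) t D by simp
    qed
    finally have "C ^ m * C ^ n \<le> C ^ m * ((r * (2 * b * D + b + 1)) * (1 + t)) ^ p"
      using C by (intro mult_left_mono) auto
    then show ?thesis by (simp add: K_def power_add power_mult_distrib mult_ac)
  qed
  have gb: "dgauge (int n) x < 1" if "b * norm x < r ^ n" for n x
  proof -
    have "dgauge (int n) x \<le> dgauge 0 x / r ^ n" using dgauge_decay[of 0 n x] by simp
    also have "\<dots> \<le> b * norm x / r ^ n" using r ab(4)[of x] by (intro divide_right_mono) (auto simp: dgauge_def)
    also have "\<dots> < 1" using that r by simp
    finally show ?thesis .
  qed
  have "emeasure N (dcube A i l) \<le> ennreal (K * (1 + norm (ivec i - ivec j :: real^'d)) ^ p) * emeasure N (dcube A j l)"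
    if N: "doubling_measure c N" for N i j l
  proof -
    let ?t = "norm (ivec i - ivec j :: real^'d)"
    obtain n where n: "b * (?t + 2 * D) < r ^ n" "r ^ n \<le> r * (b * (?t + 2 * D) + 1)"
      using power_r_minimal[of "b * (?t + 2 * D)"] ab(2) D by auto
    have "dcube A i l \<subseteq> gauge_ball (Z (- l) (ivec j + (1/2) *\<^sub>R 1)) (- l + int n) 1"
    proof
      fix w assume "w \<in> dcube A i l"
      then have w: "Z l w \<in> ucube i" by (simp add: mem_dcube)
      let ?v = "Z l w - (ivec j + (1/2) *\<^sub>R 1)"
      have wv: "w - Z (- l) (ivec j + (1/2) *\<^sub>R 1) = Z (- l) ?v" by (simp add: matrix_vector_mult_diff_distrib)
      have "?v = (Z l w - ivec i) + (ivec i - ivec j) - (1/2) *\<^sub>R 1" by simp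
      then have "norm ?v \<le> norm (Z l w - ivec i) + ?t + norm ((1/2) *\<^sub>R 1 :: real^'d)"
        by (metis (no_types, opaque_lifting) norm_triangle_ineq4 norm_triangle_ineq add_right_mono order_trans)
      also have "\<dots> \<le> D + ?t + D"
        using norm_ucube_diff[OF w ivec_in_ucube] e by (simp add: D_def)
      finally have "b * norm ?v \<le> b * (?t + 2 * D)" using ab(2) by simp
      then have "dgauge (int n) ?v < 1" using n(1) by (intro gb) linarith
      then show "w \<in> gauge_ball (Z (- l) (ivec j + (1/2) *\<^sub>R 1)) (- l + int n) 1"
        using dgauge_shift[of "- l" "int n" ?v] by (simp add: gauge_ball_def wv)
    qed
    from Cm[OF N this] have "emeasure N (dcube A i l) \<le> ennreal (C ^ (n + m)) * emeasure N (dcube A j l)" .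
    also have "\<dots> \<le> ennreal (K * (1 + ?t) ^ p) * emeasure N (dcube A j l)"
      by (intro mult_right_mono ennreal_leI pow n) auto
    finally show ?thesis .
  qed
  then show "\<exists>K\<ge>0. \<exists>n. \<forall>N i j l. doubling_measure c N \<longrightarrow>
     emeasure N (dcube A i l) \<le> ennreal (K * (1 + norm (ivec i - ivec j :: real^'d)) ^ n) * emeasure N (dcube A j l)"
    using K by blast
  have "emeasure N (dcube A 0 0) \<le> ennreal (K * C ^ nat \<bar>l\<bar> * (1 + norm (ivec j :: real^'d)) ^ p) * emeasure N (dcube A j l)"
    if N: "doubling_measure c N" for N j l
  proof -
    let ?t = "norm (ivec j :: real^'d)"
    obtain n where n: "b * (?t + 2 * D) < r ^ n" "r ^ n \<le> r * (b * (?t + 2 * D) + 1)"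
      using power_r_minimal[of "b * (?t + 2 * D)"] ab(2) D by auto
    have "dcube A 0 0 \<subseteq> gauge_ball (Z (- l) (ivec j + (1/2) *\<^sub>R 1)) (- l + int (n + nat \<bar>l\<bar>)) 1"
    proof
      fix w assume "w \<in> dcube A 0 0"
      then have w: "w \<in> ucube 0" by (simp add: mem_dcube)
      let ?y = "ivec j + (1/2) *\<^sub>R 1 :: real^'d" and ?k = "- l + int (n + nat \<bar>l\<bar>)"
      have "dgauge ?k (w - Z (- l) ?y) \<le> dgauge ?k w + dgauge ?k (Z (- l) ?y)"
        using dgauge_triangle[of ?k w "- Z (- l) ?y"] by (simp add: dgauge_minus)
      also have "dgauge ?k (Z (- l) ?y) = dgauge (int (n + nat \<bar>l\<bar>)) ?y" by (rule dgauge_shift)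
      also have "dgauge (int (n + nat \<bar>l\<bar>)) ?y \<le> dgauge (int n) ?y" by (rule dgauge_antimono) simp
      also have "dgauge ?k w \<le> dgauge (int n) w" by (rule dgauge_antimono) simp
      also have "dgauge (int n) w + dgauge (int n) ?y \<le> dgauge 0 w / r ^ n + dgauge 0 ?y / r ^ n"
        using dgauge_decay[of 0 n w] dgauge_decay[of 0 n ?y] by simp
      also have "\<dots> \<le> (b * norm w) / r ^ n + (b * norm ?y) / r ^ n"
        using r ab(4)[of w] ab(4)[of ?y] by (intro add_mono divide_right_mono) (auto simp: dgauge_def)
      also have "\<dots> = b * (norm w + norm ?y) / r ^ n" by (simp add: distrib_left add_divide_distrib)
      also have "\<dots> \<le> b * (?t + 2 * D) / r ^ n"
      proof (intro divide_right_mono mult_left_mono)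
        have "norm w \<le> D" using norm_ucube_diff[OF w ivec_in_ucube] by (simp add: D_def ivec_def zero_vec_def[symmetric])
        then show "norm w + norm ?y \<le> ?t + 2 * D" using norm_triangle_ineq[of "ivec j" "(1/2) *\<^sub>R 1 :: real^'d"] e by linarith
      qed (use ab r in auto)
      also have "\<dots> < 1" using n(1) r by simp
      finally show "w \<in> gauge_ball (Z (- l) ?y) ?k 1" by (simp add: gauge_ball_def)
    qed
    from Cm[OF N this] have "emeasure N (dcube A 0 0) \<le> ennreal (C ^ (n + nat \<bar>l\<bar> + m)) * emeasure N (dcube A j l)" .
    also have "C ^ (n + nat \<bar>l\<bar> + m) = C ^ nat \<bar>l\<bar> * C ^ (n + m)" by (simp add: power_add)
    also have "ennreal (C ^ nat \<bar>l\<bar> * C ^ (n + m)) * emeasure N (dcube A j l)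
       \<le> ennreal (C ^ nat \<bar>l\<bar> * (K * (1 + ?t) ^ p)) * emeasure N (dcube A j l)"
      using C by (intro mult_right_mono ennreal_leI mult_left_mono pow n) auto
    finally show ?thesis by (simp add: mult_ac)
  qed
  then show "\<exists>K\<ge>0. \<exists>L\<ge>1. \<exists>n. \<forall>N j l. doubling_measure c N \<longrightarrow>
     emeasure N (dcube A 0 0) \<le> ennreal (K * L ^ nat \<bar>l\<bar> * (1 + norm (ivec j :: real^'d)) ^ n) * emeasure N (dcube A j l)"
    using K C by blast
qed

end

section \<open>Schwartz functions\<close>

text \<open>The Schwartz functions form the largest set of differentiable, rapidly decreasing functions that is
  closed under partial derivatives.\<close>
lemma schwartz_coinduct:
  assumes "f \<in> X"
    and "\<And>f x. f \<in> X \<Longrightarrow> f differentiable (at x)"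
    and "\<And>f N. f \<in> X \<Longrightarrow> \<exists>c. \<forall>x. (1 + norm x) ^ N * norm (f x) \<le> c"
    and "\<And>f i. f \<in> X \<Longrightarrow> partial_deriv i f \<in> X"
  shows "f \<in> schwartz"
proof -
  have "partial_derivs js f \<in> X" for js
    by (induction js) (use assms(1,4) in auto)
  then show ?thesis using assms(2,3) by (auto simp: schwartz_def)
qed

lemma schwartz_differentiable: "f \<in> schwartz \<Longrightarrow> f differentiable (at x)"
  unfolding schwartz_def by (auto dest: spec[of _ "[]"])

lemma schwartz_decay: "f \<in> schwartz \<Longrightarrow> \<exists>c. \<forall>x. (1 + norm x) ^ N * norm (f x) \<le> c"
  unfolding schwartz_def by (auto dest: spec[of _ "[]"])

lemma schwartz_partial_derivs: "f \<in> schwartz \<Longrightarrow> partial_derivs js f \<in> schwartz"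
  unfolding schwartz_def by (auto simp flip: foldr_append)

lemma schwartz_partial_deriv: "f \<in> schwartz \<Longrightarrow> partial_deriv i f \<in> schwartz"
  using schwartz_partial_derivs[of f "[i]"] by simp

lemma schwartz_continuous: "f \<in> schwartz \<Longrightarrow> continuous_on S f"
  by (meson continuous_at_imp_continuous_on differentiable_imp_continuous_within schwartz_differentiable)

lemma schwartz_borel [measurable_dest]: "f \<in> schwartz \<Longrightarrow> f \<in> borel_measurable borel"
  by (intro borel_measurable_continuous_onI schwartz_continuous)

lemma weighted_norm_add_le:
  fixes z w :: "'a::real_normed_vector" and t :: "'b::real_normed_vector"
  assumes "(1 + norm t) ^ N * norm z \<le> c" "(1 + norm t) ^ N * norm w \<le> d"
  shows "(1 + norm t) ^ N * norm (z + w) \<le> c + d"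
proof -
  have "(1 + norm t) ^ N * norm (z + w) \<le> (1 + norm t) ^ N * (norm z + norm w)"
    by (intro mult_left_mono norm_triangle_ineq) auto
  then show ?thesis using assms by (simp add: distrib_left)
qed

lemma schwartz_add:
  assumes "f \<in> schwartz" "g \<in> schwartz" shows "(\<lambda>x. f x + g x) \<in> schwartz"
proof (rule schwartz_coinduct[where X = "{\<lambda>x. f x + g x |f g. f \<in> schwartz \<and> g \<in> schwartz}"])
  fix h and N :: nat assume "h \<in> {\<lambda>x. f x + g x |f g. f \<in> schwartz \<and> g \<in> schwartz}"
  then obtain f g where h: "h = (\<lambda>x. f x + g x)" "f \<in> schwartz" "g \<in> schwartz" by blast
  obtain c d where "\<And>x. (1 + norm x) ^ N * norm (f x) \<le> c" "\<And>x. (1 + norm x) ^ N * norm (g x) \<le> d"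
    using h schwartz_decay by metis
  then have "(1 + norm x) ^ N * norm (h x) \<le> c + d" for x
    unfolding h(1) by (rule weighted_norm_add_le)
  then show "\<exists>c. \<forall>x. (1 + norm x) ^ N * norm (h x) \<le> c" by blast
next
  fix h i assume "h \<in> {\<lambda>x. f x + g x |f g. f \<in> schwartz \<and> g \<in> schwartz}"
  then obtain f g where h: "h = (\<lambda>x. f x + g x)" "f \<in> schwartz" "g \<in> schwartz" by blast
  have "partial_deriv i h = (\<lambda>x. partial_deriv i f x + partial_deriv i g x)"
  proof
    fix x
    have "(h has_derivative (\<lambda>v. frechet_derivative f (at x) v + frechet_derivative g (at x) v)) (at x)"
      unfolding h(1) using h(2,3)
      by (intro has_derivative_add) (auto simp: schwartz_differentiable simp flip: frechet_derivative_works)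
    then show "partial_deriv i h x = partial_deriv i f x + partial_deriv i g x"
      by (simp add: partial_deriv_def frechet_derivative_at[symmetric])
  qed
  then show "partial_deriv i h \<in> {\<lambda>x. f x + g x |f g. f \<in> schwartz \<and> g \<in> schwartz}"
    using h schwartz_partial_deriv by blast
qed (use assms schwartz_differentiable in \<open>auto intro: differentiable_add\<close>)

lemma schwartz_cmult:
  assumes "f \<in> schwartz" shows "(\<lambda>x. a * f x) \<in> schwartz"
proof (rule schwartz_coinduct[where X = "{\<lambda>x. a * f x |f. f \<in> schwartz}"])
  fix h and N :: nat assume "h \<in> {\<lambda>x. a * f x |f. f \<in> schwartz}"
  then obtain f where h: "h = (\<lambda>x. a * f x)" "f \<in> schwartz" by blast
  obtain c where c: "\<And>x. (1 + norm x) ^ N * norm (f x) \<le> c" using h schwartz_decay by metis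
  have "(1 + norm x) ^ N * norm (h x) \<le> norm a * c" for x
    using mult_left_mono[OF c[of x] norm_ge_zero[of a]] by (simp add: h(1) norm_mult mult_ac)
  then show "\<exists>c. \<forall>x. (1 + norm x) ^ N * norm (h x) \<le> c" by blast
next
  fix h i assume "h \<in> {\<lambda>x. a * f x |f. f \<in> schwartz}"
  then obtain f where h: "h = (\<lambda>x. a * f x)" "f \<in> schwartz" by blast
  have "partial_deriv i h = (\<lambda>x. a * partial_deriv i f x)"
  proof
    fix x
    have "(h has_derivative (\<lambda>v. a * frechet_derivative f (at x) v)) (at x)"
      unfolding h(1) using h(2)
      by (intro has_derivative_mult_right) (auto simp: schwartz_differentiable simp flip: frechet_derivative_works)
    then show "partial_deriv i h x = a * partial_deriv i f x"
      by (simp add: partial_deriv_def frechet_derivative_at[symmetric])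
  qed
  then show "partial_deriv i h \<in> {\<lambda>x. a * f x |f. f \<in> schwartz}"
    using h schwartz_partial_deriv by blast
qed (use assms schwartz_differentiable in \<open>auto intro!: differentiable_mult\<close>)

lemma schwartz_zero: "(\<lambda>x. 0) \<in> schwartz"
proof -
  have pd: "partial_deriv i (\<lambda>x. 0) = (\<lambda>x. 0)" for i :: 'a
    by (simp add: partial_deriv_def fun_eq_iff)
  show ?thesis by (rule schwartz_coinduct[where X = "{\<lambda>x. 0}"]) (auto simp: pd)
qed

lemma frechet_derivative_sum_partials:
  assumes "f differentiable (at x)"
  shows "frechet_derivative f (at x) v = (\<Sum>i\<in>UNIV. complex_of_real (v $ i) * partial_deriv i f x)"
proof -
  let ?D = "frechet_derivative f (at x)"
  have lin: "linear ?D" by (rule linear_frechet_derivative[OF assms])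
  have "?D v = ?D (\<Sum>i\<in>UNIV. v $ i *\<^sub>R axis i 1)"
    by (simp add: basis_expansion[of v, unfolded scalar_mult_eq_scaleR])
  also have "\<dots> = (\<Sum>i\<in>UNIV. v $ i *\<^sub>R ?D (axis i 1))"
    by (simp add: linear_sum[OF lin] linear_scale[OF lin])
  finally show ?thesis by (simp add: partial_deriv_def scaleR_conv_of_real)
qed

lemma one_plus_norm_le_mult: "1 + norm (x + y) \<le> (1 + norm x) * (1 + norm y)"
proof -
  have "(1 + norm x) * (1 + norm y) = 1 + norm x + norm y + norm x * norm y" by (simp add: algebra_simps)
  moreover have "0 \<le> norm x * norm y" by simp
  ultimately show ?thesis using norm_triangle_ineq[of x y] by linarith
qed

text \<open>Composition with an affine map turns one partial derivative into a linear combination of several, so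
  the single compositions are not closed under differentiation; their span is.\<close>
inductive_set affine_span :: "real^'d^'d \<Rightarrow> real^'d \<Rightarrow> (real^'d \<Rightarrow> complex) set"
  for M :: "real^'d^'d" and b :: "real^'d" where
  base: "f \<in> schwartz \<Longrightarrow> (\<lambda>x. c * f (M *v x + b)) \<in> affine_span M b"
| add: "f \<in> affine_span M b \<Longrightarrow> g \<in> affine_span M b \<Longrightarrow> (\<lambda>x. f x + g x) \<in> affine_span M b"

lemma affine_span_sum:
  fixes M :: "real^'d^'d"
  assumes "finite I" "\<And>i. i \<in> I \<Longrightarrow> f i \<in> affine_span M b"
  shows "(\<lambda>x. \<Sum>i\<in>I. f i x) \<in> affine_span M b"
  using assms
proof (induction I rule: finite_induct)
  case empty
  have "(\<lambda>x::real^'d. 0 * (\<lambda>_. 0) (M *v x + b)) \<in> affine_span M b"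
    by (rule affine_span.base[OF schwartz_zero])
  then show ?case by simp
qed (auto intro: affine_span.add)

lemma affine_span_differentiable:
  fixes M :: "real^'d^'d"
  shows "f \<in> affine_span M b \<Longrightarrow> f differentiable (at x)"
proof (induction rule: affine_span.induct)
  case (base f c)
  have "(\<lambda>x. M *v x + b) differentiable (at x)"
    by (rule differentiable_add) (auto intro: linear_imp_differentiable)
  then have "(\<lambda>x. f (M *v x + b)) differentiable (at x)"
    using differentiable_chain_at[of "\<lambda>x. M *v x + b" x f] schwartz_differentiable[OF base]
    by (simp add: o_def)
  then show ?case by (intro differentiable_mult) auto
qed (auto intro: differentiable_add)

text \<open>Rapid decrease survives because the inverse of \<open>M\<close> bounds \<open>\<bar>x\<bar>\<close> in terms of \<open>\<bar>M x + b\<bar>\<close>.\<close>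
lemma schwartz_affine:
  fixes M :: "real^'d^'d"
  assumes f: "f \<in> schwartz" and M: "invertible M"
  shows "(\<lambda>x. f (M *v x + b)) \<in> schwartz"
proof (rule schwartz_coinduct[where X = "affine_span M b"])
  show "(\<lambda>x. f (M *v x + b)) \<in> affine_span M b" using affine_span.base[OF f, of 1 M b] by simp
next
  fix h :: "real^'d \<Rightarrow> complex" and N assume "h \<in> affine_span M b"
  then show "\<exists>c. \<forall>x. (1 + norm x) ^ N * norm (h x) \<le> c"
  proof (induction rule: affine_span.induct)
    case (base f a)
    obtain M' where M': "M' ** M = mat 1" using M by (auto simp: invertible_def)
    obtain K where K: "K > 0" "\<And>x. norm (M' *v x) \<le> K * norm x"
      using linear_bounded_pos[of "(*v) M'"] by (auto simp: mult.commute)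
    obtain c where c: "\<And>x. (1 + norm x) ^ N * norm (f x) \<le> c" using schwartz_decay[OF base] by metis
    have "(1 + norm x) ^ N * norm (a * f (M *v x + b)) \<le> norm a * (((1 + K) * (1 + norm b)) ^ N * c)" for x
    proof -
      let ?y = "M *v x + b"
      have "x = M' *v (?y - b)" by (simp add: matrix_vector_mul_assoc M')
      then have "norm x \<le> K * norm (?y - b)" using K(2)[of "?y - b"] by simp
      then have "1 + norm x \<le> (1 + K) * (1 + norm (?y + (- b)))"
        using K(1) by (simp add: algebra_simps) (use norm_ge_zero[of "M *v x"] in linarith)
      also have "\<dots> \<le> (1 + K) * ((1 + norm ?y) * (1 + norm b))"
        using one_plus_norm_le_mult[of ?y "- b"] K(1) by (intro mult_left_mono) auto
      finally have "(1 + norm x) ^ N \<le> ((1 + K) * ((1 + norm ?y) * (1 + norm b))) ^ N"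
        by (intro power_mono) auto
      then have "(1 + norm x) ^ N * norm (f ?y) \<le> ((1 + K) * ((1 + norm ?y) * (1 + norm b))) ^ N * norm (f ?y)"
        by (rule mult_right_mono) simp
      also have "\<dots> = ((1 + K) * (1 + norm b)) ^ N * ((1 + norm ?y) ^ N * norm (f ?y))"
        by (simp add: power_mult_distrib mult_ac)
      also have "\<dots> \<le> ((1 + K) * (1 + norm b)) ^ N * c"
        using K(1) by (intro mult_left_mono c) auto
      finally have "norm a * ((1 + norm x) ^ N * norm (f ?y)) \<le> norm a * (((1 + K) * (1 + norm b)) ^ N * c)"
        by (rule mult_left_mono) simp
      then show ?thesis by (simp add: norm_mult mult_ac)
    qed
    then show ?case by blast
  next
    case (add f g)
    then obtain c d where "\<And>x. (1 + norm x) ^ N * norm (f x) \<le> c" "\<And>x. (1 + norm x) ^ N * norm (g x) \<le> d"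
      by metis
    then have "(1 + norm x) ^ N * norm (f x + g x) \<le> c + d" for x
      by (rule weighted_norm_add_le)
    then show ?case by blast
  qed
next
  fix h :: "real^'d \<Rightarrow> complex" and i assume "h \<in> affine_span M b"
  then show "partial_deriv i h \<in> affine_span M b"
  proof (induction rule: affine_span.induct)
    case (base f c)
    have "partial_deriv i (\<lambda>x. c * f (M *v x + b))
        = (\<lambda>x. \<Sum>l\<in>UNIV. (c * complex_of_real (M $ l $ i)) * partial_deriv l f (M *v x + b))"
    proof
      fix x
      let ?D = "frechet_derivative f (at (M *v x + b))"
      have diff: "f differentiable (at (M *v x + b))" using base by (rule schwartz_differentiable)
      have "((\<lambda>x. M *v x + b) has_derivative (\<lambda>v. M *v v + 0)) (at x)"
        by (intro has_derivative_add has_derivative_const linear_imp_has_derivative) auto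
      moreover have "(f has_derivative ?D) (at (M *v x + b))" using diff by (simp add: frechet_derivative_works)
      ultimately have "((\<lambda>x. f (M *v x + b)) has_derivative (\<lambda>v. ?D (M *v v + 0))) (at x)"
        using diff_chain_at by (force simp: o_def)
      then have "((\<lambda>x. c * f (M *v x + b)) has_derivative (\<lambda>v. c * ?D (M *v v + 0))) (at x)"
        by (rule has_derivative_mult_right)
      then have "partial_deriv i (\<lambda>x. c * f (M *v x + b)) x = c * ?D (M *v axis i 1)"
        by (simp add: partial_deriv_def frechet_derivative_at[symmetric])
      also have "\<dots> = (\<Sum>l\<in>UNIV. (c * complex_of_real (M $ l $ i)) * partial_deriv l f (M *v x + b))"
        by (simp add: frechet_derivative_sum_partials[OF diff] sum_distrib_left matrix_vector_mul_component
            inner_axis row_def mult_ac)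
      finally show "partial_deriv i (\<lambda>x. c * f (M *v x + b)) x = \<dots>" .
    qed
    also have "\<dots> \<in> affine_span M b"
      by (intro affine_span_sum affine_span.base schwartz_partial_deriv base) auto
    finally show ?case .
  next
    case (add f g)
    have "partial_deriv i (\<lambda>x. f x + g x) = (\<lambda>x. partial_deriv i f x + partial_deriv i g x)"
    proof
      fix x
      have "((\<lambda>x. f x + g x) has_derivative (\<lambda>v. frechet_derivative f (at x) v + frechet_derivative g (at x) v)) (at x)"
        using add by (intro has_derivative_add) (auto simp: affine_span_differentiable simp flip: frechet_derivative_works)
      then show "partial_deriv i (\<lambda>x. f x + g x) x = partial_deriv i f x + partial_deriv i g x"
        by (simp add: partial_deriv_def frechet_derivative_at[symmetric])
    qed
    then show ?case using affine_span.add add by simp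
  qed
qed (rule affine_span_differentiable)

text \<open>Only finitely many coordinate lists enter the supremum that defines the seminorm, so it is finite.\<close>
lemma schwartz_seminorm_bound:
  assumes f: "f \<in> schwartz" and js: "length js \<le> M" and N: "N \<le> M"
  shows "(1 + norm x) ^ N * norm (partial_derivs js f x) \<le> schwartz_seminorm M f"
proof -
  let ?J = "{js::'a list. length js \<le> M}"
  let ?h = "\<lambda>(js, x). (1 + norm x) ^ M * norm (partial_derivs js f x)"
  have fin: "finite ?J" using finite_lists_length_le[of "UNIV::'a set" M] by simp
  have "\<forall>js. \<exists>c. \<forall>x. (1 + norm x) ^ M * norm (partial_derivs js f x) \<le> c"
    using f by (auto simp: schwartz_def)
  then obtain c where c: "\<And>js x. (1 + norm x) ^ M * norm (partial_derivs js f x) \<le> c js" by metis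
  have "bdd_above (?h ` (?J \<times> UNIV))"
  proof (rule bdd_aboveI2, clarsimp)
    fix js :: "'a list" and x assume "length js \<le> M"
    then have "c js \<le> Max (c ` ?J)" using fin by (intro Max_ge) auto
    then show "(1 + norm x) ^ M * norm (partial_derivs js f x) \<le> Max (c ` ?J)"
      using c[of x js] by simp
  qed
  then have "?h (js, x) \<le> schwartz_seminorm M f"
    unfolding schwartz_seminorm_def using js by (intro cSUP_upper) auto
  moreover have "(1 + norm x) ^ N \<le> (1 + norm x) ^ M" by (intro power_increasing N) auto
  then have "(1 + norm x) ^ N * norm (partial_derivs js f x) \<le> ?h (js, x)"
    by (simp add: mult_right_mono)
  ultimately show ?thesis by linarith
qed

lemma schwartz_seminorm_nonneg: "f \<in> schwartz \<Longrightarrow> 0 \<le> schwartz_seminorm M f"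
  using order_trans[OF norm_ge_zero, of "f 0"] schwartz_seminorm_bound[of f "[]" M 0 0] by simp

subsection \<open>Taylor expansion\<close>

text \<open>The sum runs over coordinate lists and not over multi-indices, so each mixed derivative occurs once
  for every ordering. This is the \<open>n\<close>-th derivative of \<open>t \<mapsto> f (u + t h)\<close> at \<open>0\<close>.\<close>
definition taylor_term :: "(real^'d \<Rightarrow> complex) \<Rightarrow> nat \<Rightarrow> real^'d \<Rightarrow> real^'d \<Rightarrow> complex" where
  "taylor_term f n u h =
     (\<Sum>js\<in>{js. length js = n}. complex_of_real (\<Prod>i\<leftarrow>js. h $ i) * partial_derivs js f u)"

definition taylor :: "(real^'d \<Rightarrow> complex) \<Rightarrow> nat \<Rightarrow> real^'d \<Rightarrow> real^'d \<Rightarrow> complex" where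
  "taylor f p u h = (\<Sum>n<p. taylor_term f n u h /\<^sub>R fact n)"

lemma finite_lists_of_length: "finite {js::'d::finite list. length js = n}"
  using finite_lists_length_eq[of "UNIV::'d set" n] by simp

lemma lists_of_Suc_length: "{js::'d::finite list. length js = Suc n}
    = (\<lambda>(i, js). i # js) ` (UNIV \<times> {js. length js = n})"
  by (auto simp: image_iff length_Suc_conv)

lemma taylor_term_deriv:
  assumes f: "f \<in> schwartz"
  shows "((\<lambda>t. taylor_term f n (u + t *\<^sub>R h) h) has_vector_derivative taylor_term f (Suc n) (u + t *\<^sub>R h) h) (at t within S)"
proof -
  have line: "((\<lambda>t. g (u + t *\<^sub>R h)) has_vector_derivative (\<Sum>i\<in>UNIV. complex_of_real (h $ i) * partial_deriv i g (u + t *\<^sub>R h)))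
      (at t within S)" if g: "g \<in> schwartz" for g
  proof -
    let ?D = "frechet_derivative g (at (u + t *\<^sub>R h))"
    have diff: "g differentiable (at (u + t *\<^sub>R h))" using g by (rule schwartz_differentiable)
    have D: "(g has_derivative ?D) (at (u + t *\<^sub>R h))" using diff by (simp add: frechet_derivative_works)
    have "((\<lambda>t. u + t *\<^sub>R h) has_derivative (\<lambda>s. s *\<^sub>R h)) (at t)"
      by (auto intro!: derivative_eq_intros)
    from diff_chain_at[OF this D] have "((\<lambda>t. g (u + t *\<^sub>R h)) has_derivative (\<lambda>s. ?D (s *\<^sub>R h))) (at t)"
      by (simp add: o_def)
    then have "((\<lambda>t. g (u + t *\<^sub>R h)) has_vector_derivative ?D h) (at t)"
      by (simp add: has_vector_derivative_def linear_scale[OF linear_frechet_derivative[OF diff]])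
    then show ?thesis
      by (simp add: frechet_derivative_sum_partials[OF diff] has_vector_derivative_at_within)
  qed
  have "((\<lambda>t. taylor_term f n (u + t *\<^sub>R h) h) has_vector_derivative
     (\<Sum>js\<in>{js. length js = n}. complex_of_real (\<Prod>i\<leftarrow>js. h $ i) *
        (\<Sum>i\<in>UNIV. complex_of_real (h $ i) * partial_deriv i (partial_derivs js f) (u + t *\<^sub>R h)))) (at t within S)"
    unfolding taylor_term_def
    by (intro has_vector_derivative_sum has_vector_derivative_mult_right line schwartz_partial_derivs f)
  also have "(\<Sum>js\<in>{js. length js = n}. complex_of_real (\<Prod>i\<leftarrow>js. h $ i) *
        (\<Sum>i\<in>UNIV. complex_of_real (h $ i) * partial_deriv i (partial_derivs js f) (u + t *\<^sub>R h)))
      = (\<Sum>js\<in>{js. length js = n}. \<Sum>i\<in>UNIV. complex_of_real (\<Prod>l\<leftarrow>i # js. h $ l) * partial_derivs (i # js) f (u + t *\<^sub>R h))"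
    by (simp add: sum_distrib_left mult_ac)
  also have "\<dots> = (\<Sum>i\<in>UNIV. \<Sum>js\<in>{js. length js = n}. complex_of_real (\<Prod>l\<leftarrow>i # js. h $ l) * partial_derivs (i # js) f (u + t *\<^sub>R h))"
    by (rule sum.swap)
  also have "\<dots> = taylor_term f (Suc n) (u + t *\<^sub>R h) h"
    unfolding taylor_term_def lists_of_Suc_length sum.cartesian_product
    by (subst sum.reindex) (auto simp: inj_on_def intro!: sum.cong)
  finally show ?thesis .
qed

text \<open>The one-dimensional Taylor formula on the segment from \<open>u\<close> to \<open>u + h\<close>. The decay in \<open>u\<close> persists along the
  segment at the cost of \<open>(1 + \<bar>h\<bar>)\<^sup>N\<close>.\<close>
lemma taylor_remainder:
  fixes f :: "real^'d \<Rightarrow> complex"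
  assumes f: "f \<in> schwartz" and p: "0 < p" "p \<le> M" "N \<le> M"
  shows "(1 + norm u) ^ N * norm (f (u + h) - taylor f p u h)
    \<le> (real CARD('d) * norm h) ^ p * (1 + norm h) ^ N * schwartz_seminorm M f"
proof -
  let ?S = "schwartz_seminorm M f"
  let ?B = "(real CARD('d) * norm h) ^ p * (1 + norm h) ^ N * ?S / (1 + norm u) ^ N"
  have S: "0 \<le> ?S" using f by (rule schwartz_seminorm_nonneg)
  define Df where "Df n t = taylor_term f n (u + t *\<^sub>R h) h" for n t
  have D0: "Df 0 = (\<lambda>t. f (u + t *\<^sub>R h))" by (simp add: Df_def taylor_term_def fun_eq_iff)
  have DD: "(Df m has_vector_derivative Df (Suc m) t) (at t within {0..1})" for m t
    using taylor_term_deriv[OF f] by (simp add: Df_def[abs_def])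
  have "((\<lambda>x. ((1 - x) ^ (p - 1) / fact (p - 1)) *\<^sub>R Df p x) has_integral
      f (u + 1 *\<^sub>R h) - (\<Sum>i<p. ((1 - 0) ^ i / fact i) *\<^sub>R Df i 0)) {0..1}"
    by (rule Taylor_has_integral[where p = p and Df = Df and f = "\<lambda>t. f (u + t *\<^sub>R h)" and a = 0 and b = 1])
      (use p(1) D0 DD in auto)
  then have int: "((\<lambda>x. ((1 - x) ^ (p - 1) / fact (p - 1)) *\<^sub>R Df p x) has_integral
      f (u + h) - taylor f p u h) (cbox 0 1)"
    by (simp add: taylor_def Df_def divide_inverse)
  have "norm (f (u + h) - taylor f p u h) \<le> ?B * measure lborel (cbox 0 (1::real))"
  proof (rule has_integral_bound[OF _ int])
    show "0 \<le> ?B" using S by simp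
    fix t :: real assume t: "t \<in> cbox 0 1"
    have d: "norm (partial_derivs js f (u + t *\<^sub>R h)) \<le> (1 + norm h) ^ N * ?S / (1 + norm u) ^ N"
      if "length js = p" for js
    proof -
      let ?y = "u + t *\<^sub>R h"
      have th: "norm (t *\<^sub>R h) \<le> norm h" using t by (simp add: mult_left_le_one_le)
      have "1 + norm u = 1 + norm (?y + - (t *\<^sub>R h))" by simp
      also have "\<dots> \<le> (1 + norm ?y) * (1 + norm (t *\<^sub>R h))"
        using one_plus_norm_le_mult[of ?y "- (t *\<^sub>R h)"] by simp
      also have "\<dots> \<le> (1 + norm ?y) * (1 + norm h)" using th by (intro mult_left_mono) auto
      finally have "(1 + norm u) ^ N \<le> ((1 + norm ?y) * (1 + norm h)) ^ N" by (intro power_mono) auto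
      then have "(1 + norm u) ^ N * norm (partial_derivs js f ?y)
          \<le> (1 + norm h) ^ N * ((1 + norm ?y) ^ N * norm (partial_derivs js f ?y))"
        using mult_right_mono[of _ _ "norm (partial_derivs js f ?y)"] by (fastforce simp: power_mult_distrib mult_ac)
      also have "\<dots> \<le> (1 + norm h) ^ N * ?S"
        using that p by (intro mult_left_mono schwartz_seminorm_bound f) auto
      finally show ?thesis by (simp add: pos_le_divide_eq add_pos_nonneg mult.commute)
    qed
    have h: "\<bar>\<Prod>i\<leftarrow>js. h $ i\<bar> \<le> norm h ^ length js" for js
      by (induction js) (auto simp: abs_mult intro!: mult_mono component_le_norm_cart)
    have card: "card {js::'d list. length js = p} = CARD('d) ^ p"
      using card_lists_length_eq[of "UNIV::'d set" p] by simp
    have "norm (Df p t) \<le> (\<Sum>js\<in>{js::'d list. length js = p}. norm h ^ p * ((1 + norm h) ^ N * ?S / (1 + norm u) ^ N))"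
      unfolding Df_def taylor_term_def
    proof (rule sum_norm_le)
      fix js :: "'d list" assume js: "js \<in> {js. length js = p}"
      show "norm (complex_of_real (\<Prod>i\<leftarrow>js. h $ i) * partial_derivs js f (u + t *\<^sub>R h))
          \<le> norm h ^ p * ((1 + norm h) ^ N * ?S / (1 + norm u) ^ N)"
        unfolding norm_mult norm_of_real using js h[of js] by (intro mult_mono d) auto
    qed
    also have "\<dots> = ?B" by (simp add: card power_mult_distrib)
    finally have DB: "norm (Df p t) \<le> ?B" .
    have "(1 - t) ^ (p - 1) / fact (p - 1) \<le> 1 / 1"
      using t by (intro frac_le power_le_one) (auto simp: fact_ge_1)
    then have "norm (((1 - t) ^ (p - 1) / fact (p - 1)) *\<^sub>R Df p t) \<le> 1 * norm (Df p t)"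
      unfolding norm_scaleR using t by (intro mult_right_mono) auto
    then show "norm (((1 - t) ^ (p - 1) / fact (p - 1)) *\<^sub>R Df p t) \<le> ?B" using DB by linarith
  qed
  then show ?thesis by (simp add: pos_le_divide_eq add_pos_nonneg mult.commute)
qed

lemma polynomial_function_taylor:
  fixes f :: "real^'d \<Rightarrow> complex" and l :: "real^'d \<Rightarrow> real^'d"
  assumes "linear l"
  shows "polynomial_function (\<lambda>z. taylor f p u (l z))"
proof -
  have comp: "real_polynomial_function (\<lambda>z. l z $ i)" for i
    using bounded_linear_compose[OF bounded_linear_vec_nth linear_conv_bounded_linear[THEN iffD1, OF assms]]
    by (rule real_polynomial_function.intros(1))
  have pr: "real_polynomial_function (\<lambda>z. \<Prod>i\<leftarrow>js. l z $ i)" for js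
    by (induction js) (auto intro: comp real_polynomial_function.intros)
  have "polynomial_function (\<lambda>z. (\<Prod>i\<leftarrow>js. l z $ i) *\<^sub>R partial_derivs js f u)" for js
    using pr[of js] by (intro polynomial_function_mult) (auto simp flip: real_polynomial_function_eq)
  then show ?thesis unfolding taylor_def taylor_term_def
    by (intro polynomial_function_sum polynomial_function_cmul finite_lists_of_length)
       (auto simp: scaleR_conv_of_real finite_lists_of_length)
qed

section \<open>Vanishing moments\<close>

text \<open>Decay without smoothness: unlike the Schwartz class, this is stable under multiplication by every
  measurable function of polynomial growth.\<close>
definition rapid :: "(real^'d \<Rightarrow> complex) \<Rightarrow> bool" where
  "rapid g \<longleftrightarrow> g \<in> borel_measurable borel \<and> (\<forall>N. \<exists>c. \<forall>x. (1 + norm x) ^ N * norm (g x) \<le> c)"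

lemma rapid_schwartz: "f \<in> schwartz \<Longrightarrow> rapid f"
  by (simp add: rapid_def schwartz_borel schwartz_decay)

lemma rapidD:
  assumes "rapid g" obtains c where "c \<ge> 0" "\<And>x. norm (g x) \<le> c / (1 + norm x) ^ N"
proof -
  obtain c where c: "\<And>x. (1 + norm x) ^ N * norm (g x) \<le> c" using assms by (auto simp: rapid_def)
  have "0 \<le> c" using order_trans[OF _ c[of 0]] by simp
  moreover have "norm (g x) \<le> c / (1 + norm x) ^ N" for x
    using c[of x] by (simp add: pos_le_divide_eq add_pos_nonneg mult.commute)
  ultimately show ?thesis using that by blast
qed

lemma lebesgue_measurable_borel: "g \<in> borel_measurable borel \<Longrightarrow> g \<in> borel_measurable lebesgue"
  by (simp add: measurable_completion)

lemma integrable_rapid: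
  assumes "rapid g" shows "integrable lebesgue g"
proof -
  obtain c where "\<And>x. norm (g x) \<le> c / (1 + norm x) ^ (2 * CARD('a))" using rapidD[OF assms] by metis
  then show ?thesis using assms
    by (intro integrable_decay_bound) (auto simp: rapid_def lebesgue_measurable_borel)
qed

lemma rapid_mult_bound:
  assumes g: "rapid g" and h: "h \<in> borel_measurable borel" and b: "\<And>x. norm (h x) \<le> c * (1 + norm x) ^ n"
  shows "rapid (\<lambda>x. h x * g x)"
  unfolding rapid_def
proof (intro conjI allI)
  show "(\<lambda>x. h x * g x) \<in> borel_measurable borel" using g h by (auto simp: rapid_def)
  fix N
  obtain C where C: "\<And>x. (1 + norm x) ^ (N + n) * norm (g x) \<le> C" using g by (auto simp: rapid_def)
  have c: "0 \<le> c" using order_trans[OF norm_ge_zero b[of 0]] by simp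
  have "(1 + norm x) ^ N * norm (h x * g x) \<le> c * C" for x
  proof -
    have "(1 + norm x) ^ N * norm (h x * g x) \<le> (1 + norm x) ^ N * ((c * (1 + norm x) ^ n) * norm (g x))"
      unfolding norm_mult by (intro mult_left_mono mult_right_mono b) auto
    also have "\<dots> = c * ((1 + norm x) ^ (N + n) * norm (g x))" by (simp add: power_add mult_ac)
    also have "\<dots> \<le> c * C" by (intro mult_left_mono C c)
    finally show ?thesis .
  qed
  then show "\<exists>c. \<forall>x. (1 + norm x) ^ N * norm (h x * g x) \<le> c" by blast
qed

lemma real_polynomial_growth:
  fixes P :: "'a::euclidean_space \<Rightarrow> real"
  assumes "real_polynomial_function P"
  shows "\<exists>c\<ge>0. \<exists>n. \<forall>x. \<bar>P x\<bar> \<le> c * (1 + norm x) ^ n"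
  using assms
proof (induction rule: real_polynomial_function.induct)
  case (linear f)
  obtain K where "K > 0" "\<And>x. norm (f x) \<le> norm x * K" using bounded_linear.pos_bounded[OF linear] by blast
  then have "\<bar>f x\<bar> \<le> K * (1 + norm x) ^ 1" for x by (simp add: algebra_simps order_trans[of "\<bar>f x\<bar>"])
      (smt (verit, best) mult.commute real_norm_def)
  then show ?case using \<open>K > 0\<close> by (meson less_imp_le)
next
  case (const c)
  show ?case by (rule exI[of _ "\<bar>c\<bar>"]) (auto intro!: exI[of _ 0])
next
  case (add f g)
  then obtain c n d m where c: "c \<ge> 0" "\<And>x. \<bar>f x\<bar> \<le> c * (1 + norm x) ^ n"
    and d: "d \<ge> 0" "\<And>x. \<bar>g x\<bar> \<le> d * (1 + norm x) ^ m" by metis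
  have "\<bar>f x + g x\<bar> \<le> (c + d) * (1 + norm x) ^ (n + m)" for x
  proof -
    have "\<bar>f x + g x\<bar> \<le> c * (1 + norm x) ^ n + d * (1 + norm x) ^ m"
      using c(2)[of x] d(2)[of x] by linarith
    also have "\<dots> \<le> c * (1 + norm x) ^ (n + m) + d * (1 + norm x) ^ (n + m)"
      using c d by (intro add_mono mult_left_mono power_increasing) auto
    finally show ?thesis by (simp add: algebra_simps)
  qed
  then show ?case using c d by (meson add_nonneg_nonneg)
next
  case (mult f g)
  then obtain c n d m where c: "c \<ge> 0" "\<And>x. \<bar>f x\<bar> \<le> c * (1 + norm x) ^ n"
    and d: "d \<ge> 0" "\<And>x. \<bar>g x\<bar> \<le> d * (1 + norm x) ^ m" by metis
  have "\<bar>f x * g x\<bar> \<le> (c * d) * (1 + norm x) ^ (n + m)" for x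
    using mult_mono[OF c(2)[of x] d(2)[of x]] c by (simp add: abs_mult power_add mult_ac)
  then show ?case using c d by (meson mult_nonneg_nonneg)
qed

lemma real_polynomial_borel:
  fixes P :: "'a::euclidean_space \<Rightarrow> real"
  assumes "real_polynomial_function P" shows "P \<in> borel_measurable borel"
  using assms by (intro borel_measurable_continuous_onI) (metis continuous_at_imp_continuous_on continuous_real_polymonial_function)

lemma rapid_polynomial_mult:
  assumes g: "rapid g" and P: "real_polynomial_function P"
  shows "rapid (\<lambda>x. complex_of_real (P x) * g x)"
proof -
  obtain c n where "\<And>x. \<bar>P x\<bar> \<le> c * (1 + norm x) ^ n" using real_polynomial_growth[OF P] by blast
  then show ?thesis
    using real_polynomial_borel[OF P] by (intro rapid_mult_bound[OF g, of _ c n]) auto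
qed

text \<open>Multiplication by \<open>x \<bullet> v\<close> corresponds to differentiation of the transform in direction \<open>v\<close>.\<close>
lemma fourier_mult_linear:
  assumes g: "rapid g" and z: "\<And>\<xi>. norm \<xi> < \<delta> \<Longrightarrow> fourier g \<xi> = 0" and \<xi>: "norm \<xi> < \<delta>"
  shows "fourier (\<lambda>x. complex_of_real (x \<bullet> v) * g x) \<xi> = 0"
proof -
  \<comment> \<open>Difference quotients of the transform in direction \<open>v\<close>, taken inside the open set where it vanishes.\<close>
  let ?e = "\<lambda>\<xi> x. exp (- (\<i> * complex_of_real (x \<bullet> \<xi>)))"
  let ?t = "\<lambda>n::nat. 1 / real (Suc n)"
  define s where "s n x = g x * ?e \<xi> x * ((?e (?t n *\<^sub>R v) x - 1) / complex_of_real (?t n))" for n x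
  have gm [measurable]: "g \<in> borel_measurable borel" using g by (simp add: rapid_def)
  have [measurable]: "?e \<xi> \<in> borel_measurable borel" for \<xi>
    by (intro borel_measurable_continuous_onI continuous_intros)
  have rg: "rapid (\<lambda>x. complex_of_real (x \<bullet> v) * g x)"
    by (intro rapid_polynomial_mult[OF g] real_polynomial_function.intros(1) bounded_linear_inner_left)
  have ie: "integrable lebesgue (\<lambda>x. g x * ?e \<xi> x)" for \<xi>
  proof (rule integrable_rapid)
    have "rapid (\<lambda>x. ?e \<xi> x * g x)" by (rule rapid_mult_bound[OF g, of _ 1 0]) (auto)
    then show "rapid (\<lambda>x. g x * ?e \<xi> x)" by (simp add: mult.commute)
  qed
  have expadd: "?e (\<xi> + w) x = ?e \<xi> x * ?e w x" for w x
    by (simp add: inner_add_right algebra_simps exp_add[symmetric] exp_diff)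
  have s_int: "integral\<^sup>L lebesgue (s n) = (fourier g (\<xi> + ?t n *\<^sub>R v) - fourier g \<xi>) / complex_of_real (?t n)" for n
  proof -
    have "s n = (\<lambda>x. (g x * ?e (\<xi> + ?t n *\<^sub>R v) x - g x * ?e \<xi> x) / complex_of_real (?t n))"
      unfolding s_def expadd by (simp add: fun_eq_iff algebra_simps diff_divide_distrib)
    then show ?thesis unfolding fourier_def using ie by simp
  qed
  have "eventually (\<lambda>n. integral\<^sup>L lebesgue (s n) = 0) sequentially"
  proof -
    have "(\<lambda>n. norm (\<xi> + ?t n *\<^sub>R v)) \<longlonglongrightarrow> norm (\<xi> + 0 *\<^sub>R v)"
      by (intro tendsto_intros lim_1_over_n[THEN LIMSEQ_Suc])
    then have "eventually (\<lambda>n. norm (\<xi> + ?t n *\<^sub>R v) < \<delta>) sequentially"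
      using \<xi> by (auto dest: order_tendstoD(2))
    then show ?thesis by eventually_elim (simp add: s_int z \<xi>)
  qed
  then have lim0: "(\<lambda>n. integral\<^sup>L lebesgue (s n)) \<longlonglongrightarrow> 0" by (rule tendsto_eventually)
  have "(\<lambda>n. integral\<^sup>L lebesgue (s n)) \<longlonglongrightarrow> integral\<^sup>L lebesgue (\<lambda>x. g x * ?e \<xi> x * (- (\<i> * complex_of_real (x \<bullet> v))))"
  proof (rule integral_dominated_convergence[where w = "\<lambda>x. norm (complex_of_real (x \<bullet> v) * g x)"])
    show "integrable lebesgue (\<lambda>x. norm (complex_of_real (x \<bullet> v) * g x))"
      by (intro integrable_norm integrable_rapid rg)
    show "AE x in lebesgue. (\<lambda>n. s n x) \<longlonglongrightarrow> g x * ?e \<xi> x * (- (\<i> * complex_of_real (x \<bullet> v)))"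
    proof (intro always_eventually allI)
      fix x
      let ?c = "- (\<i> * complex_of_real (x \<bullet> v))"
      have "((\<lambda>w. exp (?c * w)) has_field_derivative ?c * exp (?c * 0)) (at 0)"
        by (auto intro!: derivative_eq_intros)
      then have "((\<lambda>w. (exp (?c * w) - 1) / w) \<longlongrightarrow> ?c) (at 0)" by (simp add: DERIV_def)
      moreover have "filterlim (\<lambda>n. complex_of_real (?t n)) (at 0) sequentially"
        unfolding filterlim_at
      proof
        show "(\<lambda>n. complex_of_real (?t n)) \<longlonglongrightarrow> 0"
          using tendsto_of_real[OF lim_1_over_n[THEN LIMSEQ_Suc], where 'a = complex] by simp
      qed (auto simp del: of_nat_Suc)
      ultimately have "(\<lambda>n. (exp (?c * complex_of_real (?t n)) - 1) / complex_of_real (?t n)) \<longlonglongrightarrow> ?c"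
        by (rule filterlim_compose)
      moreover have "exp (?c * complex_of_real (?t n)) = ?e (?t n *\<^sub>R v) x" for n
        by (simp add: mult_ac)
      ultimately show "(\<lambda>n. s n x) \<longlonglongrightarrow> g x * ?e \<xi> x * ?c"
        unfolding s_def by (intro tendsto_mult tendsto_const) simp
    qed
    show "AE x in lebesgue. norm (s n x) \<le> norm (complex_of_real (x \<bullet> v) * g x)" for n
    proof (intro always_eventually allI)
      fix x
      have half_abs: "2 * \<bar>- a / 2\<bar> = \<bar>a\<bar>" for a :: real by simp
      have "norm (?e (?t n *\<^sub>R v) x - 1) = norm (exp (\<i> * complex_of_real (- (x \<bullet> (?t n *\<^sub>R v)))) - 1)" by simp
      also have "\<dots> \<le> 2 * \<bar>- (x \<bullet> (?t n *\<^sub>R v)) / 2\<bar>"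
        unfolding dist_exp_i_1 by (intro mult_left_mono abs_sin_x_le_abs_x) auto
      also have "\<dots> = \<bar>?t n * (x \<bullet> v)\<bar>" unfolding half_abs by (simp del: of_nat_Suc)
      also have "\<dots> = ?t n * \<bar>x \<bullet> v\<bar>" by (simp add: abs_mult)
      finally have "norm ((?e (?t n *\<^sub>R v) x - 1) / complex_of_real (?t n)) \<le> \<bar>x \<bullet> v\<bar>"
        unfolding norm_divide norm_of_real by (subst pos_divide_le_eq) (auto simp: mult.commute simp del: of_nat_Suc)
      moreover have "norm (?e \<xi> x) = 1" by simp
      ultimately show "norm (s n x) \<le> norm (complex_of_real (x \<bullet> v) * g x)"
        unfolding s_def norm_mult by (simp add: mult.commute mult_left_mono)
    qed
    show "s n \<in> borel_measurable lebesgue" for n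
      unfolding s_def[abs_def] by (intro lebesgue_measurable_borel) measurable
  qed (use gm in \<open>auto intro!: lebesgue_measurable_borel\<close>)
  then have "integral\<^sup>L lebesgue (\<lambda>x. g x * ?e \<xi> x * (- (\<i> * complex_of_real (x \<bullet> v)))) = 0"
    using lim0 LIMSEQ_unique by blast
  also have "(\<lambda>x. g x * ?e \<xi> x * (- (\<i> * complex_of_real (x \<bullet> v))))
      = (\<lambda>x. (- \<i>) * (complex_of_real (x \<bullet> v) * g x * ?e \<xi> x))" by (simp add: fun_eq_iff mult_ac)
  finally show ?thesis unfolding fourier_def by simp
qed

lemma fourier_mult_polynomial:
  assumes "real_polynomial_function P" and "rapid g" and "\<And>\<xi>. norm \<xi> < \<delta> \<Longrightarrow> fourier g \<xi> = 0" and "norm \<xi> < \<delta>"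
  shows "fourier (\<lambda>x. complex_of_real (P x) * g x) \<xi> = 0"
  using assms
proof (induction arbitrary: g \<xi> rule: real_polynomial_function.induct)
  case (linear f)
  have "f x = x \<bullet> (\<Sum>b\<in>Basis. f b *\<^sub>R b)" for x
  proof -
    have "f x = f (\<Sum>b\<in>Basis. (x \<bullet> b) *\<^sub>R b)" by (simp add: euclidean_representation)
    also have "\<dots> = (\<Sum>b\<in>Basis. (x \<bullet> b) * f b)"
      using linear(1) by (simp add: linear_sum linear_scale bounded_linear.linear)
    finally show ?thesis by (simp add: inner_sum_right mult.commute)
  qed
  then have "fourier (\<lambda>x. complex_of_real (f x) * g x) \<xi>
      = fourier (\<lambda>x. complex_of_real (x \<bullet> (\<Sum>b\<in>Basis. f b *\<^sub>R b)) * g x) \<xi>" by metis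
  then show ?case using fourier_mult_linear[OF linear(2,3,4)] by simp
next
  case (const c)
  then show ?case by (simp add: fourier_def mult.assoc)
next
  case (add f h)
  have rp: "integrable lebesgue (\<lambda>x. complex_of_real (Q x) * g x * exp (- (\<i> * complex_of_real (x \<bullet> \<xi>))))"
    if "real_polynomial_function Q" for Q
  proof (rule integrable_rapid)
    have "rapid (\<lambda>x. exp (- (\<i> * complex_of_real (x \<bullet> \<xi>))) * (complex_of_real (Q x) * g x))"
      by (rule rapid_mult_bound[OF rapid_polynomial_mult[OF add.prems(1) that], of _ 1 0]) auto
    then show "rapid (\<lambda>x. complex_of_real (Q x) * g x * exp (- (\<i> * complex_of_real (x \<bullet> \<xi>))))"
      by (simp add: mult_ac)
  qed
  have "fourier (\<lambda>x. complex_of_real (f x + h x) * g x) \<xi>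
      = fourier (\<lambda>x. complex_of_real (f x) * g x) \<xi> + fourier (\<lambda>x. complex_of_real (h x) * g x) \<xi>"
    unfolding fourier_def using rp[OF add.hyps(1)] rp[OF add.hyps(2)] by (simp add: distrib_right)
  then show ?case using add by simp
next
  case (mult f h)
  have "fourier (\<lambda>x. complex_of_real (f x) * (complex_of_real (h x) * g x)) \<xi> = 0"
    using mult.prems by (intro mult.IH(1) rapid_polynomial_mult mult.hyps mult.IH(2)) auto
  then show ?case by (simp add: mult.assoc)
qed

definition moment_free :: "(real^'d \<Rightarrow> complex) \<Rightarrow> bool" where
  "moment_free g \<longleftrightarrow> rapid g \<and> (\<forall>P. real_polynomial_function P \<longrightarrow> (LINT x|lebesgue. complex_of_real (P x) * g x) = 0)"

text \<open>The transform of \<open>P g\<close> at \<open>0\<close> is the moment of \<open>g\<close> against \<open>P\<close>.\<close>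
lemma moment_free_fourier:
  assumes g: "rapid g" and "0 \<notin> closure {\<xi>. fourier g \<xi> \<noteq> 0}"
  shows "moment_free g"
proof -
  obtain \<delta> where \<delta>: "\<delta> > 0" "\<And>\<xi>. norm \<xi> < \<delta> \<Longrightarrow> fourier g \<xi> = 0"
    using assms(2) by (auto simp: closure_approachable)
  have "fourier (\<lambda>x. complex_of_real (P x) * g x) 0 = 0" if "real_polynomial_function P" for P
    using that g \<delta> by (intro fourier_mult_polynomial) auto
  then show ?thesis using g by (simp add: moment_free_def fourier_def)
qed

lemma polynomial_Re_Im:
  assumes "polynomial_function (P :: 'a::real_normed_vector \<Rightarrow> complex)"
  shows "real_polynomial_function (\<lambda>x. Re (P x))" "real_polynomial_function (\<lambda>x. Im (P x))"
  using assms bounded_linear_Re bounded_linear_Im unfolding polynomial_function_def o_def by blast+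

lemma complex_split: "z * w = complex_of_real (Re z) * w + \<i> * (complex_of_real (Im z) * w)"
  by (metis complex_eq distrib_right mult.assoc)

lemma integrable_polynomial_rapid:
  assumes g: "rapid g" and P: "polynomial_function (P :: real^'d \<Rightarrow> complex)"
  shows "integrable lebesgue (\<lambda>x. P x * g x)"
  unfolding complex_split[of "P _"]
  by (intro Bochner_Integration.integrable_add integrable_mult_right integrable_rapid rapid_polynomial_mult g polynomial_Re_Im[OF P])

lemma moment_free_polynomial:
  assumes g: "moment_free g" and P: "polynomial_function (P :: real^'d \<Rightarrow> complex)"
  shows "(LINT x|lebesgue. P x * g x) = 0"
proof -
  have rg: "rapid g" using g by (simp add: moment_free_def)
  have "(LINT x|lebesgue. P x * g x) = (LINT x|lebesgue. complex_of_real (Re (P x)) * g x)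
     + \<i> * (LINT x|lebesgue. complex_of_real (Im (P x)) * g x)"
    unfolding complex_split[of "P _"]
    using integrable_rapid[OF rapid_polynomial_mult[OF rg polynomial_Re_Im(1)[OF P]]]
      integrable_rapid[OF rapid_polynomial_mult[OF rg polynomial_Re_Im(2)[OF P]]] by simp
  then show ?thesis using g polynomial_Re_Im[OF P] by (simp add: moment_free_def)
qed

lemma moment_free_affine:
  fixes M :: "real^'d^'d"
  assumes g: "moment_free g" and M: "invertible M" and r: "rapid (\<lambda>x. g (M *v x + b))"
  shows "moment_free (\<lambda>x. g (M *v x + b))"
proof -
  have gm: "g \<in> borel_measurable borel" using g by (simp add: moment_free_def rapid_def)
  obtain M' where M': "M' ** M = mat 1" using M by (auto simp: invertible_def)
  have "(LINT x|lebesgue. complex_of_real (P x) * g (M *v x + b)) = 0" if P: "real_polynomial_function P" for P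
  proof -
    have Q: "real_polynomial_function (\<lambda>y. P (M' *v (y - b)))"
    proof -
      have "polynomial_function (\<lambda>y. M' *v (y - b))"
        using polynomial_function_compose[OF polynomial_function_diff[OF polynomial_function_id polynomial_function_const], of _ b]
          polynomial_function_bounded_linear[OF linear_conv_bounded_linear[THEN iffD1, OF matrix_vector_mul_linear], of M']
        by (auto simp: o_def)
      then show ?thesis using real_polynomial_function_compose[OF _ P] by (simp add: o_def)
    qed
    have [measurable]: "(\<lambda>y. P (M' *v (y - b))) \<in> borel_measurable borel" by (rule real_polynomial_borel[OF Q])
    have "(LINT x|lebesgue. complex_of_real (P x) * g (M *v x + b))
        = (LINT x|lebesgue. (\<lambda>y. complex_of_real (P (M' *v (y - b))) * g y) (M *v x + b))"
      by (simp add: matrix_vector_mul_assoc M')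
    also have "\<dots> = (LINT y|lebesgue. complex_of_real (P (M' *v (y - b))) * g y) /\<^sub>R \<bar>det M\<bar>"
      using gm by (intro integral_affine_substitution[OF M]) auto
    also have "\<dots> = 0" using g Q by (simp add: moment_free_def)
    finally show ?thesis .
  qed
  then show ?thesis using r by (simp add: moment_free_def)
qed

text \<open>An estimate of the integrand is enough: a function that is not integrable has integral \<open>0\<close>.\<close>
lemma decay_integral_bound:
  fixes F :: "real^'d \<Rightarrow> complex"
  assumes "\<And>x. norm (F x) \<le> c / (1 + norm x) ^ (2 * CARD('d))"
  shows "norm (integral\<^sup>L lebesgue F) \<le> c * (LINT x::real^'d|lebesgue. 1 / (1 + norm x) ^ (2 * CARD('d)))"
proof (cases "integrable lebesgue F")
  case True
  have "norm (integral\<^sup>L lebesgue F) \<le> (LINT x::real^'d|lebesgue. c * (1 / (1 + norm x) ^ (2 * CARD('d))))"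
    by (rule Bochner_Integration.integral_norm_bound_integral[OF True integrable_mult_right[OF integrable_decay]]) (use assms in auto)
  then show ?thesis using integral_mult_right_zero[of lebesgue c "\<lambda>x::real^'d. 1 / (1 + norm x) ^ (2 * CARD('d))"] by (simp only:)
next
  case False
  have "0 \<le> c" using order_trans[OF norm_ge_zero assms[of 0]] by simp
  then show ?thesis using False by (simp add: not_integrable_integral_eq integral_nonneg_AE)
qed

text \<open>Subtracting from \<open>f\<close> its Taylor polynomial at \<open>u\<close> does not change the integral. The constant depends on
  \<open>f\<close> only through a seminorm, which makes the estimate usable for functionals on the Schwartz space.\<close>
lemma vanishing_moment_bound:
  fixes g :: "real^'d \<Rightarrow> complex"
  assumes g: "moment_free g" and p: "0 < p"
  shows "\<exists>C\<ge>0. \<forall>f M u b. f \<in> schwartz \<longrightarrow> 0 \<le> b \<longrightarrow> b \<le> B \<longrightarrow> (\<forall>z. norm ((M::real^'d^'d) *v z) \<le> b * norm z) \<longrightarrow>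
    (1 + norm u) ^ N * norm (LINT z|lebesgue. f (u + M *v z) * g z) \<le> C * b ^ p * schwartz_seminorm (max p N) f"
proof -
  let ?dd = "2 * CARD('d)"
  have rg: "rapid g" using g by (simp add: moment_free_def)
  obtain c where c: "c \<ge> 0" "\<And>x. norm (g x) \<le> c / (1 + norm x) ^ (p + N + ?dd)" using rapidD[OF rg] by metis
  define I where "I = (LINT x::real^'d|lebesgue. 1 / (1 + norm x) ^ ?dd)"
  have I: "0 \<le> I" by (simp add: I_def integral_nonneg_AE)
  define D where "D = real CARD('d)"
  define C where "C = D ^ p * (1 + B) ^ N * c * I"
  have "(1 + norm u) ^ N * norm (LINT z|lebesgue. f (u + M *v z) * g z) \<le> \<bar>C\<bar> * b ^ p * schwartz_seminorm (max p N) f"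
    if f: "f \<in> schwartz" and b: "0 \<le> b" "b \<le> B" and M: "\<And>z. norm ((M::real^'d^'d) *v z) \<le> b * norm z" for f M u b
  proof -
    let ?S = "schwartz_seminorm (max p N) f"
    have S: "0 \<le> ?S" using f by (rule schwartz_seminorm_nonneg)
    have C: "0 \<le> C" using b c(1) I by (simp add: C_def D_def)
    let ?T = "\<lambda>z. taylor f p u (M *v z)"
    have poly: "polynomial_function ?T" by (rule polynomial_function_taylor[of "(*v) M"]) simp
    obtain c0 where c0: "\<And>x. (1 + norm x) ^ 0 * norm (f x) \<le> c0" using schwartz_decay[OF f] by blast
    have [measurable]: "f \<in> borel_measurable borel" using f by (rule schwartz_borel)
    have "(\<lambda>z. f (u + M *v z)) \<in> borel_measurable borel" by measurable
    then have "rapid (\<lambda>z. f (u + M *v z) * g z)"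
      using c0 by (intro rapid_mult_bound[OF rg, of _ c0 0]) auto
    then have "(LINT z|lebesgue. (f (u + M *v z) - ?T z) * g z) = (LINT z|lebesgue. f (u + M *v z) * g z)"
      using integrable_polynomial_rapid[OF rg poly] moment_free_polynomial[OF g poly]
      by (simp add: left_diff_distrib integrable_rapid)
    moreover have "norm (LINT z|lebesgue. (f (u + M *v z) - ?T z) * g z)
        \<le> (D ^ p * (1 + B) ^ N * c * b ^ p * ?S / (1 + norm u) ^ N) * I"
      unfolding I_def
    proof (rule decay_integral_bound)
      fix z :: "real^'d"
      have "(1 + norm u) ^ N * norm (f (u + M *v z) - ?T z) \<le> (D * norm (M *v z)) ^ p * (1 + norm (M *v z)) ^ N * ?S"
        unfolding D_def by (rule taylor_remainder[OF f p]) auto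
      also have "\<dots> \<le> (D * (b * (1 + norm z))) ^ p * ((1 + B) * (1 + norm z)) ^ N * ?S"
      proof -
        have bz: "b * norm z \<le> B * norm z" using b(2) by (rule mult_right_mono) simp
        have h1: "D * norm (M *v z) \<le> D * (b * (1 + norm z))"
          using M[of z] b(1) by (intro mult_left_mono) (auto simp: D_def algebra_simps)
        have h2: "1 + norm (M *v z) \<le> (1 + B) * (1 + norm z)"
          using M[of z] b bz norm_ge_zero[of z] by (simp add: algebra_simps del: norm_ge_zero)
        show ?thesis
          by (rule mult_right_mono[OF mult_mono[OF power_mono[OF h1] power_mono[OF h2]]]) (use S b in \<open>auto simp: D_def\<close>)
      qed
      also have "\<dots> = (D ^ p * (1 + B) ^ N * b ^ p * ?S) * (1 + norm z) ^ (p + N)"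
        by (simp add: power_mult_distrib power_add mult_ac)
      finally have 1: "norm (f (u + M *v z) - ?T z) \<le> (D ^ p * (1 + B) ^ N * b ^ p * ?S) * (1 + norm z) ^ (p + N) / (1 + norm u) ^ N"
        by (simp add: pos_le_divide_eq add_pos_nonneg mult.commute)
      have "norm ((f (u + M *v z) - ?T z) * g z)
         \<le> ((D ^ p * (1 + B) ^ N * b ^ p * ?S) * (1 + norm z) ^ (p + N) / (1 + norm u) ^ N) * (c / (1 + norm z) ^ (p + N + ?dd))"
        unfolding norm_mult using b S c(1) by (intro mult_mono 1 c(2)) (auto simp: D_def)
      also have "\<dots> = (D ^ p * (1 + B) ^ N * c * b ^ p * ?S / (1 + norm u) ^ N) / (1 + norm z) ^ ?dd"
      proof -
        have "(1 + norm z) ^ (p + N) \<noteq> 0" using norm_ge_zero[of z] by (simp add: add_nonneg_eq_0_iff del: norm_ge_zero)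
        moreover have "X * T / U * (c / (T * R)) = X * c / U / R" if "T \<noteq> 0" for X T U R :: real
          using that by (simp add: field_simps)
        ultimately show ?thesis unfolding power_add[of _ "p + N"] by (simp add: mult_ac)
      qed
      finally show "norm ((f (u + M *v z) - ?T z) * g z) \<le> \<dots>" .
    qed
    ultimately have "norm (LINT z|lebesgue. f (u + M *v z) * g z) \<le> C * b ^ p * ?S / (1 + norm u) ^ N"
      by (simp add: C_def mult_ac)
    then show ?thesis using C by (simp add: pos_le_divide_eq add_pos_nonneg mult.commute)
  qed
  then show ?thesis by (intro exI[of _ "\<bar>C\<bar>"]) auto
qed

section \<open>Tempered distributions modulo polynomials\<close>

lemma regular_dist_tempered:
  fixes g :: "real^'d \<Rightarrow> complex"
  assumes g: "g \<in> borel_measurable borel" "\<And>x. norm (g x) \<le> c * (1 + norm x) ^ n"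
  shows "regular_dist g \<in> tempered"
proof -
  let ?dd = "2 * CARD('d)"
  define I where "I = (LINT x::real^'d|lebesgue. 1 / (1 + norm x) ^ ?dd)"
  have int: "integrable lebesgue (\<lambda>x. g x * f x)" if "f \<in> schwartz" for f
    by (intro integrable_rapid rapid_mult_bound[OF rapid_schwartz[OF that] g])
  have c: "0 \<le> c" using order_trans[OF norm_ge_zero g(2)[of 0]] by simp
  have "norm (regular_dist g f) \<le> (c * I) * schwartz_seminorm (n + ?dd) f" if f: "f \<in> schwartz" for f
  proof -
    let ?S = "schwartz_seminorm (n + ?dd) f"
    have "norm (LINT x|lebesgue. g x * f x) \<le> (c * ?S) * I"
      unfolding I_def
    proof (rule decay_integral_bound)
      fix x :: "real^'d"
      have pos: "(1 + norm x) ^ ?dd > 0" by (simp add: add_pos_nonneg)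
      have "norm (g x * f x) * (1 + norm x) ^ ?dd \<le> (c * (1 + norm x) ^ n) * norm (f x) * (1 + norm x) ^ ?dd"
        unfolding norm_mult by (intro mult_right_mono g(2)) auto
      also have "\<dots> = c * ((1 + norm x) ^ (n + ?dd) * norm (partial_derivs [] f x))" by (simp add: power_add mult_ac)
      also have "\<dots> \<le> c * ?S" by (intro mult_left_mono schwartz_seminorm_bound f c) auto
      finally show "norm (g x * f x) \<le> c * ?S / (1 + norm x) ^ ?dd" using pos by (simp add: pos_le_divide_eq)
    qed
    then show ?thesis using f by (simp add: regular_dist_def mult_ac)
  qed
  then have "\<exists>c N. \<forall>f\<in>schwartz. norm (regular_dist g f) \<le> c * schwartz_seminorm N f" by blast
  then show ?thesis using int
    by (auto simp: tempered_def regular_dist_def schwartz_add schwartz_cmult distrib_left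
        mult.left_commute[of _ "_::complex"])
qed

lemma regular_dist_add_polynomial:
  assumes "polynomial_function P" "polynomial_function Q" "f \<in> schwartz"
  shows "regular_dist (\<lambda>x. P x + Q x) f = regular_dist P f + regular_dist Q (f :: real^'d \<Rightarrow> complex)"
proof -
  have "(LINT x|lebesgue. (P x + Q x) * f x) = (LINT x|lebesgue. P x * f x) + (LINT x|lebesgue. Q x * f x)"
    unfolding distrib_right
    by (intro Bochner_Integration.integral_add integrable_polynomial_rapid rapid_schwartz assms)
  then show ?thesis using assms by (simp add: regular_dist_def)
qed

lemma mod_poly_refl: "u \<in> tempered \<Longrightarrow> (u, u) \<in> mod_poly"
  by (auto simp: mod_poly_def regular_dist_def intro!: exI[of _ "\<lambda>_. 0"])

lemma mod_poly_sym: "(u, v) \<in> mod_poly \<Longrightarrow> (v, u) \<in> mod_poly"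
proof -
  assume "(u, v) \<in> mod_poly"
  then obtain P where P: "u \<in> tempered" "v \<in> tempered" "polynomial_function P"
    "\<And>f. f \<in> schwartz \<Longrightarrow> u f - v f = regular_dist P f" by (auto simp: mod_poly_def)
  have "v f - u f = regular_dist (\<lambda>x. - P x) f" if "f \<in> schwartz" for f
    using P(4)[OF that] that by (simp add: regular_dist_def) (metis minus_diff_eq)
  then show ?thesis using P by (auto simp: mod_poly_def)
qed

lemma mod_poly_trans: "(u, v) \<in> mod_poly \<Longrightarrow> (v, w) \<in> mod_poly \<Longrightarrow> (u, w) \<in> mod_poly"
proof -
  assume "(u, v) \<in> mod_poly" "(v, w) \<in> mod_poly"
  then obtain P Q where P: "u \<in> tempered" "v \<in> tempered" "w \<in> tempered" "polynomial_function P" "polynomial_function Q"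
    "\<And>f. f \<in> schwartz \<Longrightarrow> u f - v f = regular_dist P f" "\<And>f. f \<in> schwartz \<Longrightarrow> v f - w f = regular_dist Q f"
    by (auto simp: mod_poly_def)
  have "u f - w f = regular_dist (\<lambda>x. P x + Q x) f" if "f \<in> schwartz" for f
    using P(6,7)[OF that] regular_dist_add_polynomial[OF P(4,5) that] by (simp add: algebra_simps)
  then show ?thesis using P by (auto simp: mod_poly_def intro!: exI[of _ "\<lambda>x. P x + Q x"])
qed

lemma mod_poly_class_eq: "(u, v) \<in> mod_poly \<Longrightarrow> mod_poly `` {u} = mod_poly `` {v}"
  using mod_poly_sym mod_poly_trans by blast

definition class_eval :: "(real^'d \<Rightarrow> complex) \<Rightarrow> 'd functional set \<Rightarrow> complex" where
  "class_eval h F = (SOME u. u \<in> F) h"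

text \<open>Two representatives differ by a polynomial, which a moment-free function does not see.\<close>
lemma class_eval_class:
  assumes u: "u \<in> tempered" and h: "h \<in> schwartz" "moment_free h"
  shows "class_eval h (mod_poly `` {u}) = u h"
proof -
  have "u \<in> mod_poly `` {u}" using mod_poly_refl[OF u] by simp
  then have "(SOME v. v \<in> mod_poly `` {u}) \<in> mod_poly `` {u}" by (rule someI[of "\<lambda>v. v \<in> mod_poly `` {u}"])
  then obtain P where "polynomial_function P" "u h - (SOME v. v \<in> mod_poly `` {u}) h = regular_dist P h"
    using h by (auto simp: mod_poly_def)
  then show ?thesis using h moment_free_polynomial[of h P]
    by (simp add: class_eval_def regular_dist_def)
qed

lemma continuous_map_class_eval:
  fixes h :: "real^'d \<Rightarrow> complex"
  assumes h: "h \<in> schwartz" "moment_free h"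
  shows "continuous_map tempered_mod_poly_topology euclidean (class_eval h)"
proof (rule continuous_compose_quotient_map[OF quotient_map_mod_poly])
  have "continuous_map tempered_topology euclidean (\<lambda>u. u h)"
    unfolding tempered_topology_def
    by (intro continuous_map_from_subtopology continuous_map_product_projection h)
  then show "continuous_map tempered_topology euclidean (class_eval h \<circ> (\<lambda>u. mod_poly `` {u}))"
    by (rule continuous_map_eq) (simp add: class_eval_class h topspace_tempered_topology)
qed

lemma limitin_class_eval:
  assumes "limitin tempered_mod_poly_topology (\<lambda>J. mod_poly `` {u J}) F net"
    and "\<And>J. u J \<in> tempered" and h: "h \<in> schwartz" "moment_free h"
  shows "((\<lambda>J. u J h) \<longlongrightarrow> class_eval h F) net"
  using continuous_map_limit[OF continuous_map_class_eval[OF h] assms(1)] assms(2)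
  by (simp add: o_def class_eval_class h)

lemma limitin_mod_poly_class:
  assumes u: "u \<in> tempered" and v: "\<And>J. v J \<in> tempered"
    and lim: "\<And>f. f \<in> schwartz \<Longrightarrow> ((\<lambda>J. v J f) \<longlongrightarrow> u f) net"
  shows "limitin tempered_mod_poly_topology (\<lambda>J. mod_poly `` {v J}) (mod_poly `` {u}) net"
proof -
  have "limitin tempered_topology v u net"
    unfolding tempered_topology_def limitin_subtopology limitin_componentwise
    using u v lim by (auto simp: tempered_def PiE_def)
  from continuous_map_limit[OF quotient_imp_continuous_map[OF quotient_map_mod_poly] this]
  show ?thesis by (simp add: o_def)
qed

text \<open>Absolute convergence against a fixed seminorm gives an unconditional sum that is again tempered.\<close>
lemma tempered_of_absolutely_convergent:
  fixes a :: "'i \<Rightarrow> complex" and v :: "'i \<Rightarrow> 'd::finite functional"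
  assumes v: "\<And>i. v i \<in> tempered" and w: "w summable_on UNIV"
    and b: "\<And>i f. f \<in> schwartz \<Longrightarrow> norm (a i * v i f) \<le> w i * schwartz_seminorm M f"
  obtains u where "u \<in> tempered" "\<And>f. f \<in> schwartz \<Longrightarrow> ((\<lambda>i. a i * v i f) has_sum u f) UNIV"
proof -
  define u where "u = (\<lambda>f\<in>schwartz. \<Sum>\<^sub>\<infinity>i. a i * v i f)"
  have abs: "(\<lambda>i. norm (a i * v i f)) summable_on UNIV" if "f \<in> schwartz" for f
  proof (rule Infinite_Sum.abs_summable_on_comparison_test'[where g = "\<lambda>i. w i * schwartz_seminorm M f" and f = "\<lambda>i. a i * v i f"])
    show "(\<lambda>i. w i * schwartz_seminorm M f) summable_on UNIV" by (rule summable_on_cmult_left[OF w])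
  qed (use b that in auto)
  have sm: "(\<lambda>i. a i * v i f) summable_on UNIV" if "f \<in> schwartz" for f
    using abs_summable_summable[OF abs[OF that]] .
  have hs: "((\<lambda>i. a i * v i f) has_sum u f) UNIV" if "f \<in> schwartz" for f
    using sm[OF that] that by (simp add: u_def)
  have "norm (u f) \<le> infsum w UNIV * schwartz_seminorm M f" if "f \<in> schwartz" for f
  proof -
    have "norm (u f) \<le> (\<Sum>\<^sub>\<infinity>i. norm (a i * v i f))"
      unfolding u_def using that abs[OF that] by (simp only: restrict_apply if_True norm_infsum_bound)
    also have "\<dots> \<le> (\<Sum>\<^sub>\<infinity>i. w i * schwartz_seminorm M f)"
      using b that by (intro infsum_mono abs summable_on_cmult_left[OF w]) auto
    also have "\<dots> = infsum w UNIV * schwartz_seminorm M f" by (rule infsum_cmult_left) (simp add: w)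
    finally show ?thesis .
  qed
  moreover have "u (\<lambda>x. f x + g x) = u f + u g" if "f \<in> schwartz" "g \<in> schwartz" for f g
  proof -
    have "(\<lambda>i. a i * v i (\<lambda>x. f x + g x)) = (\<lambda>i. a i * v i f + a i * v i g)"
      using v that by (simp add: tempered_def distrib_left)
    with hs[OF schwartz_add[OF that]]
    have "((\<lambda>i. a i * v i f + a i * v i g) has_sum u (\<lambda>x. f x + g x)) UNIV" by (simp only:)
    from has_sum_unique[OF this has_sum_add[OF hs[OF that(1)] hs[OF that(2)]]] show ?thesis .
  qed
  moreover have "u (\<lambda>x. k * f x) = k * u f" if "f \<in> schwartz" for f k
  proof -
    have "(\<lambda>i. a i * v i (\<lambda>x. k * f x)) = (\<lambda>i. k * (a i * v i f))"
      using v that by (simp add: tempered_def mult_ac)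
    with hs[OF schwartz_cmult[OF that, of k]]
    have "((\<lambda>i. k * (a i * v i f)) has_sum u (\<lambda>x. k * f x)) UNIV" by (simp only:)
    from has_sum_unique[OF this has_sum_cmult_right[OF hs[OF that]]] show ?thesis .
  qed
  ultimately have "u \<in> tempered" unfolding tempered_def by (auto simp: u_def)
  then show ?thesis using that hs by blast
qed

lemma matrix_mul_minus:
  "(- X) ** Y = - (X ** (Y::real^'n^'n))" "X ** (- Y) = - (X ** (Y::real^'n^'n))"
  by (simp_all add: vec_eq_iff matrix_matrix_mult_def sum_negf)

section \<open>Dilated translates of a function with vanishing moments\<close>

context dilation
begin

definition \<delta> :: real where "\<delta> = \<bar>det A\<bar>"

lemma \<delta>_pos: "0 < \<delta>" using det_pos by (simp add: \<delta>_def)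

lemma \<delta>_bound: "\<exists>D\<ge>1. \<forall>t. \<delta> powr t \<le> D powr \<bar>t\<bar>"
proof -
  let ?D = "max \<delta> (1 / \<delta>)"
  have D1: "?D \<ge> 1" using \<delta>_pos by (cases "\<delta> \<ge> 1") (auto simp: le_max_iff_disj)
  have "\<delta> powr t \<le> ?D powr \<bar>t\<bar>" for t
  proof (cases "0 \<le> t")
    case True
    then show ?thesis using \<delta>_pos by (auto intro!: powr_mono2)
  next
    case False
    then have "\<delta> powr t = (1 / \<delta>) powr \<bar>t\<bar>" using \<delta>_pos by (simp add: powr_divide powr_minus_divide)
    then show ?thesis using \<delta>_pos by (auto intro!: powr_mono2)
  qed
  then show ?thesis using D1 by blast
qed

lemma det_zpow: "\<bar>det (mat_zpow A k)\<bar> = \<delta> powr real_of_int k"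
  using \<delta>_pos by (simp add: det_mat_zpow[OF invertible_A] power_int_abs \<delta>_def powr_real_of_int')

lemma det_zpow_neg: "\<bar>det (- mat_zpow A k)\<bar> = \<delta> powr real_of_int k"
proof -
  have "- mat_zpow A k = (- mat 1) ** mat_zpow A k" by (simp add: matrix_mul_minus)
  moreover have "(- mat 1 :: real^'d^'d) ** (- mat 1) = mat 1" by (simp add: matrix_mul_minus)
  then have "det (- mat 1 :: real^'d^'d) * det (- mat 1 :: real^'d^'d) = 1" by (metis det_I det_mul)
  then have "\<bar>det (- mat 1 :: real^'d^'d)\<bar> = 1" by (metis abs_1 abs_minus square_eq_1_iff)
  ultimately show ?thesis by (simp only: det_mul abs_mult det_zpow mult_1)
qed

lemma invertible_zpow: "invertible (mat_zpow A k)" "invertible (- mat_zpow A k)"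
proof -
  show i: "invertible (mat_zpow A k)" by (rule invertible_mat_zpow[OF invertible_A])
  have "\<bar>det (- mat_zpow A k)\<bar> > 0" using \<delta>_pos by (simp add: det_zpow_neg)
  then show "invertible (- mat_zpow A k)" by (simp add: invertible_det_nz)
qed

lemma Z_neg_vec: "(- mat_zpow A k) *v x = - Z k x"
  by (simp add: matrix_vector_mult_def vec_eq_iff sum_negf)

lemma psi_cube_eq: "psi_cube A \<psi> (j, k) x = complex_of_real (\<delta> powr (real_of_int k / 2)) * \<psi> (Z k x - ivec j)"
  by (simp add: psi_cube_def \<delta>_def)

lemma dilate_eq: "dilate A \<phi> k x = complex_of_real (\<delta> powr real_of_int k) * \<phi> (Z k x)"
  using \<delta>_pos by (simp add: dilate_def \<delta>_def powr_real_of_int')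

lemma dilate_reflected:
  assumes \<phi>: "\<phi> \<in> schwartz" "moment_free \<phi>"
  shows "(\<lambda>y. dilate A \<phi> k (x - y)) \<in> schwartz" "moment_free (\<lambda>y. dilate A \<phi> k (x - y))"
proof -
  have eq: "(\<lambda>y. dilate A \<phi> k (x - y))
     = (\<lambda>y. complex_of_real (\<delta> powr real_of_int k) * \<phi> ((- mat_zpow A k) *v y + Z k x))"
    by (simp add: dilate_eq Z_neg_vec matrix_vector_mult_diff_distrib)
  have s: "(\<lambda>y. \<phi> ((- mat_zpow A k) *v y + Z k x)) \<in> schwartz"
    by (rule schwartz_affine[OF \<phi>(1) invertible_zpow(2)])
  then show S: "(\<lambda>y. dilate A \<phi> k (x - y)) \<in> schwartz" unfolding eq by (rule schwartz_cmult)
  have "moment_free (\<lambda>y. \<phi> ((- mat_zpow A k) *v y + Z k x))"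
    by (rule moment_free_affine[OF \<phi>(2) invertible_zpow(2) rapid_schwartz[OF s]])
  then show "moment_free (\<lambda>y. dilate A \<phi> k (x - y))"
    using rapid_schwartz[OF S] unfolding moment_free_def eq
    by (simp add: mult.left_commute[of _ "complex_of_real (\<delta> powr real_of_int k)"])
qed

text \<open>The exponent \<open>p\<close> will be the order of a Taylor expansion: each order gains a factor \<open>1 / r\<close> per level, and
  \<open>D\<close> and \<open>L\<close> are the losses per level.\<close>
lemma contraction_beats_growth:
  assumes "0 \<le> D" "0 \<le> L" "0 < \<theta>"
  shows "\<exists>p>0. \<forall>n. D ^ n * (L ^ n) ^ N * ((1 / r) ^ n) ^ p \<le> \<theta> ^ n"
proof -
  obtain p0 where p0: "D * L ^ N / \<theta> < r ^ p0" using real_arch_pow[OF r] by blast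
  have "r ^ p0 \<le> r ^ Suc p0" using r by (intro power_increasing) auto
  then have "D * L ^ N / \<theta> < r ^ Suc p0" using p0 by linarith
  then have "D * L ^ N < r ^ Suc p0 * \<theta>" using assms(3) by (simp only: pos_divide_less_eq)
  then have pr: "D * L ^ N / r ^ Suc p0 \<le> \<theta>"
    using r by (subst pos_divide_le_eq) (auto simp: mult.commute)
  have "D ^ n * (L ^ n) ^ N * ((1 / r) ^ n) ^ Suc p0 \<le> \<theta> ^ n" for n
  proof -
    have "D ^ n * (L ^ n) ^ N * ((1 / r) ^ n) ^ Suc p0 = D ^ n * (L ^ N) ^ n * ((1 / r) ^ Suc p0) ^ n"
      by (simp only: power_mult[symmetric] mult.commute[of n])
    also have "\<dots> = (D * L ^ N / r ^ Suc p0) ^ n"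
      unfolding power_one_over by (simp only: power_mult_distrib power_divide) simp
    also have "\<dots> \<le> \<theta> ^ n" using assms r by (intro power_mono pr) auto
    finally show ?thesis .
  qed
  then show ?thesis by blast
qed

text \<open>After a change of variables the finer of the two functions is integrated against the coarser one at
  unit scale, and the scale ratio becomes the contraction factor in \<open>vanishing_moment_bound\<close>.\<close>
lemma almost_orthogonality:
  fixes \<phi> \<psi> :: "real^'d \<Rightarrow> complex"
  assumes \<phi>: "\<phi> \<in> schwartz" "moment_free \<phi>" and \<psi>: "\<psi> \<in> schwartz" "moment_free \<psi>" and \<theta>: "0 < \<theta>"
  shows "\<exists>C\<ge>0. \<forall>j l k x. norm (LINT y|lebesgue. psi_cube A \<psi> (j, l) y * dilate A \<phi> k (x - y))
     \<le> C * \<delta> powr (real_of_int l / 2) * \<theta> ^ nat \<bar>k - l\<bar> / (1 + norm (Z l x - ivec j)) ^ N"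
proof -
  obtain c where c: "c > 0" "\<And>n x. norm (Z (- int n) x) \<le> c * (1 / r) ^ n * norm x" using Z_contraction by blast
  obtain L where L: "L \<ge> 1" "\<And>n x. norm (Z (int n) x) \<le> L ^ n * norm x" using Z_growth by blast
  obtain D where D: "D \<ge> 1" "\<And>t. \<delta> powr t \<le> D powr \<bar>t\<bar>" using \<delta>_bound by blast
  obtain p where p: "0 < p" and small: "\<And>n. D ^ n * (L ^ n) ^ N * ((1 / r) ^ n) ^ p \<le> \<theta> ^ n"
    using contraction_beats_growth[of D L \<theta> N] D(1) L(1) \<theta> by auto
  have rn: "c * (1 / r) ^ n \<le> c" for n using c(1) r by (simp add: power_le_one)
  obtain C1 where C1: "C1 \<ge> 0" "\<And>f M u b. \<lbrakk>f \<in> schwartz; 0 \<le> b; b \<le> c; \<And>z. norm ((M::real^'d^'d) *v z) \<le> b * norm z\<rbrakk> \<Longrightarrow>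
    (1 + norm u) ^ N * norm (LINT z|lebesgue. f (u + M *v z) * \<psi> z) \<le> C1 * b ^ p * schwartz_seminorm (max p N) f"
    using vanishing_moment_bound[OF \<psi>(2) p, where B = c and N = N] by blast
  obtain C2 where C2: "C2 \<ge> 0" "\<And>f M u b. \<lbrakk>f \<in> schwartz; 0 \<le> b; b \<le> c; \<And>z. norm ((M::real^'d^'d) *v z) \<le> b * norm z\<rbrakk> \<Longrightarrow>
    (1 + norm u) ^ N * norm (LINT z|lebesgue. f (u + M *v z) * \<phi> z) \<le> C2 * b ^ p * schwartz_seminorm (max p N) f"
    using vanishing_moment_bound[OF \<phi>(2) p, where B = c and N = N] by blast
  define S1 where "S1 = schwartz_seminorm (max p N) \<phi>"
  define S2 where "S2 = schwartz_seminorm (max p N) \<psi>"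
  have S: "0 \<le> S1" "0 \<le> S2" using \<phi> \<psi> by (simp_all add: S1_def S2_def schwartz_seminorm_nonneg)
  define C where "C = C1 * c ^ p * S1 + C2 * c ^ p * S2"
  have C: "0 \<le> C" "C1 * c ^ p * S1 \<le> C" "C2 * c ^ p * S2 \<le> C" using C1(1) C2(1) S c(1) by (simp_all add: C_def)
  have [measurable]: "\<phi> \<in> borel_measurable borel" "\<psi> \<in> borel_measurable borel"
    using \<phi> \<psi> by (auto intro: schwartz_borel)
  have "norm (LINT y|lebesgue. psi_cube A \<psi> (j, l) y * dilate A \<phi> k (x - y))
     \<le> C * \<delta> powr (real_of_int l / 2) * \<theta> ^ nat \<bar>k - l\<bar> / (1 + norm (Z l x - ivec j)) ^ N" for j l k x
  proof -
    let ?v = "Z l x - ivec j" and ?n = "nat \<bar>k - l\<bar>"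
    have "(1 + norm ?v) ^ N * norm (LINT y|lebesgue. psi_cube A \<psi> (j, l) y * dilate A \<phi> k (x - y))
        \<le> C * \<delta> powr (real_of_int l / 2) * \<theta> ^ ?n"
    proof (cases "k \<le> l")
      case True
      then have n: "k - l = - int ?n" by simp
      \<comment> \<open>The cube is finer: expand \<open>\<phi>\<close> around \<open>A\<^sup>k\<^sup>-\<^sup>l v\<close> and integrate against \<open>\<psi>\<close>.\<close>
      let ?u = "Z (k - l) ?v"
      let ?F = "\<lambda>z. \<phi> (?u + (- mat_zpow A (k - l)) *v z) * \<psi> z"
      have F: "?F (Z l y + (- ivec j)) = \<psi> (Z l y - ivec j) * \<phi> (Z k (x - y))" for y
      proof -
        have "?u + (- mat_zpow A (k - l)) *v (Z l y - ivec j) = Z (k - l) (Z l (x - y))"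
          unfolding Z_neg_vec by (simp only: matrix_vector_mult_diff_distrib) simp
        also have "\<dots> = Z k (x - y)" by (simp flip: Z_add)
        finally show ?thesis by simp
      qed
      have "(LINT y|lebesgue. psi_cube A \<psi> (j, l) y * dilate A \<phi> k (x - y))
          = (LINT y|lebesgue. complex_of_real (\<delta> powr (real_of_int l / 2) * \<delta> powr real_of_int k) * ?F (Z l y + (- ivec j)))"
        unfolding F by (simp add: psi_cube_eq dilate_eq mult_ac)
      also have "\<dots> = complex_of_real (\<delta> powr (real_of_int l / 2) * \<delta> powr real_of_int k) * (LINT y|lebesgue. ?F (Z l y + (- ivec j)))"
        by (rule integral_mult_right_zero)
      also have "(LINT y|lebesgue. ?F (Z l y + (- ivec j))) = (LINT z|lebesgue. ?F z) /\<^sub>R \<delta> powr real_of_int l"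
        unfolding det_zpow[symmetric] by (rule integral_affine_substitution[OF invertible_zpow(1)]) measurable
      finally have "norm (LINT y|lebesgue. psi_cube A \<psi> (j, l) y * dilate A \<phi> k (x - y))
          = \<delta> powr (real_of_int l / 2) * (\<delta> powr real_of_int (k - l) * norm (LINT z|lebesgue. ?F z))"
        using \<delta>_pos by (simp add: norm_mult powr_diff field_simps)
      also have "\<dots> \<le> \<delta> powr (real_of_int l / 2) * (D ^ ?n * norm (LINT z|lebesgue. ?F z))"
      proof -
        have "\<delta> powr real_of_int (k - l) \<le> D ^ ?n"
          using D(2)[of "real_of_int (k - l)"] D(1) by (simp add: powr_realpow[symmetric])
        then show ?thesis by (intro mult_left_mono mult_right_mono) auto
      qed
      finally have 1: "norm (LINT y|lebesgue. psi_cube A \<psi> (j, l) y * dilate A \<phi> k (x - y)) \<le> \<dots>" .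
      have "norm ?v \<le> L ^ ?n * norm ?u" using L(2)[of ?n ?u] n by (simp flip: Z_add)
      then have "1 + norm ?v \<le> L ^ ?n * (1 + norm ?u)"
        using one_le_power[OF L(1), of ?n] by (simp only: distrib_left mult_1_right add_mono)
      then have "(1 + norm ?v) ^ N \<le> (L ^ ?n * (1 + norm ?u)) ^ N" by (intro power_mono) auto
      then have "(1 + norm ?v) ^ N * norm (LINT z|lebesgue. ?F z)
          \<le> (L ^ ?n * (1 + norm ?u)) ^ N * norm (LINT z|lebesgue. ?F z)" by (rule mult_right_mono) simp
      also have "\<dots> = (L ^ ?n) ^ N * ((1 + norm ?u) ^ N * norm (LINT z|lebesgue. ?F z))"
        by (simp add: power_mult_distrib)
      also have "\<dots> \<le> (L ^ ?n) ^ N * (C1 * (c * (1 / r) ^ ?n) ^ p * S1)"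
        unfolding S1_def
      proof (intro mult_left_mono C1(2) \<phi>(1) rn)
        show "norm ((- mat_zpow A (k - l)) *v z) \<le> c * (1 / r) ^ ?n * norm z" for z
          unfolding Z_neg_vec norm_minus_cancel using c(2)[of ?n z] by (simp only: n[symmetric])
      qed (use c r L in auto)
      finally have 2: "(1 + norm ?v) ^ N * norm (LINT z|lebesgue. ?F z) \<le> \<dots>" .
      have "(1 + norm ?v) ^ N * norm (LINT y|lebesgue. psi_cube A \<psi> (j, l) y * dilate A \<phi> k (x - y))
          \<le> (1 + norm ?v) ^ N * (\<delta> powr (real_of_int l / 2) * (D ^ ?n * norm (LINT z|lebesgue. ?F z)))"
        by (intro mult_left_mono 1) auto
      also have "\<dots> = \<delta> powr (real_of_int l / 2) * (D ^ ?n * ((1 + norm ?v) ^ N * norm (LINT z|lebesgue. ?F z)))"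
        by (simp add: mult_ac)
      also have "\<dots> \<le> \<delta> powr (real_of_int l / 2) * (D ^ ?n * ((L ^ ?n) ^ N * (C1 * (c * (1 / r) ^ ?n) ^ p * S1)))"
        using D(1) by (intro mult_left_mono 2) auto
      also have "\<dots> = \<delta> powr (real_of_int l / 2) * ((C1 * c ^ p * S1) * (D ^ ?n * (L ^ ?n) ^ N * ((1 / r) ^ ?n) ^ p))"
        by (simp add: power_mult_distrib mult_ac)
      also have "\<dots> \<le> \<delta> powr (real_of_int l / 2) * (C * \<theta> ^ ?n)"
        using C D(1) L(1) r by (intro mult_left_mono mult_mono small) auto
      finally show ?thesis by (simp add: mult_ac)
    next
      case False
      then have n: "l - k = - int ?n" by simp
      \<comment> \<open>The cube is coarser: expand \<open>\<psi>\<close> around \<open>v\<close> and integrate against \<open>\<phi>\<close>.\<close>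
      let ?F = "\<lambda>z. \<psi> (?v + (- mat_zpow A (l - k)) *v z) * \<phi> z"
      have F: "?F ((- mat_zpow A k) *v y + Z k x) = \<psi> (Z l y - ivec j) * \<phi> (Z k (x - y))" for y
      proof -
        have k: "(- mat_zpow A k) *v y + Z k x = Z k (x - y)"
          by (simp add: Z_neg_vec matrix_vector_mult_diff_distrib)
        have e: "?v + (- mat_zpow A (l - k)) *v Z k (x - y) = Z l y - ivec j"
          by (simp add: Z_neg_vec matrix_vector_mult_diff_distrib flip: Z_add)
        show ?thesis unfolding k e ..
      qed
      have "(LINT y|lebesgue. psi_cube A \<psi> (j, l) y * dilate A \<phi> k (x - y))
          = (LINT y|lebesgue. complex_of_real (\<delta> powr (real_of_int l / 2) * \<delta> powr real_of_int k) * ?F ((- mat_zpow A k) *v y + Z k x))"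
        unfolding F by (simp add: psi_cube_eq dilate_eq mult_ac)
      also have "\<dots> = complex_of_real (\<delta> powr (real_of_int l / 2) * \<delta> powr real_of_int k) * (LINT y|lebesgue. ?F ((- mat_zpow A k) *v y + Z k x))"
        by (rule integral_mult_right_zero)
      also have "(LINT y|lebesgue. ?F ((- mat_zpow A k) *v y + Z k x)) = (LINT z|lebesgue. ?F z) /\<^sub>R \<delta> powr real_of_int k"
        unfolding det_zpow_neg[symmetric] by (rule integral_affine_substitution[OF invertible_zpow(2)]) measurable
      finally have 1: "norm (LINT y|lebesgue. psi_cube A \<psi> (j, l) y * dilate A \<phi> k (x - y))
          = \<delta> powr (real_of_int l / 2) * norm (LINT z|lebesgue. ?F z)"
        using \<delta>_pos by (simp add: norm_mult field_simps)
      have 2: "(1 + norm ?v) ^ N * norm (LINT z|lebesgue. ?F z) \<le> C2 * (c * (1 / r) ^ ?n) ^ p * S2"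
        unfolding S2_def
      proof (intro C2(2) \<psi>(1) rn)
        show "norm ((- mat_zpow A (l - k)) *v z) \<le> c * (1 / r) ^ ?n * norm z" for z
          unfolding Z_neg_vec norm_minus_cancel using c(2)[of ?n z] by (simp only: n[symmetric])
      qed (use c r in auto)
      have "(1 + norm ?v) ^ N * norm (LINT y|lebesgue. psi_cube A \<psi> (j, l) y * dilate A \<phi> k (x - y))
          = \<delta> powr (real_of_int l / 2) * ((1 + norm ?v) ^ N * norm (LINT z|lebesgue. ?F z))"
        unfolding 1 by (simp add: mult_ac)
      also have "\<dots> \<le> \<delta> powr (real_of_int l / 2) * (C2 * (c * (1 / r) ^ ?n) ^ p * S2)"
        by (intro mult_left_mono 2) auto
      also have "\<dots> = \<delta> powr (real_of_int l / 2) * ((C2 * c ^ p * S2) * (1 * 1 * ((1 / r) ^ ?n) ^ p))"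
        by (simp add: power_mult_distrib mult_ac)
      also have "\<dots> \<le> \<delta> powr (real_of_int l / 2) * ((C2 * c ^ p * S2) * (D ^ ?n * (L ^ ?n) ^ N * ((1 / r) ^ ?n) ^ p))"
        using C2(1) c(1) S D(1) L(1) r by (intro mult_left_mono mult_right_mono mult_mono one_le_power) auto
      also have "\<dots> \<le> \<delta> powr (real_of_int l / 2) * (C * \<theta> ^ ?n)"
        using C D(1) L(1) r by (intro mult_left_mono mult_mono small) auto
      finally show ?thesis by (simp add: mult_ac)
    qed
    then show ?thesis by (simp add: pos_le_divide_eq add_pos_nonneg mult.commute)
  qed
  then show ?thesis using C(1) by blast
qed

text \<open>On negative levels, \<open>\<psi>\<^sub>Q\<close> minus its Taylor polynomial at the origin. The order \<open>p\<close> is the same for all cubes.\<close>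
definition psi_mod :: "nat \<Rightarrow> (real^'d \<Rightarrow> complex) \<Rightarrow> (int^'d) \<times> int \<Rightarrow> real^'d \<Rightarrow> complex" where
  "psi_mod p \<psi> = (\<lambda>(j, k) x. psi_cube A \<psi> (j, k) x -
     (if 0 \<le> k then 0 else complex_of_real (\<delta> powr (real_of_int k / 2)) * taylor \<psi> p (- ivec j) (Z k x)))"

text \<open>For \<open>k \<ge> 0\<close> the moments of \<open>\<psi>\<close> are used on the expansion of \<open>f\<close>; for \<open>k < 0\<close> the remainder of \<open>\<psi>\<close> is small where
  \<open>f\<close> lives, because \<open>A\<^sup>k\<close> contracts.\<close>
lemma psi_mod_pairing_bound:
  fixes \<psi> :: "real^'d \<Rightarrow> complex"
  assumes \<psi>: "\<psi> \<in> schwartz" "moment_free \<psi>" and \<theta>: "0 < \<theta>"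
  shows "\<exists>C\<ge>0. \<exists>p M. \<forall>f j k. f \<in> schwartz \<longrightarrow>
     norm (LINT y|lebesgue. psi_mod p \<psi> (j, k) y * f y) \<le> C * \<theta> ^ nat \<bar>k\<bar> / (1 + norm (ivec j :: real^'d)) ^ N * schwartz_seminorm M f"
proof -
  let ?dd = "2 * CARD('d)"
  obtain c where c: "c > 0" "\<And>n x. norm (Z (- int n) x) \<le> c * (1 / r) ^ n * norm x" using Z_contraction by blast
  obtain L where L: "L \<ge> 1" "\<And>n x. norm (Z (int n) x) \<le> L ^ n * norm x" using Z_growth by blast
  obtain D where D: "D \<ge> 1" "\<And>t. \<delta> powr t \<le> D powr \<bar>t\<bar>" using \<delta>_bound by blast
  obtain p where p: "0 < p" and small: "\<And>n. D ^ n * (L ^ n) ^ N * ((1 / r) ^ n) ^ p \<le> \<theta> ^ n"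
    using contraction_beats_growth[of D L \<theta> N] D(1) L(1) \<theta> by auto
  have rn: "c * (1 / r) ^ n \<le> c" for n using c(1) r by (simp add: power_le_one)
  obtain C1 where C1: "C1 \<ge> 0" "\<And>f M u b. \<lbrakk>f \<in> schwartz; 0 \<le> b; b \<le> c; \<And>z. norm ((M::real^'d^'d) *v z) \<le> b * norm z\<rbrakk> \<Longrightarrow>
    (1 + norm u) ^ N * norm (LINT z|lebesgue. f (u + M *v z) * \<psi> z) \<le> C1 * b ^ p * schwartz_seminorm (max p N) f"
    using vanishing_moment_bound[OF \<psi>(2) p, where B = c and N = N] by blast
  define M where "M = p + N + ?dd"
  define S where "S = schwartz_seminorm M \<psi>"
  define I where "I = (LINT x::real^'d|lebesgue. 1 / (1 + norm x) ^ ?dd)"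
  define E where "E = real CARD('d)"
  define C2 where "C2 = E ^ p * (1 + c) ^ N * S * I"
  have I: "0 \<le> I" by (simp add: I_def integral_nonneg_AE)
  have S: "0 \<le> S" using \<psi> by (simp add: S_def schwartz_seminorm_nonneg)
  have C2: "0 \<le> C2" using I S c by (simp add: C2_def E_def)
  define C where "C = C1 * c ^ p + C2 * c ^ p"
  have C: "0 \<le> C" "C1 * c ^ p \<le> C" "C2 * c ^ p \<le> C" using C1(1) C2 c(1) by (simp_all add: C_def)
  have [measurable]: "\<psi> \<in> borel_measurable borel" using \<psi> by (auto intro: schwartz_borel)
  have half: "\<delta> powr (real_of_int k / 2) \<le> D ^ nat \<bar>k\<bar>" "\<delta> powr (- (real_of_int k / 2)) \<le> D ^ nat \<bar>k\<bar>" for k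
  proof -
    have "D powr \<bar>real_of_int k / 2\<bar> \<le> D powr \<bar>real_of_int k\<bar>" using D(1) by (intro powr_mono) auto
    also have "\<dots> = D ^ nat \<bar>k\<bar>" using D(1) by (simp add: powr_realpow[symmetric])
    finally show "\<delta> powr (real_of_int k / 2) \<le> D ^ nat \<bar>k\<bar>" "\<delta> powr (- (real_of_int k / 2)) \<le> D ^ nat \<bar>k\<bar>"
      using D(2)[of "real_of_int k / 2"] D(2)[of "- (real_of_int k / 2)"] by auto
  qed
  have Smono: "schwartz_seminorm (max p N) f \<le> schwartz_seminorm M f" if "f \<in> schwartz" for f :: "real^'d \<Rightarrow> complex"
    unfolding schwartz_seminorm_def[of "max p N"]
  proof (rule cSUP_least)
    show "{js::'d list. length js \<le> max p N} \<times> (UNIV :: (real^'d) set) \<noteq> {}" by (auto intro: exI[of _ "[]"])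
  qed (use that in \<open>auto intro!: schwartz_seminorm_bound simp: M_def\<close>)
  have "norm (LINT y|lebesgue. psi_mod p \<psi> (j, k) y * f y) \<le> C * \<theta> ^ nat \<bar>k\<bar> / (1 + norm (ivec j :: real^'d)) ^ N * schwartz_seminorm M f"
    if f: "f \<in> schwartz" for f j k
  proof -
    let ?J = "ivec j :: real^'d" and ?n = "nat \<bar>k\<bar>" and ?Sf = "schwartz_seminorm M f"
    have Sf: "0 \<le> ?Sf" using f by (rule schwartz_seminorm_nonneg)
    have [measurable]: "f \<in> borel_measurable borel" using f by (rule schwartz_borel)
    have "(1 + norm ?J) ^ N * norm (LINT y|lebesgue. psi_mod p \<psi> (j, k) y * f y) \<le> C * \<theta> ^ ?n * ?Sf"
    proof (cases "0 \<le> k")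
      case True
      then have n: "k = int ?n" by simp
      let ?u = "Z (- k) ?J"
      let ?F = "\<lambda>z. f (?u + mat_zpow A (- k) *v z) * \<psi> z"
      have F: "?F (Z k y + (- ?J)) = \<psi> (Z k y - ?J) * f y" for y
        by (simp add: matrix_vector_mult_diff_distrib)
      have "(LINT y|lebesgue. psi_mod p \<psi> (j, k) y * f y)
          = (LINT y|lebesgue. complex_of_real (\<delta> powr (real_of_int k / 2)) * ?F (Z k y + (- ?J)))"
        unfolding F using True by (simp add: psi_mod_def psi_cube_eq mult_ac)
      also have "\<dots> = complex_of_real (\<delta> powr (real_of_int k / 2)) * (LINT y|lebesgue. ?F (Z k y + (- ?J)))"
        by (rule integral_mult_right_zero)
      also have "(LINT y|lebesgue. ?F (Z k y + (- ?J))) = (LINT z|lebesgue. ?F z) /\<^sub>R \<delta> powr real_of_int k"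
        unfolding det_zpow[symmetric] by (rule integral_affine_substitution[OF invertible_zpow(1)]) measurable
      finally have "norm (LINT y|lebesgue. psi_mod p \<psi> (j, k) y * f y)
          = (\<delta> powr (real_of_int k / 2) / \<delta> powr (real_of_int k)) * norm (LINT z|lebesgue. ?F z)"
        using \<delta>_pos by (simp add: norm_mult field_simps)
      also have "\<delta> powr (real_of_int k / 2) / \<delta> powr (real_of_int k) = \<delta> powr (- (real_of_int k / 2))"
        by (simp flip: powr_diff)
      also have "\<delta> powr (- (real_of_int k / 2)) * norm (LINT z|lebesgue. ?F z) \<le> D ^ ?n * norm (LINT z|lebesgue. ?F z)"
        by (intro mult_right_mono half) auto
      finally have 1: "norm (LINT y|lebesgue. psi_mod p \<psi> (j, k) y * f y) \<le> \<dots>" .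
      have "norm ?J \<le> L ^ ?n * norm ?u" using L(2)[of ?n ?u] n by simp
      then have "1 + norm ?J \<le> L ^ ?n * (1 + norm ?u)"
        using one_le_power[OF L(1), of ?n] by (simp only: distrib_left mult_1_right add_mono)
      then have "(1 + norm ?J) ^ N \<le> (L ^ ?n * (1 + norm ?u)) ^ N" by (intro power_mono) auto
      then have "(1 + norm ?J) ^ N * norm (LINT z|lebesgue. ?F z)
          \<le> (L ^ ?n * (1 + norm ?u)) ^ N * norm (LINT z|lebesgue. ?F z)" by (rule mult_right_mono) simp
      also have "\<dots> = (L ^ ?n) ^ N * ((1 + norm ?u) ^ N * norm (LINT z|lebesgue. ?F z))"
        by (simp add: power_mult_distrib)
      also have "\<dots> \<le> (L ^ ?n) ^ N * (C1 * (c * (1 / r) ^ ?n) ^ p * schwartz_seminorm (max p N) f)"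
      proof (intro mult_left_mono C1(2) f rn)
        show "norm (mat_zpow A (- k) *v z) \<le> c * (1 / r) ^ ?n * norm z" for z
          using c(2)[of ?n z] n by simp
      qed (use c r L in auto)
      also have "\<dots> \<le> (L ^ ?n) ^ N * (C1 * (c * (1 / r) ^ ?n) ^ p * ?Sf)"
        using L(1) C1(1) c(1) r f by (intro mult_left_mono Smono) auto
      finally have 2: "(1 + norm ?J) ^ N * norm (LINT z|lebesgue. ?F z) \<le> \<dots>" .
      have "(1 + norm ?J) ^ N * norm (LINT y|lebesgue. psi_mod p \<psi> (j, k) y * f y)
          \<le> (1 + norm ?J) ^ N * (D ^ ?n * norm (LINT z|lebesgue. ?F z))"
        by (intro mult_left_mono 1) auto
      also have "\<dots> = D ^ ?n * ((1 + norm ?J) ^ N * norm (LINT z|lebesgue. ?F z))"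
        by (simp add: mult_ac)
      also have "\<dots> \<le> D ^ ?n * ((L ^ ?n) ^ N * (C1 * (c * (1 / r) ^ ?n) ^ p * ?Sf))"
        using D(1) by (intro mult_left_mono 2) auto
      also have "\<dots> = ((C1 * c ^ p) * (D ^ ?n * (L ^ ?n) ^ N * ((1 / r) ^ ?n) ^ p)) * ?Sf"
        by (simp add: power_mult_distrib mult_ac)
      also have "\<dots> \<le> (C * \<theta> ^ ?n) * ?Sf"
        using C D(1) L(1) r Sf by (intro mult_right_mono mult_mono small) auto
      finally show ?thesis .
    next
      case False
      then have n: "k = - int ?n" by simp
      let ?R = "\<lambda>y. \<psi> (- ?J + Z k y) - taylor \<psi> p (- ?J) (Z k y)"
      have eq: "psi_mod p \<psi> (j, k) y = complex_of_real (\<delta> powr (real_of_int k / 2)) * ?R y" for y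
        using False by (simp add: psi_mod_def psi_cube_eq right_diff_distrib)
      have "norm (LINT y|lebesgue. psi_mod p \<psi> (j, k) y * f y)
          \<le> (D ^ ?n * (E ^ p * (c * (1 / r) ^ ?n) ^ p * (1 + c) ^ N * S * ?Sf / (1 + norm ?J) ^ N)) * I"
        unfolding I_def
      proof (rule decay_integral_bound)
        fix y :: "real^'d"
        let ?t = "1 + norm y"
        have t: "?t > 0" by (simp add: add_pos_nonneg)
        have zk: "norm (Z k y) \<le> c * (1 / r) ^ ?n * norm y" using c(2)[of ?n y] n by simp
        also have "\<dots> \<le> c * norm y" by (intro mult_right_mono rn) auto
        finally have zc: "norm (Z k y) \<le> c * norm y" .
        have h1: "E * norm (Z k y) \<le> E * ((c * (1 / r) ^ ?n) * ?t)"
          using zk c(1) r by (intro mult_left_mono) (auto simp: E_def algebra_simps intro: add_increasing)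
        have h2: "1 + norm (Z k y) \<le> (1 + c) * ?t" using zc c(1) norm_ge_zero[of y] by (simp add: algebra_simps del: norm_ge_zero)
        have "(1 + norm (- ?J)) ^ N * norm (?R y) \<le> (E * norm (Z k y)) ^ p * (1 + norm (Z k y)) ^ N * S"
          unfolding E_def S_def by (rule taylor_remainder[OF \<psi>(1) p]) (auto simp: M_def)
        also have "\<dots> \<le> (E * ((c * (1 / r) ^ ?n) * ?t)) ^ p * ((1 + c) * ?t) ^ N * S"
          by (rule mult_right_mono[OF mult_mono[OF power_mono[OF h1] power_mono[OF h2]]])
             (use S c r in \<open>auto simp: E_def\<close>)
        also have "\<dots> = (E ^ p * (c * (1 / r) ^ ?n) ^ p * (1 + c) ^ N * S) * ?t ^ (p + N)"
          by (simp add: power_mult_distrib power_add mult_ac)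
        finally have "norm (?R y) \<le> (E ^ p * (c * (1 / r) ^ ?n) ^ p * (1 + c) ^ N * S) * ?t ^ (p + N) / (1 + norm ?J) ^ N"
          by (simp add: pos_le_divide_eq add_pos_nonneg mult.commute)
        moreover have "norm (f y) \<le> ?Sf / ?t ^ (p + N + ?dd)"
          using schwartz_seminorm_bound[OF f, of "[]" M M y] t
          by (simp add: pos_le_divide_eq mult.commute M_def)
        ultimately have "norm (psi_mod p \<psi> (j, k) y * f y)
            \<le> (D ^ ?n * ((E ^ p * (c * (1 / r) ^ ?n) ^ p * (1 + c) ^ N * S) * ?t ^ (p + N) / (1 + norm ?J) ^ N)) * (?Sf / ?t ^ (p + N + ?dd))"
          unfolding eq norm_mult norm_of_real
          using half(1)[of k] S c r D(1) by (intro mult_mono) (auto simp: E_def)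
        also have "\<dots> = (D ^ ?n * (E ^ p * (c * (1 / r) ^ ?n) ^ p * (1 + c) ^ N * S * ?Sf / (1 + norm ?J) ^ N)) / ?t ^ ?dd"
        proof -
          have "?t ^ (p + N) \<noteq> 0" using t by simp
          moreover have "Y * (X * T / U) * (w / (T * R)) = Y * (X * w / U) / R" if "T \<noteq> 0" for X Y w T U R :: real
            using that by (simp add: field_simps)
          ultimately show ?thesis unfolding power_add[of _ "p + N"] by (simp add: mult_ac)
        qed
        finally show "norm (psi_mod p \<psi> (j, k) y * f y) \<le> \<dots>" .
      qed
      then have "norm (LINT y|lebesgue. psi_mod p \<psi> (j, k) y * f y)
        \<le> ((C2 * c ^ p) * (D ^ ?n * ((1 / r) ^ ?n) ^ p) * ?Sf) / (1 + norm ?J) ^ N"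
        by (simp add: C2_def power_mult_distrib mult_ac)
      then have "(1 + norm ?J) ^ N * norm (LINT y|lebesgue. psi_mod p \<psi> (j, k) y * f y)
        \<le> (C2 * c ^ p) * (D ^ ?n * 1 * ((1 / r) ^ ?n) ^ p) * ?Sf"
        by (simp add: pos_le_divide_eq add_pos_nonneg mult.commute)
      also have "\<dots> \<le> (C2 * c ^ p) * (D ^ ?n * (L ^ ?n) ^ N * ((1 / r) ^ ?n) ^ p) * ?Sf"
        using C2 c(1) Sf D(1) L(1) r by (intro mult_left_mono mult_right_mono one_le_power) auto
      also have "\<dots> \<le> (C * \<theta> ^ ?n) * ?Sf"
        using C D(1) L(1) r Sf by (intro mult_right_mono mult_mono small) auto
      finally show ?thesis .
    qed
    then have "norm (LINT y|lebesgue. psi_mod p \<psi> (j, k) y * f y) \<le> (C * \<theta> ^ ?n * ?Sf) / (1 + norm ?J) ^ N"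
      by (simp add: pos_le_divide_eq add_pos_nonneg mult.commute)
    then show ?thesis by simp
  qed
  then show ?thesis using C(1) by blast
qed

end

section \<open>Weights\<close>

definition weight_measure :: "real \<Rightarrow> (real^'d \<Rightarrow> complex^'m^'m) \<Rightarrow> complex^'m \<Rightarrow> (real^'d) measure" where
  "weight_measure p W y = density lebesgue (\<lambda>z. ennreal (wnorm p W z y powr p))"

lemma borel_measurable_wnorm_powr [measurable]:
  assumes "matrix_weight W" "1 \<le> p"
  shows "(\<lambda>z. ennreal (wnorm p W z y powr p)) \<in> borel_measurable lebesgue"
  using borel_measurable_wnorm[OF assms] by measurable

lemma emeasure_weight_measure:
  assumes "matrix_weight W" "1 \<le> p" "S \<in> sets lebesgue"
  shows "emeasure (weight_measure p W y) S = (\<integral>\<^sup>+z. ennreal (wnorm p W z y powr p) * indicator S z \<partial>lebesgue)"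
  unfolding weight_measure_def using assms by (intro emeasure_density borel_measurable_wnorm_powr)

text \<open>By compactness it is enough that the weight of no unit vector can be arbitrarily small: a limit of unit
  vectors with vanishing weight would, by Fatou's lemma, be a unit vector in the kernel of \<open>W\<close> almost
  everywhere on the cube, where \<open>W\<close> is invertible. The weight of some vectors may be
  infinite, so only a lower bound is possible.\<close>
lemma weight_lower_bound:
  fixes W :: "real^'d \<Rightarrow> complex^'m^'m"
  assumes W: "matrix_weight W" and p: "1 \<le> p"
  shows "\<exists>c>0. \<forall>y. ennreal (c * norm y powr p) \<le> emeasure (weight_measure p W y) (ucube 0)"
proof -
  let ?U = "ucube 0 :: (real^'d) set"
  have [measurable]: "?U \<in> sets lebesgue" by (simp add: ucube_cbox)
  note [measurable] = borel_measurable_wnorm_powr[OF W p]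
  define G where "G y = emeasure (weight_measure p W y) ?U" for y
  have G: "G y = (\<integral>\<^sup>+z. ennreal (wnorm p W z y powr p) * indicator ?U z \<partial>lebesgue)" for y
    unfolding G_def by (rule emeasure_weight_measure[OF W p]) measurable
  have "\<exists>n::nat. \<forall>y. norm y = 1 \<longrightarrow> ennreal (1 / Suc n) \<le> G y"
  proof (rule ccontr)
    assume "\<not> ?thesis"
    then have "\<forall>n::nat. \<exists>y. norm y = 1 \<and> G y < ennreal (1 / Suc n)" by (auto simp: not_le)
    then obtain y where y: "\<And>n. norm (y n) = 1" "\<And>n. G (y n) < ennreal (1 / Suc n)" by metis
    have "compact (sphere (0 :: complex^'m) 1)" by simp
    moreover have "\<forall>n. y n \<in> sphere 0 1" using y(1) by simp
    ultimately obtain l s where l: "l \<in> sphere 0 1" "strict_mono (s :: nat \<Rightarrow> nat)" "(y \<circ> s) \<longlonglongrightarrow> l"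
      unfolding compact_def by blast
    have cont: "(\<lambda>n. wnorm p W z (y (s n)) powr p) \<longlonglongrightarrow> wnorm p W z l powr p" for z
    proof -
      have "continuous_on UNIV (\<lambda>v. norm (psd_powr (W z) (1 / p) *v v))"
        by (simp add: matrix_vector_mult_def) (intro continuous_intros)
      then have "(\<lambda>n. wnorm p W z ((y \<circ> s) n)) \<longlonglongrightarrow> wnorm p W z l"
        unfolding wnorm_def using l(3) by (rule continuous_on_tendsto_compose) auto
      then show ?thesis using p by (intro tendsto_powr') (auto simp: wnorm_nonneg)
    qed
    have "G l = (\<integral>\<^sup>+z. liminf (\<lambda>n. ennreal (wnorm p W z (y (s n)) powr p) * indicator ?U z) \<partial>lebesgue)"
      unfolding G
    proof (intro nn_integral_cong)
      fix z
      have "(\<lambda>n. ennreal (wnorm p W z (y (s n)) powr p) * indicator ?U z)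
          \<longlonglongrightarrow> ennreal (wnorm p W z l powr p) * indicator ?U z"
        using cont[of z] by (auto simp: indicator_def intro!: tendsto_ennrealI)
      then show "ennreal (wnorm p W z l powr p) * indicator ?U z
          = liminf (\<lambda>n. ennreal (wnorm p W z (y (s n)) powr p) * indicator ?U z)"
        by (rule lim_imp_Liminf[OF sequentially_bot, symmetric])
    qed
    also have "\<dots> \<le> liminf (\<lambda>n. G (y (s n)))" unfolding G by (rule nn_integral_liminf) measurable
    also have "\<dots> \<le> liminf (\<lambda>n. ennreal (1 / Suc (s n)))"
      using y(2) by (intro Liminf_mono always_eventually allI) (simp add: less_imp_le)
    also have "(\<lambda>n. ennreal (1 / Suc (s n))) \<longlonglongrightarrow> ennreal 0"
      using LIMSEQ_subseq_LIMSEQ[OF lim_1_over_n[THEN LIMSEQ_Suc] l(2)] by (intro tendsto_ennrealI) (simp add: o_def)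
    then have "liminf (\<lambda>n. ennreal (1 / Suc (s n))) = ennreal 0"
      by (rule lim_imp_Liminf[OF sequentially_bot])
    finally have "G l = 0" by simp
    then have "AE z in lebesgue. ennreal (wnorm p W z l powr p) * indicator ?U z = 0"
      unfolding G by (subst (asm) nn_integral_0_iff_AE) auto
    moreover have "AE z in lebesgue. 0 < wnorm p W z l" using l(1) by (intro wnorm_pos_AE[OF W]) auto
    ultimately have "AE z in lebesgue. z \<notin> ?U"
      by eventually_elim (auto simp: indicator_def split: if_splits)
    then have "emeasure lebesgue ?U = 0" by (simp add: AE_iff_measurable[of ?U])
    then show False by (simp add: emeasure_ucube)
  qed
  then obtain n where n: "\<And>y. norm y = 1 \<Longrightarrow> ennreal (1 / Suc n) \<le> G y" by blast
  have "ennreal (1 / Suc n * norm y powr p) \<le> G y" for y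
  proof (cases "y = 0")
    case False
    let ?e = "y /\<^sub>R norm y"
    have yy: "y = complex_of_real (norm y) *s ?e" using False by (simp flip: scaleR_eq_scale_complex)
    have "wnorm p W z y = norm y * wnorm p W z ?e" for z
      by (subst yy, subst wnorm_scale) simp
    then have "G y = (\<integral>\<^sup>+z. ennreal (norm y powr p) * (ennreal (wnorm p W z ?e powr p) * indicator ?U z) \<partial>lebesgue)"
      unfolding G by (simp add: powr_mult wnorm_nonneg ennreal_mult mult.assoc)
    also have "\<dots> = ennreal (norm y powr p) * G ?e" unfolding G by (rule nn_integral_cmult) measurable
    also have "\<dots> \<ge> ennreal (norm y powr p) * ennreal (1 / Suc n)"
      using False by (intro mult_left_mono n) auto
    finally show ?thesis by (simp add: ennreal_mult[symmetric] mult.commute)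
  qed (use p in simp)
  then show ?thesis unfolding G_def by (intro exI[of _ "1 / Suc n"]) auto
qed

context dilation
begin

lemma weight_measure_doubling:
  assumes W: "doubling_weight A \<Delta> p W" and p: "1 \<le> p"
  shows "\<exists>c. \<forall>y. doubling_measure c (weight_measure p W y)"
proof -
  have mw: "matrix_weight W" using W by (simp add: doubling_weight_def)
  obtain c where c: "\<And>y x k.
        (\<integral>\<^sup>+ z \<in> (+) x ` (*\<^sub>R) 2 ` dball0 A \<Delta> k. ennreal (wnorm p W z y powr p) \<partial>lebesgue)
        \<le> ennreal c * (\<integral>\<^sup>+ z \<in> (+) x ` dball0 A \<Delta> k. ennreal (wnorm p W z y powr p) \<partial>lebesgue)"
    using W by (auto simp: doubling_weight_def)
  have "emeasure (weight_measure p W y) (gauge_ball x k 2) \<le> ennreal (max 1 c) * emeasure (weight_measure p W y) (gauge_ball x k 1)" for y x k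
  proof -
    have "emeasure (weight_measure p W y) (gauge_ball x k 2) \<le> ennreal c * emeasure (weight_measure p W y) (gauge_ball x k 1)"
      using c[where x = x and y = y and k = k] by (simp add: emeasure_weight_measure[OF mw p] gauge_ball_dball gauge_ball_double_dball)
    also have "\<dots> \<le> ennreal (max 1 c) * emeasure (weight_measure p W y) (gauge_ball x k 1)"
      by (intro mult_right_mono ennreal_leI) auto
    finally show ?thesis .
  qed
  then show ?thesis by (intro exI[of _ "max 1 c"]) (simp add: doubling_measure_def weight_measure_def)
qed

text \<open>The level \<open>k\<close> contribution to the sequence norm, without the factor \<open>\<bar>det A\<bar>\<^sup>k\<^sup>\<alpha>\<close>.\<close>

definition seq_level :: "real \<Rightarrow> (real^'d \<Rightarrow> complex^'m^'m) \<Rightarrow> ((int^'d) \<times> int \<Rightarrow> complex^'m) \<Rightarrow> int \<Rightarrow> ennreal" where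
  "seq_level p W s k = Lp_norm p (\<lambda>x. \<Sum>\<^sub>\<infinity>j. ennreal (measure lebesgue (dcube A j k) powr (- 1 / 2) *
         wnorm p W x (s (j, k)) * indicator (dcube A j k) x))"

lemma besov_seq_norm_eq:
  "besov_seq_norm \<alpha> q p A W s = lq_norm q (\<lambda>k. ennreal (\<delta> powr (real_of_int k * \<alpha>)) * seq_level p W s k)"
  by (simp add: besov_seq_norm_def seq_level_def \<delta>_def)

text \<open>Restricting the integral to one cube at a time costs nothing, as \<open>x \<mapsto> x\<^sup>p\<close> is superadditive.\<close>
lemma seq_level_lower:
  assumes W: "matrix_weight W" and p: "1 \<le> p"
  shows "(\<integral>\<^sup>+j. ennreal (\<delta> powr (real_of_int k / 2 * p)) * emeasure (weight_measure p W (s (j, k))) (dcube A j k) \<partial>count_space UNIV)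
    \<le> ennpowr (seq_level p W s k) p"
proof -
  note [measurable] = borel_measurable_wnorm_powr[OF W p]
  let ?a = "\<lambda>j x. ennreal (measure lebesgue (dcube A j k) powr (- 1 / 2) * wnorm p W x (s (j, k)) * indicator (dcube A j k) x)"
  have m: "measure lebesgue (dcube A j k) powr (- 1 / 2) = \<delta> powr (real_of_int k / 2)" for j
    using \<delta>_pos by (simp add: measure_dcube \<delta>_def[symmetric] powr_powr)
  have a: "ennpowr (?a j x) p = ennreal (\<delta> powr (real_of_int k / 2 * p)) * (ennreal (wnorm p W x (s (j, k)) powr p) * indicator (dcube A j k) x)" for j x
  proof (cases "x \<in> dcube A j k")
    case True
    then have "?a j x = ennreal (\<delta> powr (real_of_int k / 2) * wnorm p W x (s (j, k)))" by (simp only: m indicator_simps mult_1_right)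
    also have "ennpowr \<dots> p = ennreal (\<delta> powr (real_of_int k / 2 * p) * wnorm p W x (s (j, k)) powr p)"
      by (subst ennpowr_ennreal) (simp_all add: wnorm_nonneg powr_mult powr_powr)
    finally show ?thesis using True by (simp add: ennreal_mult)
  qed simp
  have "(\<integral>\<^sup>+j. ennreal (\<delta> powr (real_of_int k / 2 * p)) * emeasure (weight_measure p W (s (j, k))) (dcube A j k) \<partial>count_space UNIV)
     = (\<integral>\<^sup>+j. (\<integral>\<^sup>+x. ennpowr (?a j x) p \<partial>lebesgue) \<partial>count_space UNIV)"
    unfolding a emeasure_weight_measure[OF W p dcube_sets]
    by (intro nn_integral_cong nn_integral_cmult[symmetric]) measurable
  also have "\<dots> = (\<integral>\<^sup>+x. (\<integral>\<^sup>+j. ennpowr (?a j x) p \<partial>count_space UNIV) \<partial>lebesgue)"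
    unfolding a by (rule nn_integral_count_space_nn_integral[symmetric]) auto
  also have "\<dots> \<le> (\<integral>\<^sup>+x. ennpowr (\<Sum>\<^sub>\<infinity>j. ?a j x) p \<partial>lebesgue)"
    using ennpowr_superadditive[OF p] by (intro nn_integral_mono) (simp add: infsum_ennreal_eq_nn_integral)
  also have "\<dots> = ennpowr (seq_level p W s k) p"
    using p by (simp add: seq_level_def Lp_norm_def ennpowr_inverse)
  finally show ?thesis .
qed

text \<open>The norm bounds the \<open>w\<^sub>y\<close>-measure of \<open>Q\<close> for \<open>y = s\<^sub>Q\<close>, doubling transfers the bound to the unit cube, and
  there the measure controls \<open>\<bar>y\<bar>\<close> by \<open>weight_lower_bound\<close>.\<close>
lemma coefficient_growth:
  assumes W: "doubling_weight A \<Delta> p W" and p: "1 \<le> p" and q: "0 < q" and s: "s \<in> besov_seq_space \<alpha> q p A W"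
  shows "\<exists>C\<ge>0. \<exists>L\<ge>1. \<exists>n. \<forall>j k. norm (s (j, k)) \<le> C * L ^ nat \<bar>k\<bar> * (1 + norm (ivec j :: real^'d)) ^ n"
proof -
  have mw: "matrix_weight W" using W by (simp add: doubling_weight_def)
  obtain c where c: "\<And>y. doubling_measure c (weight_measure p W y)" using weight_measure_doubling[OF W p] by blast
  obtain c0 where c0: "c0 > 0" "\<And>y. ennreal (c0 * norm y powr p) \<le> emeasure (weight_measure p W y) (ucube 0)"
    using weight_lower_bound[OF mw p] by blast
  obtain K L n where K: "K \<ge> 0" "L \<ge> 1" and KL: "\<And>N j l. doubling_measure c N \<Longrightarrow>
     emeasure N (dcube A 0 0) \<le> ennreal (K * L ^ nat \<bar>l\<bar> * (1 + norm (ivec j :: real^'d)) ^ n) * emeasure N (dcube A j l)"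
    using doubling_unit_cube[of c] by blast
  obtain D where D: "D \<ge> 1" "\<And>t. \<delta> powr t \<le> D powr \<bar>t\<bar>" using \<delta>_bound by blast
  define B where "B = enn2real (besov_seq_norm \<alpha> q p A W s)"
  have B: "0 \<le> B" "besov_seq_norm \<alpha> q p A W s = ennreal B"
    using s by (simp_all add: B_def besov_seq_space_def)
  \<comment> \<open>Bounds the level-dependent normalisations of the norm, per level.\<close>
  define E where "E = D powr ((\<bar>\<alpha>\<bar> + 1 / 2) * p)"
  have E: "1 \<le> E" using D p by (simp add: E_def ge_one_powr_ge_zero)
  define C where "C = 1 + K * B powr p / c0"
  have "norm (s (j, k)) \<le> C * (L * E) ^ nat \<bar>k\<bar> * (1 + norm (ivec j :: real^'d)) ^ n" for j k
  proof -
    let ?y = "s (j, k)" and ?J = "1 + norm (ivec j :: real^'d)" and ?N = "emeasure (weight_measure p W (s (j, k))) (dcube A j k)"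
    have "ennreal (\<delta> powr (real_of_int k * \<alpha>)) * seq_level p W s k \<le> ennreal B"
      unfolding B(2)[symmetric] besov_seq_norm_eq
      by (rule lq_norm_upper[OF q, of "\<lambda>k. ennreal (\<delta> powr (real_of_int k * \<alpha>)) * seq_level p W s k"])
    then have "ennpowr (ennreal (\<delta> powr (real_of_int k * \<alpha>)) * seq_level p W s k) p \<le> ennpowr (ennreal B) p"
      using p by (intro ennpowr_mono) auto
    then have 1: "ennreal (\<delta> powr (real_of_int k * \<alpha> * p)) * ennpowr (seq_level p W s k) p \<le> ennreal (B powr p)"
      using p B(1) by (simp add: ennpowr_mult ennpowr_ennreal powr_powr)
    have "ennreal (\<delta> powr (real_of_int k / 2 * p)) * ?N \<le> ennpowr (seq_level p W s k) p"
      using order_trans[OF sum_le_nn_integral_count_space seq_level_lower[OF mw p, of k s], of "{j}"] by simp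
    then have "ennreal (\<delta> powr (real_of_int k * \<alpha> * p)) * (ennreal (\<delta> powr (real_of_int k / 2 * p)) * ?N) \<le> ennreal (B powr p)"
      using order_trans[OF mult_left_mono 1] by simp
    moreover have "\<delta> powr (real_of_int k * (\<alpha> + 1 / 2) * p) = \<delta> powr (real_of_int k * \<alpha> * p) * \<delta> powr (real_of_int k / 2 * p)"
      by (simp add: distrib_left distrib_right flip: powr_add)
    ultimately have "ennreal (\<delta> powr (real_of_int k * (\<alpha> + 1 / 2) * p)) * ?N \<le> ennreal (B powr p)"
      by (simp only: ennreal_mult powr_ge_zero mult.assoc)
    then have *: "ennreal (\<delta> powr (- (real_of_int k * (\<alpha> + 1 / 2) * p))) * (ennreal (\<delta> powr (real_of_int k * (\<alpha> + 1 / 2) * p)) * ?N)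
        \<le> ennreal (\<delta> powr (- (real_of_int k * (\<alpha> + 1 / 2) * p))) * ennreal (B powr p)" by (rule mult_left_mono) simp
    then have N: "?N \<le> ennreal (\<delta> powr (- (real_of_int k * (\<alpha> + 1 / 2) * p)) * B powr p)"
    proof -
      have "\<delta> powr (- (real_of_int k * (\<alpha> + 1 / 2) * p)) * \<delta> powr (real_of_int k * (\<alpha> + 1 / 2) * p) = 1"
        using \<delta>_pos by (simp only: powr_add[symmetric]) simp
      then have "ennreal (\<delta> powr (- (real_of_int k * (\<alpha> + 1 / 2) * p))) * ennreal (\<delta> powr (real_of_int k * (\<alpha> + 1 / 2) * p)) = 1"
        by (simp only: ennreal_mult[symmetric] powr_ge_zero) simp
      then show ?thesis using * by (simp only: ennreal_mult powr_ge_zero mult.assoc[symmetric] mult_1_left)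
    qed
    have "\<delta> powr (- (real_of_int k * (\<alpha> + 1 / 2) * p)) \<le> E ^ nat \<bar>k\<bar>"
    proof -
      have "\<delta> powr (- (real_of_int k * (\<alpha> + 1 / 2) * p)) \<le> D powr \<bar>real_of_int k * (\<alpha> + 1 / 2) * p\<bar>"
        using D(2)[of "- (real_of_int k * (\<alpha> + 1 / 2) * p)"] by simp
      also have "\<dots> \<le> D powr (((\<bar>\<alpha>\<bar> + 1 / 2) * p) * real (nat \<bar>k\<bar>))"
      proof (intro powr_mono D(1))
        have "\<bar>real_of_int k * (\<alpha> + 1 / 2) * p\<bar> = real (nat \<bar>k\<bar>) * p * \<bar>\<alpha> + 1 / 2\<bar>" using p by (simp add: abs_mult mult_ac)
        also have "\<dots> \<le> real (nat \<bar>k\<bar>) * p * (\<bar>\<alpha>\<bar> + 1 / 2)" using p by (intro mult_left_mono) auto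
        finally show "\<bar>real_of_int k * (\<alpha> + 1 / 2) * p\<bar> \<le> (\<bar>\<alpha>\<bar> + 1 / 2) * p * real (nat \<bar>k\<bar>)" by (simp add: mult_ac)
      qed
      also have "\<dots> = E ^ nat \<bar>k\<bar>" using E D(1) by (simp add: E_def powr_realpow[symmetric] powr_powr)
      finally show ?thesis .
    qed
    then have N': "?N \<le> ennreal (E ^ nat \<bar>k\<bar> * B powr p)"
      by (intro order_trans[OF N] ennreal_leI mult_right_mono) auto
    have "dcube A 0 0 = (ucube 0 :: (real^'d) set)" by (simp add: dcube_ucube)
    then have "ennreal (c0 * norm ?y powr p) \<le> ennreal (K * L ^ nat \<bar>k\<bar> * ?J ^ n) * ?N"
      using order_trans[OF c0(2)[of ?y], of "ennreal (K * L ^ nat \<bar>k\<bar> * ?J ^ n) * ?N"] KL[OF c, of ?y k j] by (simp only:)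
    also have "\<dots> \<le> ennreal (K * L ^ nat \<bar>k\<bar> * ?J ^ n) * ennreal (E ^ nat \<bar>k\<bar> * B powr p)"
      by (intro mult_left_mono N') auto
    also have "\<dots> = ennreal ((K * L ^ nat \<bar>k\<bar> * ?J ^ n) * (E ^ nat \<bar>k\<bar> * B powr p))"
      using K E by (subst ennreal_mult) auto
    finally have "c0 * norm ?y powr p \<le> (K * L ^ nat \<bar>k\<bar> * ?J ^ n) * (E ^ nat \<bar>k\<bar> * B powr p)"
      using K E by (subst (asm) ennreal_le_iff) auto
    then have yp: "norm ?y powr p \<le> (K * B powr p / c0) * ((L * E) ^ nat \<bar>k\<bar> * ?J ^ n)"
      using c0(1) by (simp add: field_simps power_mult_distrib)
    have one: "1 \<le> (L * E) ^ nat \<bar>k\<bar> * ?J ^ n"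
    proof -
      have "1 * 1 \<le> L * E" using K E by (intro mult_mono) auto
      then have "1 * 1 \<le> (L * E) ^ nat \<bar>k\<bar> * ?J ^ n" by (intro mult_mono one_le_power) auto
      then show ?thesis by simp
    qed
    \<comment> \<open>A crude \<open>p\<close>-th root, sufficient because only the growth rate matters.\<close>
    have "norm ?y \<le> 1 + norm ?y powr p"
    proof (cases "norm ?y \<le> 1")
      case True
      then show ?thesis using powr_ge_zero[of "norm ?y" p] by linarith
    next
      case False
      then have "norm ?y powr 1 \<le> norm ?y powr p" using p by (intro powr_mono) auto
      then show ?thesis using False by simp
    qed
    also have "\<dots> \<le> 1 * ((L * E) ^ nat \<bar>k\<bar> * ?J ^ n) + (K * B powr p / c0) * ((L * E) ^ nat \<bar>k\<bar> * ?J ^ n)"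
      using one yp by linarith
    also have "\<dots> = C * (L * E) ^ nat \<bar>k\<bar> * ?J ^ n" by (simp add: C_def algebra_simps)
    finally show ?thesis .
  qed
  moreover have "0 \<le> C" using K c0(1) by (simp add: C_def)
  moreover have "1 \<le> L * E" using mult_mono[of 1 L 1 E] K E by simp
  ultimately show ?thesis by blast
qed

section \<open>Convergence of the inverse transform\<close>

lemma psi_cube_bounded:
  assumes \<psi>: "\<psi> \<in> schwartz"
  shows "psi_cube A \<psi> Q \<in> borel_measurable borel" "\<exists>c. \<forall>x. norm (psi_cube A \<psi> Q x) \<le> c"
proof -
  obtain j k where Q: "Q = (j, k)" by (cases Q)
  have [measurable]: "\<psi> \<in> borel_measurable borel" using \<psi> by (rule schwartz_borel)
  have e: "psi_cube A \<psi> Q = (\<lambda>x. complex_of_real (\<delta> powr (real_of_int k / 2)) * \<psi> (Z k x - ivec j))"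
    by (simp add: Q psi_cube_eq fun_eq_iff)
  show "psi_cube A \<psi> Q \<in> borel_measurable borel" unfolding e by measurable
  obtain c where c: "\<And>x. (1 + norm x) ^ 0 * norm (\<psi> x) \<le> c" using schwartz_decay[OF \<psi>] by blast
  have "norm (psi_cube A \<psi> Q x) \<le> \<delta> powr (real_of_int k / 2) * c" for x
    unfolding e norm_mult using c by (intro mult_mono) auto
  then show "\<exists>c. \<forall>x. norm (psi_cube A \<psi> Q x) \<le> c" by blast
qed

end

definition poly_growth :: "(real^'d \<Rightarrow> complex) \<Rightarrow> bool" where
  "poly_growth g \<longleftrightarrow> g \<in> borel_measurable borel \<and> (\<exists>c n. \<forall>x. norm (g x) \<le> c * (1 + norm x) ^ n)"

lemma poly_growth_add:
  assumes "poly_growth f" "poly_growth g" shows "poly_growth (\<lambda>x. f x + g x)"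
proof -
  obtain c n d m where c: "\<And>x. norm (f x) \<le> c * (1 + norm x) ^ n" and d: "\<And>x. norm (g x) \<le> d * (1 + norm x) ^ m"
    using assms unfolding poly_growth_def by blast
  have cd: "0 \<le> c" "0 \<le> d" using order_trans[OF norm_ge_zero c[of 0]] order_trans[OF norm_ge_zero d[of 0]] by simp_all
  have "norm (f x + g x) \<le> (c + d) * (1 + norm x) ^ (n + m)" for x
  proof -
    have "norm (f x + g x) \<le> c * (1 + norm x) ^ n + d * (1 + norm x) ^ m"
      by (intro order_trans[OF norm_triangle_ineq] add_mono c d)
    also have "\<dots> \<le> c * (1 + norm x) ^ (n + m) + d * (1 + norm x) ^ (n + m)"
      using cd by (intro add_mono mult_left_mono power_increasing) auto
    finally show ?thesis by (simp add: distrib_right)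
  qed
  then show ?thesis using assms by (auto simp: poly_growth_def)
qed

lemma poly_growth_cmult:
  assumes "poly_growth f" shows "poly_growth (\<lambda>x. a * f x)"
proof -
  obtain c n where c: "\<And>x. norm (f x) \<le> c * (1 + norm x) ^ n" using assms unfolding poly_growth_def by blast
  have "norm (a * f x) \<le> (norm a * c) * (1 + norm x) ^ n" for x
    using mult_left_mono[OF c[of x], of "norm a"] by (simp add: norm_mult mult.assoc)
  then show ?thesis using assms by (auto simp: poly_growth_def)
qed

lemma poly_growth_sum:
  assumes "\<And>i. poly_growth (f i)" shows "poly_growth (\<lambda>x. \<Sum>i\<in>I. f i x)"
proof -
  have z: "poly_growth (\<lambda>x. 0)" by (auto simp: poly_growth_def intro!: exI[of _ 0])
  show ?thesis by (induction I rule: infinite_finite_induct) (auto intro: z poly_growth_add assms)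
qed

lemma poly_growth_polynomial:
  fixes P :: "real^'d \<Rightarrow> complex"
  assumes P: "polynomial_function P" shows "poly_growth P"
proof -
  have c: "poly_growth (\<lambda>x. complex_of_real (R x))" if R: "real_polynomial_function R" for R :: "real^'d \<Rightarrow> real"
    using real_polynomial_growth[OF R] real_polynomial_borel[OF R] by (fastforce simp: poly_growth_def)
  have "poly_growth (\<lambda>x. complex_of_real (Re (P x)) + \<i> * complex_of_real (Im (P x)))"
    by (intro poly_growth_add poly_growth_cmult c polynomial_Re_Im[OF P])
  then show ?thesis by (simp flip: complex_eq)
qed

lemma poly_growth_tempered: "poly_growth g \<Longrightarrow> regular_dist g \<in> tempered"
  unfolding poly_growth_def using regular_dist_tempered by blast

lemma poly_growth_integrable:
  assumes "poly_growth g" "f \<in> schwartz" shows "integrable lebesgue (\<lambda>x. g x * f x)"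
proof -
  obtain c n where "g \<in> borel_measurable borel" "\<And>x. norm (g x) \<le> c * (1 + norm x) ^ n"
    using assms(1) unfolding poly_growth_def by blast
  then show ?thesis by (intro integrable_rapid rapid_mult_bound[OF rapid_schwartz[OF assms(2)]])
qed

lemma regular_dist_sum:
  assumes g: "\<And>i. poly_growth (g i)" and f: "f \<in> schwartz"
  shows "regular_dist (\<lambda>x. \<Sum>i\<in>J. a i * g i x) f = (\<Sum>i\<in>J. a i * regular_dist (g i) f)"
proof -
  have "(\<lambda>x. (\<Sum>i\<in>J. a i * g i x) * f x) = (\<lambda>x. \<Sum>i\<in>J. a i * (g i x * f x))"
    by (simp add: sum_distrib_right mult.assoc)
  then show ?thesis using f
    by (simp add: regular_dist_def Bochner_Integration.integral_sum poly_growth_integrable[OF g f])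
qed

context dilation
begin

lemma poly_growth_psi_cube: "\<psi> \<in> schwartz \<Longrightarrow> poly_growth (psi_cube A \<psi> Q)"
proof -
  assume "\<psi> \<in> schwartz"
  note b = psi_cube_bounded[OF this, of Q]
  then obtain c where "\<And>x. norm (psi_cube A \<psi> Q x) \<le> c * (1 + norm x) ^ 0" by auto
  then show ?thesis using b(1) unfolding poly_growth_def by blast
qed

lemma psi_mod_polynomial: "polynomial_function (\<lambda>x. psi_cube A \<psi> Q x - psi_mod p \<psi> Q x)"
proof -
  obtain j k where Q: "Q = (j, k)" by (cases Q)
  have "polynomial_function (\<lambda>x. \<delta> powr (real_of_int k / 2) *\<^sub>R taylor \<psi> p (- ivec j) (Z k x))"
    by (intro polynomial_function_cmul polynomial_function_taylor[of "(*v) (mat_zpow A k)"]) auto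
  then show ?thesis by (cases "0 \<le> k") (simp_all add: psi_mod_def Q scaleR_conv_of_real)
qed

lemma poly_growth_psi_mod:
  assumes "\<psi> \<in> schwartz" shows "poly_growth (psi_mod p \<psi> Q)"
proof -
  have "poly_growth (\<lambda>x. psi_cube A \<psi> Q x + (- 1) * (psi_cube A \<psi> Q x - psi_mod p \<psi> Q x))"
    by (intro poly_growth_add poly_growth_cmult poly_growth_psi_cube poly_growth_polynomial psi_mod_polynomial assms)
  then show ?thesis by simp
qed

text \<open>The partial sums of the original and of the corrected series lie in the same classes.\<close>
lemma inv_transform_exists:
  assumes W: "doubling_weight A \<Delta> p W" and p: "1 \<le> p" and q: "0 < q"
    and s: "s \<in> besov_seq_space \<alpha> q p A W" and \<psi>: "\<psi> \<in> schwartz" "moment_free \<psi>"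
  shows "\<exists>F. inv_transform_has_sum A \<psi> s F"
proof -
  let ?dd = "2 * CARD('d)"
  obtain C L n where C: "C \<ge> 0" "L \<ge> 1" "\<And>j k. norm (s (j, k)) \<le> C * L ^ nat \<bar>k\<bar> * (1 + norm (ivec j :: real^'d)) ^ n"
    using coefficient_growth[OF W p q s] by blast
  \<comment> \<open>The choice \<open>1 / (2 L)\<close> leaves the summable factor \<open>2\<^sup>-\<^sup>\<bar>\<^sup>k\<^sup>\<bar>\<close> after multiplication by the growth \<open>L\<^sup>\<bar>\<^sup>k\<^sup>\<bar>\<close>.\<close>
  obtain C' m M where C': "C' \<ge> 0" "\<And>f j k. f \<in> schwartz \<Longrightarrow>
     norm (LINT y|lebesgue. psi_mod m \<psi> (j, k) y * f y) \<le> C' * (1 / (2 * L)) ^ nat \<bar>k\<bar> / (1 + norm (ivec j :: real^'d)) ^ (n + ?dd) * schwartz_seminorm M f"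
  proof -
    have "0 < 1 / (2 * L)" using C(2) by simp
    from psi_mod_pairing_bound[OF \<psi> this, of "n + ?dd"] that show thesis by blast
  qed
  define w where "w = (\<lambda>Q. (C * C') * (case Q of (j :: int^'d, k) \<Rightarrow> (1 / 2) ^ nat \<bar>k\<bar> / (1 + norm (ivec j :: real^'d)) ^ ?dd))"
  have w: "w summable_on UNIV" unfolding w_def
    by (intro summable_on_cmult_right summable_level_lattice) auto
  have "\<exists>u. u \<in> tempered \<and> limitin tempered_mod_poly_topology
       (\<lambda>J. mod_poly `` {regular_dist (\<lambda>x. \<Sum>Q\<in>J. s Q $ i * psi_cube A \<psi> Q x)})
       (mod_poly `` {u}) (finite_subsets_at_top UNIV)" for i
  proof -
    let ?v = "\<lambda>Q. regular_dist (psi_mod m \<psi> Q)"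
    have v: "?v Q \<in> tempered" for Q by (intro poly_growth_tempered poly_growth_psi_mod \<psi>)
    have b: "norm (s Q $ i * ?v Q f) \<le> w Q * schwartz_seminorm M f" if f: "f \<in> schwartz" for Q f
    proof -
      obtain j k where Q: "Q = (j, k)" by (cases Q)
      let ?J = "1 + norm (ivec j :: real^'d)" and ?k = "nat \<bar>k\<bar>"
      have J: "?J \<noteq> 0" by (metis add_pos_nonneg less_irrefl norm_ge_zero zero_less_one)
      have "norm (s Q $ i) \<le> C * L ^ ?k * ?J ^ n"
        unfolding Q by (rule order_trans[OF Finite_Cartesian_Product.norm_nth_le C(3)])
      moreover have "norm (?v Q f) \<le> C' * (1 / (2 * L)) ^ ?k / ?J ^ (n + ?dd) * schwartz_seminorm M f"
        using C'(2)[OF f] f by (simp add: Q regular_dist_def)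
      ultimately have "norm (s Q $ i * ?v Q f)
          \<le> (C * L ^ ?k * ?J ^ n) * (C' * (1 / (2 * L)) ^ ?k / ?J ^ (n + ?dd) * schwartz_seminorm M f)"
        unfolding norm_mult using C(1,2) by (intro mult_mono) auto
      also have "\<dots> = w Q * schwartz_seminorm M f"
        using C(2) J by (simp add: w_def Q power_add power_divide power_mult_distrib field_simps)
      finally show ?thesis .
    qed
    obtain u where u: "u \<in> tempered" "\<And>f. f \<in> schwartz \<Longrightarrow> ((\<lambda>Q. s Q $ i * ?v Q f) has_sum u f) UNIV"
      using tempered_of_absolutely_convergent[where v = ?v and a = "\<lambda>Q. s Q $ i", OF v w b] by blast
    let ?U = "\<lambda>J. regular_dist (\<lambda>x. \<Sum>Q\<in>J. s Q $ i * psi_mod m \<psi> Q x)"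
    let ?V = "\<lambda>J. regular_dist (\<lambda>x. \<Sum>Q\<in>J. s Q $ i * psi_cube A \<psi> Q x)"
    have U: "?U J \<in> tempered" for J
      by (intro poly_growth_tempered poly_growth_sum poly_growth_cmult poly_growth_psi_mod \<psi>)
    have V: "?V J \<in> tempered" for J
      by (intro poly_growth_tempered poly_growth_sum poly_growth_cmult poly_growth_psi_cube \<psi>)
    have "limitin tempered_mod_poly_topology (\<lambda>J. mod_poly `` {?U J}) (mod_poly `` {u}) (finite_subsets_at_top UNIV)"
    proof (rule limitin_mod_poly_class[OF u(1) U])
      fix f :: "real^'d \<Rightarrow> complex" assume f: "f \<in> schwartz"
      show "((\<lambda>J. ?U J f) \<longlongrightarrow> u f) (finite_subsets_at_top UNIV)"
        using u(2)[OF f] unfolding has_sum_def regular_dist_sum[OF poly_growth_psi_mod[OF \<psi>(1)] f] .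
    qed
    moreover have "mod_poly `` {?U J} = mod_poly `` {?V J}" for J
    proof (rule mod_poly_class_eq[symmetric])
      let ?P = "\<lambda>x. \<Sum>Q\<in>J. s Q $ i * (psi_cube A \<psi> Q x - psi_mod m \<psi> Q x)"
      have "polynomial_function ?P"
      proof (cases "finite J")
        case True
        have "polynomial_function (\<lambda>x. s Q $ i * (psi_cube A \<psi> Q x - psi_mod m \<psi> Q x))" for Q
          using polynomial_function_compose[OF psi_mod_polynomial[of \<psi> Q m] polynomial_function_bounded_linear[OF bounded_linear_mult_right[of "s Q $ i"]]]
          by (simp add: o_def)
        then show ?thesis using True by (intro polynomial_function_sum) auto
      qed simp
      moreover have "?V J f - ?U J f = regular_dist ?P f" if f: "f \<in> schwartz" for f
      proof -
        have pg: "poly_growth (\<lambda>x. psi_cube A \<psi> Q x - psi_mod m \<psi> Q x)" for Q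
          by (rule poly_growth_polynomial[OF psi_mod_polynomial])
        have "regular_dist (\<lambda>x. psi_cube A \<psi> Q x - psi_mod m \<psi> Q x) f
            = regular_dist (psi_cube A \<psi> Q) f - regular_dist (psi_mod m \<psi> Q) f" for Q
          using f poly_growth_integrable[OF poly_growth_psi_cube[OF \<psi>(1)] f] poly_growth_integrable[OF poly_growth_psi_mod[OF \<psi>(1)] f]
          by (simp add: regular_dist_def left_diff_distrib)
        then show ?thesis
          unfolding regular_dist_sum[OF pg f] regular_dist_sum[OF poly_growth_psi_mod[OF \<psi>(1)] f]
            regular_dist_sum[OF poly_growth_psi_cube[OF \<psi>(1)] f]
          by (simp add: right_diff_distrib sum_subtractf)
      qed
      ultimately show "(?V J, ?U J) \<in> mod_poly" using U V unfolding mod_poly_def by blast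
    qed
    ultimately show ?thesis using u(1) by auto
  qed
  then have "\<exists>u. \<forall>i. u i \<in> tempered \<and> limitin tempered_mod_poly_topology
       (\<lambda>J. mod_poly `` {regular_dist (\<lambda>x. \<Sum>Q\<in>J. s Q $ i * psi_cube A \<psi> Q x)})
       (mod_poly `` {u i}) (finite_subsets_at_top UNIV)" by (intro choice allI)
  then obtain u where "\<And>i. limitin tempered_mod_poly_topology
       (\<lambda>J. mod_poly `` {regular_dist (\<lambda>x. \<Sum>Q\<in>J. s Q $ i * psi_cube A \<psi> Q x)})
       (mod_poly `` {u i}) (finite_subsets_at_top UNIV)" by blast
  then have "inv_transform_has_sum A \<psi> s (\<chi> i. mod_poly `` {u i})"
    by (simp add: inv_transform_has_sum_def)
  then show ?thesis by blast
qed

text \<open>Evaluation at a moment-free Schwartz function is continuous on the quotient, so this holds for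
  every sum \<open>F\<close> of the series.\<close>
lemma conv_class_inv_transform:
  assumes F: "inv_transform_has_sum A \<psi> s F" and \<psi>: "\<psi> \<in> schwartz" and \<phi>: "\<phi> \<in> schwartz" "moment_free \<phi>"
  shows "((\<lambda>Q. s Q $ i * (LINT y|lebesgue. psi_cube A \<psi> Q y * dilate A \<phi> k (x - y)))
     has_sum conv_class (F $ i) (dilate A \<phi> k) x) UNIV"
proof -
  let ?h = "\<lambda>y. dilate A \<phi> k (x - y)"
  have h: "?h \<in> schwartz" "moment_free ?h" using dilate_reflected[OF \<phi>] by blast+
  have "((\<lambda>J. regular_dist (\<lambda>x. \<Sum>Q\<in>J. s Q $ i * psi_cube A \<psi> Q x) ?h) \<longlongrightarrow> class_eval ?h (F $ i)) (finite_subsets_at_top UNIV)"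
    using F unfolding inv_transform_has_sum_def
    by (intro limitin_class_eval h poly_growth_tempered poly_growth_sum poly_growth_cmult poly_growth_psi_cube \<psi>) blast
  then show ?thesis
    unfolding regular_dist_sum[OF poly_growth_psi_cube[OF \<psi>] h(1)] has_sum_def
    using h by (simp add: regular_dist_def class_eval_def conv_class_def)
qed

end

section \<open>The norm estimate\<close>

context dilation
begin

text \<open>The integral is split over the cubes of level \<open>l\<close>; on \<open>Q\<^sub>i\<^sub>,\<^sub>l\<close> the kernel is comparable to \<open>(1 + \<bar>i - j\<bar>)\<^sup>-\<^sup>N\<close>, which
  beats the polynomial loss of the doubling property.\<close>
lemma weighted_tail:
  assumes W: "doubling_weight A \<Delta> p W" and p: "1 \<le> p"
  shows "\<exists>N\<ge>2 * CARD('d). \<exists>K\<ge>0. \<forall>y j l.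
    (\<integral>\<^sup>+x. ennreal (1 / (1 + norm (Z l x - ivec j)) ^ N) * ennreal (wnorm p W x y powr p) \<partial>lebesgue)
      \<le> ennreal K * emeasure (weight_measure p W y) (dcube A j l)"
proof -
  let ?dd = "2 * CARD('d)"
  have mw: "matrix_weight W" using W by (simp add: doubling_weight_def)
  note [measurable] = borel_measurable_wnorm_powr[OF mw p]
  obtain c where c: "\<And>y. doubling_measure c (weight_measure p W y)" using weight_measure_doubling[OF W p] by blast
  obtain K n where K: "K \<ge> 0" and Kn: "\<And>N i j l. doubling_measure c N \<Longrightarrow>
     emeasure N (dcube A i l) \<le> ennreal (K * (1 + norm (ivec i - ivec j :: real^'d)) ^ n) * emeasure N (dcube A j l)"
    using doubling_cubes[of c] by blast
  obtain K0 where K0: "K0 > 0" "\<And>x::real^'d. (\<integral>\<^sup>+j. ennreal (1 / (1 + norm (x - ivec j)) ^ ?dd) \<partial>count_space UNIV) \<le> ennreal K0"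
    using lattice_sum_bounded by blast
  \<comment> \<open>Beyond the loss \<open>n\<close>, the exponent leaves enough for a convergent lattice sum.\<close>
  define N where "N = n + ?dd"
  define D where "D = 1 + real CARD('d)"
  have "(\<integral>\<^sup>+x. ennreal (1 / (1 + norm (Z l x - ivec j)) ^ N) * ennreal (wnorm p W x y powr p) \<partial>lebesgue)
      \<le> ennreal (D ^ N * K * K0) * emeasure (weight_measure p W y) (dcube A j l)" for y j l
  proof -
    let ?w = "\<lambda>x. ennreal (wnorm p W x y powr p)" and ?M = "\<lambda>i. emeasure (weight_measure p W y) (dcube A i l)"
    let ?e = "\<lambda>i. 1 + norm (ivec i - ivec j :: real^'d)"
    have epos: "?e i > 0" for i by (simp add: add_pos_nonneg)
    have "(\<integral>\<^sup>+x. ennreal (1 / (1 + norm (Z l x - ivec j)) ^ N) * ?w x \<partial>lebesgue)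
        \<le> (\<integral>\<^sup>+x. (\<integral>\<^sup>+i. ennreal (D ^ N / ?e i ^ N) * (?w x * indicator (dcube A i l) x) \<partial>count_space UNIV) \<partial>lebesgue)"
    proof (rule nn_integral_mono)
      fix x
      obtain i where i: "x \<in> dcube A i l" using ex_dcube by blast
      have "?e i = 1 + norm (ivec j - ivec i :: real^'d)" by (simp add: norm_minus_commute)
      also have "\<dots> \<le> D * (1 + norm (ivec j - Z l x))"
        unfolding D_def using i by (intro one_plus_norm_ucube[OF ivec_in_ucube]) (simp add: mem_dcube)
      finally have "?e i \<le> D * (1 + norm (Z l x - ivec j))" by (simp add: norm_minus_commute)
      then have "?e i ^ N \<le> D ^ N * (1 + norm (Z l x - ivec j)) ^ N"
        using epos[of i] by (subst power_mult_distrib[symmetric]) (intro power_mono, auto)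
      moreover have "(1 + norm (Z l x - ivec j)) ^ N > 0" "?e i ^ N > 0" using epos by (auto simp: add_pos_nonneg)
      ultimately have "1 / (1 + norm (Z l x - ivec j)) ^ N \<le> D ^ N / ?e i ^ N" by (simp add: divide_simps mult.commute)
      then have "ennreal (1 / (1 + norm (Z l x - ivec j)) ^ N) * ?w x \<le> (\<Sum>i\<in>{i}. ennreal (D ^ N / ?e i ^ N) * (?w x * indicator (dcube A i l) x))"
        using i by (simp add: ennreal_leI mult_right_mono)
      also have "\<dots> \<le> (\<integral>\<^sup>+i. ennreal (D ^ N / ?e i ^ N) * (?w x * indicator (dcube A i l) x) \<partial>count_space UNIV)"
        by (rule sum_le_nn_integral_count_space) auto
      finally show "ennreal (1 / (1 + norm (Z l x - ivec j)) ^ N) * ?w x \<le> \<dots>" .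
    qed
    also have "\<dots> = (\<integral>\<^sup>+i. (\<integral>\<^sup>+x. ennreal (D ^ N / ?e i ^ N) * (?w x * indicator (dcube A i l) x) \<partial>lebesgue) \<partial>count_space UNIV)"
      by (rule nn_integral_count_space_nn_integral) auto
    also have "\<dots> = (\<integral>\<^sup>+i. ennreal (D ^ N / ?e i ^ N) * ?M i \<partial>count_space UNIV)"
      unfolding emeasure_weight_measure[OF mw p dcube_sets]
      by (intro nn_integral_cong nn_integral_cmult) measurable
    also have "\<dots> \<le> (\<integral>\<^sup>+i. ennreal (1 / (1 + norm (ivec j - ivec i :: real^'d)) ^ ?dd) * (ennreal (D ^ N * K) * ?M j) \<partial>count_space UNIV)"
    proof (rule nn_integral_mono)
      fix i
      have "ennreal (D ^ N / ?e i ^ N) * ?M i \<le> ennreal (D ^ N / ?e i ^ N) * (ennreal (K * ?e i ^ n) * ?M j)"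
        by (intro mult_left_mono Kn c) auto
      also have "\<dots> = ennreal (D ^ N / ?e i ^ N * (K * ?e i ^ n)) * ?M j"
        using K by (subst ennreal_mult) (auto simp: D_def mult.assoc)
      also have "D ^ N / ?e i ^ N * (K * ?e i ^ n) = 1 / (1 + norm (ivec j - ivec i :: real^'d)) ^ ?dd * (D ^ N * K)"
        using epos[of i] by (simp add: N_def power_add norm_minus_commute)
      also have "ennreal \<dots> * ?M j = ennreal (1 / (1 + norm (ivec j - ivec i :: real^'d)) ^ ?dd) * (ennreal (D ^ N * K) * ?M j)"
        using K by (subst ennreal_mult) (auto simp: D_def mult.assoc)
      finally show "ennreal (D ^ N / ?e i ^ N) * ?M i \<le> \<dots>" .
    qed
    also have "\<dots> = (\<integral>\<^sup>+i. ennreal (1 / (1 + norm (ivec j - ivec i :: real^'d)) ^ ?dd) \<partial>count_space UNIV) * (ennreal (D ^ N * K) * ?M j)"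
      by (rule nn_integral_multc) auto
    also have "\<dots> \<le> ennreal K0 * (ennreal (D ^ N * K) * ?M j)" by (intro mult_right_mono K0) auto
    also have "\<dots> = ennreal (D ^ N * K * K0) * ?M j"
      using K K0(1) by (simp add: D_def ennreal_mult mult_ac)
    finally show ?thesis .
  qed
  moreover have "0 \<le> D ^ N * K * K0" using K K0(1) by (simp add: D_def)
  ultimately show ?thesis by (intro exI[of _ N] conjI exI[of _ "D ^ N * K * K0"]) (auto simp: N_def)
qed

text \<open>The triangle inequality for the finite partial sums, in the limit.\<close>
lemma wnorm_transform_le:
  fixes F :: "('d functional set)^'m"
  assumes F: "inv_transform_has_sum A \<psi> s F" and \<psi>: "\<psi> \<in> schwartz" and \<phi>: "\<phi> \<in> schwartz" "moment_free \<phi>"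
  shows "ennreal (wnorm p W x (\<chi> i. conv_class (F $ i) (dilate A \<phi> k) x))
    \<le> (\<integral>\<^sup>+Q. ennreal (norm (LINT y|lebesgue. psi_cube A \<psi> Q y * dilate A \<phi> k (x - y)) * wnorm p W x (s Q)) \<partial>count_space UNIV)"
proof -
  define G where "G Q = (LINT y|lebesgue. psi_cube A \<psi> Q y * dilate A \<phi> k (x - y))" for Q
  define v where "v = (\<chi> i. conv_class (F $ i) (dilate A \<phi> k) x)"
  let ?R = "\<integral>\<^sup>+Q. ennreal (norm (G Q) * wnorm p W x (s Q)) \<partial>count_space UNIV"
  have "((\<lambda>J. (\<Sum>Q\<in>J. G Q *s s Q) $ i) \<longlongrightarrow> v $ i) (finite_subsets_at_top UNIV)" for i
    using conv_class_inv_transform[OF F \<psi> \<phi>, of i k x] by (simp add: has_sum_def G_def v_def mult.commute)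
  then have lim: "((\<lambda>J. \<Sum>Q\<in>J. G Q *s s Q) \<longlongrightarrow> v) (finite_subsets_at_top UNIV)"
    by (intro vec_tendstoI)
  have "continuous_on UNIV (\<lambda>v. norm (psd_powr (W x) (1 / p) *v v))"
    by (simp add: matrix_vector_mult_def) (intro continuous_intros)
  then have "((\<lambda>J. wnorm p W x (\<Sum>Q\<in>J. G Q *s s Q)) \<longlongrightarrow> wnorm p W x v) (finite_subsets_at_top UNIV)"
    unfolding wnorm_def using lim by (rule continuous_on_tendsto_compose) auto
  then have "((\<lambda>J. ennreal (wnorm p W x (\<Sum>Q\<in>J. G Q *s s Q))) \<longlongrightarrow> ennreal (wnorm p W x v)) (finite_subsets_at_top UNIV)"
    by (rule tendsto_ennrealI)
  moreover have "eventually (\<lambda>J. ennreal (wnorm p W x (\<Sum>Q\<in>J. G Q *s s Q)) \<le> ?R) (finite_subsets_at_top UNIV)"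
  proof (rule eventually_mono[OF eventually_finite_subsets_at_top_weakI[of UNIV "\<lambda>J. finite J"]])
    fix J :: "((int^'d) \<times> int) set" assume J: "finite J"
    have "wnorm p W x (\<Sum>Q\<in>J. G Q *s s Q) \<le> (\<Sum>Q\<in>J. norm (G Q) * wnorm p W x (s Q))"
      using J
    proof (induction J rule: finite_induct)
      case (insert Q J)
      have "wnorm p W x (G Q *s s Q + (\<Sum>Q\<in>J. G Q *s s Q)) \<le> wnorm p W x (G Q *s s Q) + wnorm p W x (\<Sum>Q\<in>J. G Q *s s Q)"
        by (rule wnorm_triangle)
      then show ?case using insert by (simp add: wnorm_scale)
    qed (simp add: wnorm_def)
    then have "ennreal (wnorm p W x (\<Sum>Q\<in>J. G Q *s s Q)) \<le> ennreal (\<Sum>Q\<in>J. norm (G Q) * wnorm p W x (s Q))"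
      by (rule ennreal_leI)
    also have "\<dots> = (\<Sum>Q\<in>J. ennreal (norm (G Q) * wnorm p W x (s Q)))"
      by (rule sum_ennreal[symmetric]) (simp add: wnorm_nonneg)
    also have "\<dots> \<le> ?R" by (rule sum_le_nn_integral_count_space[OF J]) simp
    finally show "ennreal (wnorm p W x (\<Sum>Q\<in>J. G Q *s s Q)) \<le> ?R" .
  qed auto
  ultimately have "ennreal (wnorm p W x v) \<le> ?R"
    by (rule tendsto_upperbound) simp
  then show ?thesis by (simp add: v_def G_def)
qed

lemma weight_sum_bounded:
  fixes \<theta> :: real
  assumes \<theta>: "0 \<le> \<theta>" "\<theta> < 1" and N: "2 * CARD('d) \<le> N"
  shows "\<exists>K>0. \<forall>k x. (\<integral>\<^sup>+(j, l). ennreal (\<theta> ^ nat \<bar>k - l\<bar> / (1 + norm (Z l x - ivec j)) ^ N) \<partial>count_space UNIV) \<le> ennreal K"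
proof -
  obtain K where K: "K > 0" "\<And>x::real^'d. (\<integral>\<^sup>+j. ennreal (1 / (1 + norm (x - ivec j)) ^ (2 * CARD('d))) \<partial>count_space UNIV) \<le> ennreal K"
    using lattice_sum_bounded by blast
  have "(\<integral>\<^sup>+(j, l). ennreal (\<theta> ^ nat \<bar>k - l\<bar> / (1 + norm (Z l x - ivec j)) ^ N) \<partial>count_space UNIV) \<le> ennreal (K * (2 / (1 - \<theta>)))" for k x
  proof -
    have "(\<integral>\<^sup>+(j, l). ennreal (\<theta> ^ nat \<bar>k - l\<bar> / (1 + norm (Z l x - ivec j)) ^ N) \<partial>count_space UNIV)
        = (\<integral>\<^sup>+l. (\<integral>\<^sup>+j. ennreal (\<theta> ^ nat \<bar>k - l\<bar> / (1 + norm (Z l x - ivec j)) ^ N) \<partial>count_space UNIV) \<partial>count_space UNIV)"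
      by (subst nn_integral_snd_count_space[symmetric]) simp
    also have "\<dots> \<le> (\<integral>\<^sup>+l. ennreal (\<theta> ^ nat \<bar>k - l\<bar>) * ennreal K \<partial>count_space UNIV)"
    proof (rule nn_integral_mono)
      fix l
      have "(\<integral>\<^sup>+j. ennreal (\<theta> ^ nat \<bar>k - l\<bar> / (1 + norm (Z l x - ivec j)) ^ N) \<partial>count_space UNIV)
          \<le> (\<integral>\<^sup>+j. ennreal (\<theta> ^ nat \<bar>k - l\<bar>) * ennreal (1 / (1 + norm (Z l x - ivec j)) ^ (2 * CARD('d))) \<partial>count_space UNIV)"
      proof (rule nn_integral_mono)
        fix j
        have "(1 + norm (Z l x - ivec j)) ^ (2 * CARD('d)) \<le> (1 + norm (Z l x - ivec j)) ^ N"
          using N by (intro power_increasing) auto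
        then have "\<theta> ^ nat \<bar>k - l\<bar> / (1 + norm (Z l x - ivec j)) ^ N \<le> \<theta> ^ nat \<bar>k - l\<bar> * (1 / (1 + norm (Z l x - ivec j)) ^ (2 * CARD('d)))"
          using \<theta> by (simp add: divide_left_mono add_pos_nonneg)
        then show "ennreal (\<theta> ^ nat \<bar>k - l\<bar> / (1 + norm (Z l x - ivec j)) ^ N)
            \<le> ennreal (\<theta> ^ nat \<bar>k - l\<bar>) * ennreal (1 / (1 + norm (Z l x - ivec j)) ^ (2 * CARD('d)))"
          using \<theta> by (subst ennreal_mult[symmetric]) (auto intro: ennreal_leI)
      qed
      also have "\<dots> = ennreal (\<theta> ^ nat \<bar>k - l\<bar>) * (\<integral>\<^sup>+j. ennreal (1 / (1 + norm (Z l x - ivec j)) ^ (2 * CARD('d))) \<partial>count_space UNIV)"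
        by (rule nn_integral_cmult) simp
      also have "\<dots> \<le> ennreal (\<theta> ^ nat \<bar>k - l\<bar>) * ennreal K" by (intro mult_left_mono K) auto
      finally show "(\<integral>\<^sup>+j. ennreal (\<theta> ^ nat \<bar>k - l\<bar> / (1 + norm (Z l x - ivec j)) ^ N) \<partial>count_space UNIV) \<le> \<dots>" .
    qed
    also have "\<dots> = (\<integral>\<^sup>+l. ennreal (\<theta> ^ nat \<bar>k - l\<bar>) \<partial>count_space UNIV) * ennreal K"
      by (rule nn_integral_multc) simp
    also have "\<dots> \<le> ennreal (2 / (1 - \<theta>)) * ennreal K"
      by (intro mult_right_mono nn_integral_geometric_int \<theta>) auto
    also have "\<dots> = ennreal (K * (2 / (1 - \<theta>)))" using K(1) \<theta> by (subst ennreal_mult[symmetric]) (auto simp: mult.commute)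
    finally show ?thesis .
  qed
  moreover have "0 < K * (2 / (1 - \<theta>))" using K(1) \<theta> by simp
  ultimately show ?thesis by blast
qed

lemma level_estimate:
  fixes W :: "real^'d \<Rightarrow> complex^'m^'m"
  assumes W: "doubling_weight A \<Delta> p W" and p: "1 \<le> p"
    and \<psi>: "\<psi> \<in> schwartz" "moment_free \<psi>" and \<phi>: "\<phi> \<in> schwartz" "moment_free \<phi>" and \<theta>: "0 < \<theta>" "\<theta> < 1"
  shows "\<exists>C\<ge>0. \<forall>s F k. inv_transform_has_sum A \<psi> s F \<longrightarrow>
     LpW_norm p W (\<lambda>x. \<chi> i. conv_class (F $ i) (dilate A \<phi> k) x)
     \<le> ennreal C * (\<integral>\<^sup>+l. ennreal (\<theta> ^ nat \<bar>k - l\<bar>) * seq_level p W s l \<partial>count_space UNIV)"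
proof -
  have mw: "matrix_weight W" using W by (simp add: doubling_weight_def)
  have p0: "0 < p" using p by simp
  note [measurable] = borel_measurable_wnorm_powr[OF mw p] borel_measurable_wnorm[OF mw p]
  obtain N K1 where N: "2 * CARD('d) \<le> N" and K1: "0 \<le> K1" "\<And>y j l.
    (\<integral>\<^sup>+x. ennreal (1 / (1 + norm (Z l x - ivec j)) ^ N) * ennreal (wnorm p W x y powr p) \<partial>lebesgue)
      \<le> ennreal K1 * emeasure (weight_measure p W y) (dcube A j l)"
    using weighted_tail[OF W p] by blast
  obtain C0 where C0: "C0 \<ge> 0" "\<And>j l k x. norm (LINT y|lebesgue. psi_cube A \<psi> (j, l) y * dilate A \<phi> k (x - y))
     \<le> C0 * \<delta> powr (real_of_int l / 2) * (\<theta> * \<theta>) ^ nat \<bar>k - l\<bar> / (1 + norm (Z l x - ivec j)) ^ (N + N)"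
    using almost_orthogonality[OF \<phi> \<psi>, of "\<theta> * \<theta>" "N + N"] \<theta> by auto
  obtain K2 where K2: "K2 > 0" "\<And>k x. (\<integral>\<^sup>+(j, l). ennreal (\<theta> ^ nat \<bar>k - l\<bar> / (1 + norm (Z l x - ivec j)) ^ N) \<partial>count_space UNIV) \<le> ennreal K2"
    using weight_sum_bounded[of \<theta> N] \<theta> N by auto
  define C where "C = (C0 * K2) powr p * K1"
  have C: "0 \<le> C" using K1 by (simp add: C_def)
  have "LpW_norm p W (\<lambda>x. \<chi> i. conv_class (F $ i) (dilate A \<phi> k) x)
     \<le> ennreal (C powr (1 / p)) * (\<integral>\<^sup>+l. ennreal (\<theta> ^ nat \<bar>k - l\<bar>) * seq_level p W s l \<partial>count_space UNIV)"
    if F: "inv_transform_has_sum A \<psi> s F" for s F k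
  proof -
    let ?f = "\<lambda>x. \<chi> i. conv_class (F $ i) (dilate A \<phi> k) x"
    \<comment> \<open>Split each kernel into two equal factors: one is summable over all cubes, the other keeps the decay.\<close>
    define c where "c x = (\<lambda>(j, l). \<theta> ^ nat \<bar>k - l\<bar> / (1 + norm (Z l x - ivec j)) ^ N)" for x
    define a where "a x = (\<lambda>(j, l). \<delta> powr (real_of_int l / 2) * wnorm p W x (s (j, l)))" for x
    have ca: "0 \<le> c x Q" "0 \<le> a x Q" for x Q
      using \<theta> by (auto simp: c_def a_def wnorm_nonneg split: prod.splits)
    have pw: "ennpowr (ennreal (wnorm p W x (?f x))) p
        \<le> ennreal ((C0 * K2) powr p) * (\<integral>\<^sup>+Q. ennpowr (ennreal (c x Q) * ennreal (a x Q)) p \<partial>count_space UNIV)" for x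
    proof -
      have "ennreal (wnorm p W x (?f x))
          \<le> (\<integral>\<^sup>+Q. ennreal (norm (LINT y|lebesgue. psi_cube A \<psi> Q y * dilate A \<phi> k (x - y)) * wnorm p W x (s Q)) \<partial>count_space UNIV)"
        by (rule wnorm_transform_le[OF F \<psi>(1) \<phi>])
      also have "\<dots> \<le> (\<integral>\<^sup>+Q. ennreal C0 * (ennreal (c x Q) * (ennreal (c x Q) * ennreal (a x Q))) \<partial>count_space UNIV)"
      proof (rule nn_integral_mono)
        fix Q :: "(int^'d) \<times> int"
        obtain j l where Q: "Q = (j, l)" by (cases Q)
        have "norm (LINT y|lebesgue. psi_cube A \<psi> Q y * dilate A \<phi> k (x - y)) * wnorm p W x (s Q)
            \<le> C0 * \<delta> powr (real_of_int l / 2) * (\<theta> * \<theta>) ^ nat \<bar>k - l\<bar> / (1 + norm (Z l x - ivec j)) ^ (N + N) * wnorm p W x (s Q)"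
          unfolding Q by (intro mult_right_mono C0 wnorm_nonneg)
        also have "\<dots> = C0 * (c x Q * (c x Q * a x Q))"
          by (simp add: c_def a_def Q power_add power_mult_distrib)
        finally show "ennreal (norm (LINT y|lebesgue. psi_cube A \<psi> Q y * dilate A \<phi> k (x - y)) * wnorm p W x (s Q))
            \<le> ennreal C0 * (ennreal (c x Q) * (ennreal (c x Q) * ennreal (a x Q)))"
          using C0(1) ca[of x Q] by (simp add: ennreal_mult[symmetric] ennreal_leI)
      qed
      also have "\<dots> = ennreal C0 * (\<integral>\<^sup>+Q. ennreal (c x Q) * (ennreal (c x Q) * ennreal (a x Q)) \<partial>count_space UNIV)"
        by (rule nn_integral_cmult) simp
      finally have "ennpowr (ennreal (wnorm p W x (?f x))) p
          \<le> ennpowr (ennreal C0 * (\<integral>\<^sup>+Q. ennreal (c x Q) * (ennreal (c x Q) * ennreal (a x Q)) \<partial>count_space UNIV)) p"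
        using p by (intro ennpowr_mono) auto
      also have "\<dots> = ennreal (C0 powr p) * ennpowr (\<integral>\<^sup>+Q. ennreal (c x Q) * (ennreal (c x Q) * ennreal (a x Q)) \<partial>count_space UNIV) p"
        using p C0(1) by (simp add: ennpowr_mult ennpowr_ennreal)
      also have "\<dots> \<le> ennreal (C0 powr p) * (ennpowr (ennreal K2) p * (\<integral>\<^sup>+Q. ennpowr (ennreal (c x Q) * ennreal (a x Q)) p \<partial>count_space UNIV))"
        using K2(2)[of k x] by (intro mult_left_mono ennpowr_sum_weighted p0) (auto simp: c_def split_beta')
      also have "\<dots> = ennreal ((C0 * K2) powr p) * (\<integral>\<^sup>+Q. ennpowr (ennreal (c x Q) * ennreal (a x Q)) p \<partial>count_space UNIV)"
        using C0(1) K2(1) by (simp add: ennpowr_ennreal powr_mult ennreal_mult mult.assoc)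
      finally show ?thesis .
    qed
    have ca_le: "ennpowr (ennreal (c x (j, l)) * ennreal (a x (j, l))) p
        \<le> ennreal ((\<theta> powr p) ^ nat \<bar>k - l\<bar>) * (ennreal (\<delta> powr (real_of_int l / 2 * p)) *
           (ennreal (1 / (1 + norm (Z l x - ivec j)) ^ N) * ennreal (wnorm p W x (s (j, l)) powr p)))" for x j l
    proof -
      let ?t = "1 / (1 + norm (Z l x - ivec j)) ^ N"
      have t: "0 \<le> ?t" "?t \<le> 1" by (auto simp: divide_le_eq_1 one_le_power add_pos_nonneg)
      \<comment> \<open>The tail factor is at most \<open>1\<close>, so its power may be dropped; the other factors are kept exactly.\<close>
      have "ennpowr (ennreal ?t) p \<le> ennreal ?t" by (rule ennpowr_le_self) (use t p in auto)
      moreover have "ennreal (c x (j, l)) * ennreal (a x (j, l)) = ennreal (\<theta> ^ nat \<bar>k - l\<bar>) * (ennreal (\<delta> powr (real_of_int l / 2)) * (ennreal ?t * ennreal (wnorm p W x (s (j, l)))))"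
        using \<theta> by (simp add: c_def a_def wnorm_nonneg ennreal_mult[symmetric])
      moreover have "ennpowr (ennreal (\<theta> ^ nat \<bar>k - l\<bar>)) p = ennreal ((\<theta> powr p) ^ nat \<bar>k - l\<bar>)"
        using \<theta> by (simp add: ennpowr_ennreal powr_powr powr_realpow[symmetric] mult.commute)
      ultimately show ?thesis
        using p0 by (simp add: ennpowr_mult ennpowr_ennreal[of "wnorm _ _ _ _"] ennpowr_ennreal[of "\<delta> powr _"] wnorm_nonneg powr_powr mult_left_mono mult_right_mono)
    qed
    have cm: "(\<lambda>x. ennpowr (ennreal (c x Q) * ennreal (a x Q)) p) \<in> borel_measurable lebesgue" for Q
    proof -
      obtain j l where Q: "Q = (j, l)" by (cases Q)
      have "(\<lambda>x. c x Q) \<in> borel_measurable lebesgue"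
        unfolding c_def Q prod.case by (intro lebesgue_measurable_borel) measurable
      moreover have "(\<lambda>x. a x Q) \<in> borel_measurable lebesgue" unfolding a_def Q prod.case by measurable
      ultimately show ?thesis by measurable
    qed
    have "(\<integral>\<^sup>+x. ennpowr (ennreal (wnorm p W x (?f x))) p \<partial>lebesgue)
        \<le> (\<integral>\<^sup>+x. ennreal ((C0 * K2) powr p) * (\<integral>\<^sup>+Q. ennpowr (ennreal (c x Q) * ennreal (a x Q)) p \<partial>count_space UNIV) \<partial>lebesgue)"
      by (intro nn_integral_mono pw)
    also have "\<dots> = (\<integral>\<^sup>+x. (\<integral>\<^sup>+Q. ennreal ((C0 * K2) powr p) * ennpowr (ennreal (c x Q) * ennreal (a x Q)) p \<partial>count_space UNIV) \<partial>lebesgue)"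
      by (simp add: nn_integral_cmult)
    also have "\<dots> = (\<integral>\<^sup>+Q. (\<integral>\<^sup>+x. ennreal ((C0 * K2) powr p) * ennpowr (ennreal (c x Q) * ennreal (a x Q)) p \<partial>lebesgue) \<partial>count_space UNIV)"
      using cm by (intro nn_integral_count_space_nn_integral) auto
    also have "\<dots> = ennreal ((C0 * K2) powr p) * (\<integral>\<^sup>+Q. (\<integral>\<^sup>+x. ennpowr (ennreal (c x Q) * ennreal (a x Q)) p \<partial>lebesgue) \<partial>count_space UNIV)"
      by (simp add: nn_integral_cmult cm)
    also have "(\<integral>\<^sup>+Q. (\<integral>\<^sup>+x. ennpowr (ennreal (c x Q) * ennreal (a x Q)) p \<partial>lebesgue) \<partial>count_space UNIV)
        = (\<integral>\<^sup>+l. (\<integral>\<^sup>+j. (\<integral>\<^sup>+x. ennpowr (ennreal (c x (j, l)) * ennreal (a x (j, l))) p \<partial>lebesgue) \<partial>count_space UNIV) \<partial>count_space UNIV)"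
      by (rule nn_integral_snd_count_space[symmetric])
    also have "\<dots> \<le> (\<integral>\<^sup>+l. ennreal ((\<theta> powr p) ^ nat \<bar>k - l\<bar>) * (ennreal K1 * ennpowr (seq_level p W s l) p) \<partial>count_space UNIV)"
    proof (rule nn_integral_mono)
      fix l
      let ?S = "ennreal ((\<theta> powr p) ^ nat \<bar>k - l\<bar>)" and ?d = "ennreal (\<delta> powr (real_of_int l / 2 * p))"
      let ?M = "\<lambda>j. emeasure (weight_measure p W (s (j, l))) (dcube A j l)"
      have "(\<integral>\<^sup>+x. ennpowr (ennreal (c x (j, l)) * ennreal (a x (j, l))) p \<partial>lebesgue) \<le> ?S * (ennreal K1 * (?d * ?M j))" for j
      proof -
        have [measurable]: "(\<lambda>x. ennreal (1 / (1 + norm (Z l x - ivec j)) ^ N)) \<in> borel_measurable lebesgue"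
          by (intro lebesgue_measurable_borel) measurable
        have "(\<integral>\<^sup>+x. ennpowr (ennreal (c x (j, l)) * ennreal (a x (j, l))) p \<partial>lebesgue)
            \<le> (\<integral>\<^sup>+x. ?S * (?d * (ennreal (1 / (1 + norm (Z l x - ivec j)) ^ N) * ennreal (wnorm p W x (s (j, l)) powr p))) \<partial>lebesgue)"
          by (intro nn_integral_mono ca_le)
        also have "\<dots> = ?S * (\<integral>\<^sup>+x. ?d * (ennreal (1 / (1 + norm (Z l x - ivec j)) ^ N) * ennreal (wnorm p W x (s (j, l)) powr p)) \<partial>lebesgue)"
          by (rule nn_integral_cmult) measurable
        also have "(\<integral>\<^sup>+x. ?d * (ennreal (1 / (1 + norm (Z l x - ivec j)) ^ N) * ennreal (wnorm p W x (s (j, l)) powr p)) \<partial>lebesgue) = ?d * (\<integral>\<^sup>+x. ennreal (1 / (1 + norm (Z l x - ivec j)) ^ N) * ennreal (wnorm p W x (s (j, l)) powr p) \<partial>lebesgue)"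
          by (rule nn_integral_cmult) measurable
        also have "?S * (?d * (\<integral>\<^sup>+x. ennreal (1 / (1 + norm (Z l x - ivec j)) ^ N) * ennreal (wnorm p W x (s (j, l)) powr p) \<partial>lebesgue)) \<le> ?S * (?d * (ennreal K1 * ?M j))" by (intro mult_left_mono K1) auto
        finally show ?thesis by (simp add: mult_ac)
      qed
      then have "(\<integral>\<^sup>+j. (\<integral>\<^sup>+x. ennpowr (ennreal (c x (j, l)) * ennreal (a x (j, l))) p \<partial>lebesgue) \<partial>count_space UNIV)
          \<le> (\<integral>\<^sup>+j. ?S * (ennreal K1 * (?d * ?M j)) \<partial>count_space UNIV)" by (intro nn_integral_mono)
      also have "\<dots> = ?S * (ennreal K1 * (\<integral>\<^sup>+j. ?d * ?M j \<partial>count_space UNIV))"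
        by (simp add: nn_integral_cmult)
      also have "\<dots> \<le> ?S * (ennreal K1 * ennpowr (seq_level p W s l) p)"
        by (intro mult_left_mono seq_level_lower[OF mw p]) auto
      finally show "(\<integral>\<^sup>+j. (\<integral>\<^sup>+x. ennpowr (ennreal (c x (j, l)) * ennreal (a x (j, l))) p \<partial>lebesgue) \<partial>count_space UNIV) \<le> \<dots>" .
    qed
    also have "\<dots> = ennreal K1 * (\<integral>\<^sup>+l. ennreal ((\<theta> powr p) ^ nat \<bar>k - l\<bar>) * ennpowr (seq_level p W s l) p \<partial>count_space UNIV)"
      by (simp add: nn_integral_cmult[symmetric] mult.left_commute)
    also have "(\<integral>\<^sup>+l. ennreal ((\<theta> powr p) ^ nat \<bar>k - l\<bar>) * ennpowr (seq_level p W s l) p \<partial>count_space UNIV)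
        = (\<integral>\<^sup>+l. ennpowr (ennreal (\<theta> ^ nat \<bar>k - l\<bar>) * seq_level p W s l) p \<partial>count_space UNIV)"
      using p0 \<theta> by (simp add: ennpowr_mult ennpowr_ennreal powr_powr powr_realpow[symmetric] mult.commute)
    also have "\<dots> \<le> ennpowr (\<integral>\<^sup>+l. ennreal (\<theta> ^ nat \<bar>k - l\<bar>) * seq_level p W s l \<partial>count_space UNIV) p"
      by (rule ennpowr_superadditive[OF p])
    finally have "(\<integral>\<^sup>+x. ennpowr (ennreal (wnorm p W x (?f x))) p \<partial>lebesgue)
        \<le> ennreal C * ennpowr (\<integral>\<^sup>+l. ennreal (\<theta> ^ nat \<bar>k - l\<bar>) * seq_level p W s l \<partial>count_space UNIV) p"
      using K1(1) by (simp add: C_def ennreal_mult mult.assoc mult_left_mono)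
    then have "LpW_norm p W ?f \<le> ennpowr (ennreal C * ennpowr (\<integral>\<^sup>+l. ennreal (\<theta> ^ nat \<bar>k - l\<bar>) * seq_level p W s l \<partial>count_space UNIV) p) (1 / p)"
      unfolding LpW_norm_def Lp_norm_def using p by (intro ennpowr_mono) auto
    also have "\<dots> = ennreal (C powr (1 / p)) * (\<integral>\<^sup>+l. ennreal (\<theta> ^ nat \<bar>k - l\<bar>) * seq_level p W s l \<partial>count_space UNIV)"
      using p0 C by (simp add: ennpowr_mult ennpowr_inverse ennpowr_ennreal)
    finally show ?thesis .
  qed
  then show ?thesis by (intro exI[of _ "C powr (1 / p)"]) auto
qed

lemma besov_norm_estimate:
  fixes W :: "real^'d \<Rightarrow> complex^'m^'m"
  assumes W: "doubling_weight A \<Delta> p W" and p: "1 \<le> p" and q: "0 < q"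
    and \<psi>: "\<psi> \<in> schwartz" "moment_free \<psi>" and \<phi>: "\<phi> \<in> schwartz" "moment_free \<phi>"
  shows "\<exists>C>0. \<forall>s F. inv_transform_has_sum A \<psi> s F \<longrightarrow>
     besov_norm \<alpha> q p A \<phi> W F \<le> ennreal C * besov_seq_norm \<alpha> q p A W s"
proof -
  obtain D where D: "D \<ge> 1" "\<And>t. \<delta> powr t \<le> D powr \<bar>t\<bar>" using \<delta>_bound by blast
  define E where "E = D powr \<bar>\<alpha>\<bar>"
  have E: "1 \<le> E" using D by (simp add: E_def ge_one_powr_ge_zero)
  \<comment> \<open>\<open>E\<close> is the cost per level of moving the factor \<open>\<bar>det A\<bar>\<^sup>k\<^sup>\<alpha>\<close> from \<open>k\<close> to \<open>l\<close>; a convergent kernel remains.\<close>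
  define \<theta> where "\<theta> = 1 / (2 * E)"
  have \<theta>: "0 < \<theta>" "\<theta> < 1" "\<theta> * E = 1 / 2" using E by (auto simp: \<theta>_def)
  obtain C where C: "C \<ge> 0" "\<And>s F k. inv_transform_has_sum A \<psi> s F \<Longrightarrow>
     LpW_norm p W (\<lambda>x. \<chi> i. conv_class (F $ i) (dilate A \<phi> k) x)
     \<le> ennreal C * (\<integral>\<^sup>+l. ennreal (\<theta> ^ nat \<bar>k - l\<bar>) * seq_level p W s l \<partial>count_space UNIV)"
    using level_estimate[OF W p \<psi> \<phi> \<theta>(1,2)] by blast
  obtain K where K: "K > 0" "\<And>a b. (\<And>k. a k \<le> ennreal C * (\<integral>\<^sup>+l. ennreal ((1 / 2) ^ nat \<bar>k - l\<bar>) * b l \<partial>count_space UNIV))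
    \<Longrightarrow> lq_norm q a \<le> ennreal K * lq_norm q b"
    using lq_norm_geometric_convolution[of "1 / 2" C q] C(1) q by auto
  have "besov_norm \<alpha> q p A \<phi> W F \<le> ennreal K * besov_seq_norm \<alpha> q p A W s" if F: "inv_transform_has_sum A \<psi> s F" for s F
    unfolding besov_norm_def besov_seq_norm_eq \<delta>_def[symmetric]
  proof (rule K(2))
    fix k
    let ?N = "LpW_norm p W (\<lambda>x. \<chi> i. conv_class (F $ i) (dilate A \<phi> k) x)"
    have "ennreal (\<delta> powr (real_of_int k * \<alpha>)) * ?N
        \<le> ennreal (\<delta> powr (real_of_int k * \<alpha>)) * (ennreal C * (\<integral>\<^sup>+l. ennreal (\<theta> ^ nat \<bar>k - l\<bar>) * seq_level p W s l \<partial>count_space UNIV))"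
      by (intro mult_left_mono C(2) F) auto
    also have "\<dots> = ennreal C * (\<integral>\<^sup>+l. ennreal (\<delta> powr (real_of_int k * \<alpha>)) * (ennreal (\<theta> ^ nat \<bar>k - l\<bar>) * seq_level p W s l) \<partial>count_space UNIV)"
      by (subst nn_integral_cmult) (simp_all add: mult.left_commute)
    also have "\<dots> \<le> ennreal C * (\<integral>\<^sup>+l. ennreal ((1 / 2) ^ nat \<bar>k - l\<bar>) * (ennreal (\<delta> powr (real_of_int l * \<alpha>)) * seq_level p W s l) \<partial>count_space UNIV)"
    proof (intro mult_left_mono nn_integral_mono)
      fix l
      have "\<delta> powr (real_of_int k * \<alpha>) = \<delta> powr (real_of_int (k - l) * \<alpha>) * \<delta> powr (real_of_int l * \<alpha>)"
        by (simp add: left_diff_distrib flip: powr_add)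
      also have "\<dots> \<le> E ^ nat \<bar>k - l\<bar> * \<delta> powr (real_of_int l * \<alpha>)"
      proof (rule mult_right_mono)
        have "\<delta> powr (real_of_int (k - l) * \<alpha>) \<le> D powr \<bar>real_of_int (k - l) * \<alpha>\<bar>" by (rule D(2))
        also have "\<dots> = E ^ nat \<bar>k - l\<bar>"
          using D(1) E by (simp add: E_def powr_realpow[symmetric] powr_powr abs_mult mult.commute)
        finally show "\<delta> powr (real_of_int (k - l) * \<alpha>) \<le> E ^ nat \<bar>k - l\<bar>" .
      qed simp
      finally have "\<delta> powr (real_of_int k * \<alpha>) * \<theta> ^ nat \<bar>k - l\<bar> \<le> E ^ nat \<bar>k - l\<bar> * \<delta> powr (real_of_int l * \<alpha>) * \<theta> ^ nat \<bar>k - l\<bar>"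
        using \<theta> by (intro mult_right_mono) auto
      also have "\<dots> = (\<theta> * E) ^ nat \<bar>k - l\<bar> * \<delta> powr (real_of_int l * \<alpha>)" by (simp add: power_mult_distrib mult_ac)
      finally have "\<delta> powr (real_of_int k * \<alpha>) * \<theta> ^ nat \<bar>k - l\<bar> \<le> (1 / 2) ^ nat \<bar>k - l\<bar> * \<delta> powr (real_of_int l * \<alpha>)"
        unfolding \<theta>(3) .
      then have "ennreal (\<delta> powr (real_of_int k * \<alpha>) * \<theta> ^ nat \<bar>k - l\<bar>) * seq_level p W s l
          \<le> ennreal ((1 / 2) ^ nat \<bar>k - l\<bar> * \<delta> powr (real_of_int l * \<alpha>)) * seq_level p W s l"
        by (intro mult_right_mono ennreal_leI) auto
      then show "ennreal (\<delta> powr (real_of_int k * \<alpha>)) * (ennreal (\<theta> ^ nat \<bar>k - l\<bar>) * seq_level p W s l)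
          \<le> ennreal ((1 / 2) ^ nat \<bar>k - l\<bar>) * (ennreal (\<delta> powr (real_of_int l * \<alpha>)) * seq_level p W s l)"
        using \<theta> by (simp add: ennreal_mult mult.assoc)
    qed auto
    finally show "ennreal (\<delta> powr (real_of_int k * \<alpha>)) * ?N \<le> \<dots>" .
  qed
  then show ?thesis using K(1) by blast
qed

end

theorem theorem3p1:
  fixes A :: "real^'d^'d" and \<Delta> :: "(real^'d) set"
    and W :: "real^'d \<Rightarrow> complex^'m^'m"
    and \<phi> \<psi> :: "real^'d \<Rightarrow> complex"
    and \<alpha> p :: real and q :: ennreal
  assumes "expansive A"
    and "dilation_ellipsoid A \<Delta>"
    and "1 \<le> p"
    and "0 < q"
    and "doubling_weight A \<Delta> p W"
    and "admissible_pair A \<phi> \<psi>"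
  shows "\<exists>C>0. \<forall>s \<in> besov_seq_space \<alpha> q p A W.
    inv_transform_has_sum A \<psi> s (inv_transform A \<psi> s) \<and>
    inv_transform A \<psi> s \<in> besov_space \<alpha> q p A \<phi> W \<and>
    besov_norm \<alpha> q p A \<phi> W (inv_transform A \<psi> s) \<le> ennreal C * besov_seq_norm \<alpha> q p A W s"
proof -
  note ellipsoid = assms(2)[unfolded dilation_ellipsoid_def]
  obtain P :: "real^'d^'d" where "invertible P" "\<Delta> = {x. norm (P *v x) < 1}"
    using conjunct1[OF ellipsoid] by blast
  moreover obtain r where "1 < r" "(*\<^sub>R) r ` \<Delta> \<subseteq> (*v) A ` \<Delta>"
    using conjunct2[OF conjunct2[OF ellipsoid]] by blast
  ultimately interpret dilation A P \<Delta> r by unfold_locales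
  have s: "\<phi> \<in> schwartz" "\<psi> \<in> schwartz"
    and "0 \<notin> closure {\<xi>. fourier \<phi> \<xi> \<noteq> 0}" "0 \<notin> closure {\<xi>. fourier \<psi> \<xi> \<noteq> 0}"
    using assms(6) by (auto simp: admissible_pair_def)
  then have m: "moment_free \<phi>" "moment_free \<psi>" by (auto intro: moment_free_fourier rapid_schwartz)
  obtain C where C: "C > 0" "\<And>s F. inv_transform_has_sum A \<psi> s F \<Longrightarrow>
     besov_norm \<alpha> q p A \<phi> W F \<le> ennreal C * besov_seq_norm \<alpha> q p A W s"
    using besov_norm_estimate[OF assms(5,3,4) s(2) m(2) s(1) m(1)] by blast
  have "inv_transform_has_sum A \<psi> s (inv_transform A \<psi> s) \<and>
    inv_transform A \<psi> s \<in> besov_space \<alpha> q p A \<phi> W \<and>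
    besov_norm \<alpha> q p A \<phi> W (inv_transform A \<psi> s) \<le> ennreal C * besov_seq_norm \<alpha> q p A W s"
    if sq: "s \<in> besov_seq_space \<alpha> q p A W" for s
  proof -
    have has: "inv_transform_has_sum A \<psi> s (inv_transform A \<psi> s)"
      unfolding inv_transform_def
      by (rule someI_ex[OF inv_transform_exists[OF assms(5,3,4) sq s(2) m(2)]])
    note bound = C(2)[OF has]
    have "ennreal C * besov_seq_norm \<alpha> q p A W s < \<infinity>"
      using sq by (simp add: besov_seq_space_def ennreal_mult_less_top)
    then have "besov_norm \<alpha> q p A \<phi> W (inv_transform A \<psi> s) < \<infinity>" by (rule le_less_trans[OF bound])
    moreover have "inv_transform A \<psi> s $ i \<in> tempered_mod_poly" for i
      using limitin_topspace[OF has[unfolded inv_transform_has_sum_def, rule_format, of i]]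
      by (simp only: topspace_tempered_mod_poly_topology)
    ultimately show ?thesis using has bound by (simp add: besov_space_def)
  qed
  then show ?thesis using C(1) by blast
qed

end
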